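(* Let $\omega>0$, let $g:[0,\infty)\to\mathbb{R}$ be nondecreasing and left-continuous, let $t_0=0$, $x_0\in\mathbb{R}^n$, and let $f,h:[0,\infty)\times\mathbb{R}^n\to\mathbb{R}^n$ be functions satisfying: (A0) For every $t\ge0$, the function $f(t,\cdot)$ is continuous. (A1* ) For every $u\in\mathbb{R}^n$ and every $a>0$, the function $f(\cdot,u)$ is Kurzweil--Stieltjes integrable with respect to $g$ on the interval $[0,a]$. (A2* ) There exists a function $M:[0,\infty)\times[0,\infty)\to[0,\infty)$ such that $M(\cdot,\alpha)$ is Kurzweil--Stieltjes integrable with respect to $g$ on $[0,a]$ for all $\alpha\ge0$ and all $a>0$, the function $M(s,\cdot)$ is nondecreasing for all $s\ge0$, and $\left\|\int_c^d f(s,u)\,\mathrm{d}g(s)\right\|\le\int_c^d M(s,\|u\|)\,\mathrm{d}g(s)$ for all $u\in\mathbb{R}^n$ and all $[c,d]\subseteq[0,\infty)$. (A3* ) For every $v\in\mathbb{R}^n$, the function $h(\cdot,v)$ is bounded and regulated on $[0,\infty)$, and there exists a function $\varphi:[0,\infty)\times[0,\infty)\to[0,\infty)$ such that for every $r\ge0$, $\varphi(\cdot,r)$ is a $\mathfrak{D}$-function satisfying $\varphi(t,r)<t$ for all $t>0$, and $\|h(t,u)-h(t,v)\|\le\varphi(\|u-v\|,r)$ for all $u,v\in\mathbb{R}^n$ with $\|u\|,\|v\|\le r$ and all $t\ge0$. Suppose that $$\liminf_{N\to\infty}\frac1N\left(\sup_{0\le t<\infty,\ \|u\|\le N}\|h(t,u)\|+\int_0^\infty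 M(s,N)\,\mathrm{d}g(s)\right)<1 ,$$ and that, in addition: (a) The function $h$ is uniformly S-asymptotically $\omega$-periodic on bounded sets. (b) For every $N>0$, the function $\mu(\cdot,N)$ given by $\mu(t,N)=\int_0^t M(s,N)\,\mathrm{d}g(s)$, $t\ge0$, is S-asymptotically $\omega$-periodic. Then the problem $$x(t)=x_0-h(0,x(0))+h(t,x(t))+\int_0^t f(s,x(s))\,\mathrm{d}g(s),\quad t\ge0,\qquad x(0)=x_0,$$ has an S-asymptotically $\omega$-periodic solution on $[0,\infty)$.
   Context: $\mathbb{R}^n$ carries a norm $\|\cdot\|$. A function on $[0,\infty)$ is regulated if it has a (finite) right limit at every $t\ge0$ and a left limit at every $t>0$. Kurzweil--Stieltjes integral: a gauge on $[a,b]$ is a function $\delta:[a,b]\to(0,\infty)$. A tagged partition $a=s_0\le s_1\le\dots\le s_k=b$ with tags $\tau_i\in[s_{i-1},s_i]$ is $\delta$-fine if $[s_{i-1},s_i]\subset(\tau_i-\delta(\tau_i),\tau_i+\delta(\tau_i))$ for all $i$. A function $f:[a,b]\to\mathbb{R}^n$ is Kurzweil--Stieltjes integrable with respect to $g:[a,b]\to\mathbb{R}$ if there is $\mathcal{I}\in\mathbb{R}^n$ such that for every $\varepsilon>0$ there is a gauge $\delta$ on $[a,b]$ with $\left\|\sum_{i=1}^k f(\tau_i)(g(s_i)-g(s_{i-1}))-\mathcal{I}\right\|<\varepsilon$ for all $\delta$-fine tagged partitions of $[a,b]$; then $\int_a^b f\,\mathrm{d}g:=\mathcal{I}$. All integrals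 are in this sense, and $\int_0^\infty M(s,N)\,\mathrm{d}g(s)=\lim_{t\to\infty}\int_0^t M(s,N)\,\mathrm{d}g(s)$ (possibly $+\infty$). A $\mathfrak{D}$-function is a continuous nondecreasing function $\psi:[0,\infty)\to[0,\infty)$ with $\psi(0)=0$ and $\psi(s)>0$ for $s>0$. A bounded regulated function $x:[0,\infty)\to X$ ($X$ a Banach space) is S-asymptotically $\omega$-periodic if $x(t+\omega)-x(t)\to0$ as $t\to\infty$. A function $p:[0,\infty)\times\mathbb{R}^n\to\mathbb{R}^n$ such that $p(\cdot,u)$ is bounded and regulated for every $u\in\mathbb{R}^n$ and $p(t,\cdot)$ is continuous for every $t\ge0$ is uniformly S-asymptotically $\omega$-periodic on bounded sets if $p(t+\omega,u)-p(t,u)\to0$ as $t\to\infty$, uniformly for $u$ in bounded subsets of $\mathbb{R}^n$. A solution of the problem on $[0,\infty)$ is a regulated function $x:[0,\infty)\to\mathbb{R}^n$ such that $t\mapsto h(t,x(t))$ is regulated, the integral equation holds for all $t\ge0$ (with the integral existing in the Kurzweil--Stieltjes sense), and $x(0)=x_0$. *)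

theory Defs
  imports "HOL-Analysis.Analysis"
begin

text \<open>
  The space \<open>\<real>\<^sup>n\<close> is \<open>real ^ 'n\<close>, and the norm it carries is an arbitrary function \<open>nrm\<close>
  satisfying the norm axioms, not only the Euclidean one. All norms on \<open>\<real>\<^sup>n\<close> are equivalent, so
  limits, continuity, boundedness and the Kurzweil-Stieltjes integral do not depend on the norm and
  are expressed with the standard library structure; the estimates in the hypotheses do depend on it
  and use \<open>nrm\<close>.

  A function on \<open>[0,\<infinity>)\<close> is a function on \<open>real\<close> of which only the values at nonnegative arguments
  are ever used.
\<close>

definition is_norm :: "('a::real_vector \<Rightarrow> real) \<Rightarrow> bool" where
  "is_norm nrm \<longleftrightarrow>
     (\<forall>x. 0 \<le> nrm x) \<and> (\<forall>x. nrm x = 0 \<longleftrightarrow> x = 0) \<and>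
     (\<forall>c x. nrm (c *\<^sub>R x) = \<bar>c\<bar> * nrm x) \<and> (\<forall>x y. nrm (x + y) \<le> nrm x + nrm y)"

definition regulated :: "(real \<Rightarrow> 'a::topological_space) \<Rightarrow> bool" where
  "regulated x \<longleftrightarrow>
     (\<forall>t\<ge>0. \<exists>l. (x \<longlongrightarrow> l) (at_right t)) \<and> (\<forall>t>0. \<exists>l. (x \<longlongrightarrow> l) (at_left t))"

definition gauge_on :: "(real \<Rightarrow> real) \<Rightarrow> real \<Rightarrow> real \<Rightarrow> bool" where
  "gauge_on \<delta> a b \<longleftrightarrow> (\<forall>t\<in>{a..b}. 0 < \<delta> t)"

text \<open>Tags are indexed from \<open>0\<close>: \<open>\<tau> i\<close> lies in \<open>[s i, s (Suc i)]\<close> for \<open>i < k\<close>.\<close>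

definition tagged_partition ::
  "real \<Rightarrow> real \<Rightarrow> nat \<Rightarrow> (nat \<Rightarrow> real) \<Rightarrow> (nat \<Rightarrow> real) \<Rightarrow> bool" where
  "tagged_partition a b k s \<tau> \<longleftrightarrow>
     s 0 = a \<and> s k = b \<and> (\<forall>i<k. s i \<le> \<tau> i \<and> \<tau> i \<le> s (Suc i))"

definition delta_fine :: "(real \<Rightarrow> real) \<Rightarrow> nat \<Rightarrow> (nat \<Rightarrow> real) \<Rightarrow> (nat \<Rightarrow> real) \<Rightarrow> bool" where
  "delta_fine \<delta> k s \<tau> \<longleftrightarrow>
     (\<forall>i<k. {s i..s (Suc i)} \<subseteq> {\<tau> i - \<delta> (\<tau> i)<..<\<tau> i + \<delta> (\<tau> i)})"

definition ks_has_integral ::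
  "(real \<Rightarrow> 'a::real_normed_vector) \<Rightarrow> (real \<Rightarrow> real) \<Rightarrow> real \<Rightarrow> real \<Rightarrow> 'a \<Rightarrow> bool" where
  "ks_has_integral f g a b I \<longleftrightarrow>
     a \<le> b \<and>
     (\<forall>\<epsilon>>0. \<exists>\<delta>. gauge_on \<delta> a b \<and>
        (\<forall>k s \<tau>. tagged_partition a b k s \<tau> \<and> delta_fine \<delta> k s \<tau> \<longrightarrow>
           norm ((\<Sum>i<k. (g (s (Suc i)) - g (s i)) *\<^sub>R f (\<tau> i)) - I) < \<epsilon>))"

definition ks_integrable ::
  "(real \<Rightarrow> 'a::real_normed_vector) \<Rightarrow> (real \<Rightarrow> real) \<Rightarrow> real \<Rightarrow> real \<Rightarrow> bool" where
  "ks_integrable f g a b \<longleftrightarrow> (\<exists>I. ks_has_integral f g a b I)"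

text \<open>The value is unique because \<open>\<delta>\<close>-fine tagged partitions exist for every gauge (Cousin's lemma).\<close>

definition ks_integral ::
  "(real \<Rightarrow> 'a::real_normed_vector) \<Rightarrow> (real \<Rightarrow> real) \<Rightarrow> real \<Rightarrow> real \<Rightarrow> 'a" where
  "ks_integral f g a b = (THE I. ks_has_integral f g a b I)"

text \<open>
  The limit exists in \<open>ereal\<close> for a nonnegative integrand and a nondecreasing integrator, since the
  integral is then nondecreasing in its upper limit.
\<close>

definition ks_integral_inf :: "(real \<Rightarrow> real) \<Rightarrow> (real \<Rightarrow> real) \<Rightarrow> ereal" where
  "ks_integral_inf f g = Lim at_top (\<lambda>t. ereal (ks_integral f g 0 t))"

definition D_function :: "(real \<Rightarrow> real) \<Rightarrow> bool" where
  "D_function \<psi> \<longleftrightarrow>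
     continuous_on {0..} \<psi> \<and> mono_on {0..} \<psi> \<and> \<psi> 0 = 0 \<and> (\<forall>s>0. 0 < \<psi> s)"

definition S_asymp_periodic :: "real \<Rightarrow> (real \<Rightarrow> 'a::banach) \<Rightarrow> bool" where
  "S_asymp_periodic \<omega> x \<longleftrightarrow>
     bounded (x ` {0..}) \<and> regulated x \<and> ((\<lambda>t. x (t + \<omega>) - x t) \<longlongrightarrow> 0) at_top"

definition unif_S_asymp_periodic_on_bounded ::
  "real \<Rightarrow> (real \<Rightarrow> real ^ 'n \<Rightarrow> real ^ 'n) \<Rightarrow> bool" where
  "unif_S_asymp_periodic_on_bounded \<omega> p \<longleftrightarrow>
     (\<forall>u. bounded ((\<lambda>t. p t u) ` {0..}) \<and> regulated (\<lambda>t. p t u)) \<and>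
     (\<forall>t\<ge>0. continuous_on UNIV (p t)) \<and>
     (\<forall>S. bounded S \<longrightarrow> uniform_limit S (\<lambda>t u. p (t + \<omega>) u - p t u) (\<lambda>u. 0) at_top)"

definition is_solution ::
  "(real \<Rightarrow> real ^ 'n \<Rightarrow> real ^ 'n) \<Rightarrow> (real \<Rightarrow> real ^ 'n \<Rightarrow> real ^ 'n) \<Rightarrow> (real \<Rightarrow> real) \<Rightarrow>
   real ^ 'n \<Rightarrow> (real \<Rightarrow> real ^ 'n) \<Rightarrow> bool" where
  "is_solution f h g x0 x \<longleftrightarrow>
     regulated x \<and> regulated (\<lambda>t. h t (x t)) \<and>
     (\<forall>t\<ge>0. ks_integrable (\<lambda>s. f s (x s)) g 0 t \<and>
        x t = x0 - h 0 (x 0) + h t (x t) + ks_integral (\<lambda>s. f s (x s)) g 0 t) \<and>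
     x 0 = x0"

end

theory Submission
  imports Defs "HOL-Complex_Analysis.Great_Picard"
begin

text \<open>
  Two ideas carry the proof: a change of variable that turns Kurzweil-Stieltjes integrals into
  Lebesgue integrals, and a pointwise inversion of the neutral term \<open>h\<close> that leaves an ordinary
  integral equation.

  Let \<open>ginv y\<close> be the last time \<open>t\<close> with \<open>g t \<le> y\<close>. Since \<open>g\<close> is nondecreasing and
  left-continuous, \<open>g t \<le> y\<close> is equivalent to \<open>t \<le> ginv y\<close>, and the integral of \<open>f\<close> with
  respect to \<open>g\<close> over \<open>[c, d]\<close> equals the integral of \<open>f (ginv y)\<close> with respect to \<open>y\<close> over
  \<open>[g c, g d]\<close>: a jump of \<open>g\<close> becomes an interval on which \<open>ginv\<close> is constant, and an interval of
  constancy of \<open>g\<close> becomes a single level. The integral over the levels is the Henstock-Kurzweil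
  integral, which like the Stieltjes integral may converge conditionally, and the two sides exist
  together (\<open>has_integral_of_ks\<close>, \<open>ks_of_integrable\<close>). On the levels, dominated convergence and the
  differentiation theorem are available. The latter turns the bound on the integrals of \<open>f\<close> by those
  of \<open>M\<close> into a pointwise bound at almost every level (\<open>ae_is_norm_le\<close>); a countable dense set of
  states makes the exceptional set independent of the state.

  The growth condition yields a radius \<open>N\<close> for which the norm of \<open>c0 = x0 - h 0 x0\<close>, the supremum
  of \<open>h\<close> over the ball of radius \<open>N\<close> and the total integral \<open>B\<close> of \<open>M s N\<close> add up to at most
  \<open>N\<close> (\<open>growth_radius\<close>). Given \<open>w\<close> of norm at most \<open>B\<close>, Brouwer's theorem solves
  \<open>x = c0 + w + h t x\<close> in that ball. The solution is unique because \<open>h t\<close> is a nonlinear contraction,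
  and it depends on \<open>w\<close> continuously, with a modulus that is the same for all \<open>t\<close> (\<open>modulus\<close>). The
  unknown is then only \<open>w t\<close>, the integral of \<open>f s (x s)\<close> up to time \<open>t\<close>. With \<open>w t = W (g t)\<close> it
  satisfies an equation \<open>W y = integral {g 0..y} (\<lambda>s. H s (W (G s)))\<close> in which \<open>H\<close> is a
  Caratheodory function with an integrable majorant and \<open>G s = g (ginv s) \<le> s\<close>. Tonelli's method
  solves it (\<open>caratheodory_delay_solution\<close>): an additional delay of \<open>1/k\<close> makes the equation
  explicit, the solutions are equicontinuous and have a convergent subsequence, and dominated
  convergence identifies the limit.

  The remaining properties of \<open>x\<close> follow from the modulus. One-sided limits of \<open>w\<close> and of \<open>h\<close> at
  fixed states give those of \<open>x\<close> (\<open>resolvent_limit\<close>). The increments of \<open>w\<close> over a period are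
  bounded by those of the integral of \<open>M s N\<close>, hence vanish at infinity, and so do those of \<open>h\<close>;
  therefore \<open>x (t + \<omega>) - x t\<close> vanishes too (\<open>tendsto_of_residual\<close>).
\<close>

section \<open>Riemann-Stieltjes sums and primitives\<close>

text \<open>
  The sums over the \<open>\<delta>\<close>-fine tagged partitions of an interval, built by appending one cell at a
  time, so that estimates telescope by rule induction and no partition points have to be indexed.
  A cell may be degenerate.
\<close>

inductive fine_sum ::
  "(real \<Rightarrow> 'a::real_normed_vector) \<Rightarrow> (real \<Rightarrow> real) \<Rightarrow> (real \<Rightarrow> real) \<Rightarrow> real \<Rightarrow> real \<Rightarrow> 'a \<Rightarrow> bool"
  for f g \<delta> c where
  empty: "fine_sum f g \<delta> c c 0"
| snoc: "fine_sum f g \<delta> c d S \<Longrightarrow> d \<le> \<tau> \<Longrightarrow> \<tau> \<le> e \<Longrightarrow> \<tau> - \<delta> \<tau> < d \<Longrightarrow> e < \<tau> + \<delta> \<tau> \<Longrightarrow>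
    fine_sum f g \<delta> c e (S + (g e - g d) *\<^sub>R f \<tau>)"

lemma fine_sum_le: "fine_sum f g \<delta> c d S \<Longrightarrow> c \<le> d"
  by (induction rule: fine_sum.induct) auto

lemma fine_sum_append:
  assumes "fine_sum f g \<delta> d e T" "fine_sum f g \<delta> c d S"
  shows "fine_sum f g \<delta> c e (S + T)"
  using assms
proof (induction rule: fine_sum.induct)
  case empty
  then show ?case by simp
next
  case (snoc d' T \<tau> e)
  have "fine_sum f g \<delta> c e ((S + T) + (g e - g d') *\<^sub>R f \<tau>)"
    by (rule fine_sum.snoc) (use snoc in auto)
  then show ?case by (simp add: add.assoc)
qed

lemma fine_sum_single:
  assumes "c \<le> \<tau>" "\<tau> \<le> d" "\<tau> - \<delta> \<tau> < c" "d < \<tau> + \<delta> \<tau>"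
  shows "fine_sum f g \<delta> c d ((g d - g c) *\<^sub>R f \<tau>)"
  using fine_sum.snoc[where f = f and g = g and \<delta> = \<delta>, OF fine_sum.empty assms] by simp

lemma fine_sum_gauge_mono:
  assumes "fine_sum f g \<delta> c d S" "\<And>t. c \<le> t \<Longrightarrow> t \<le> d \<Longrightarrow> \<delta> t \<le> \<delta>' t"
  shows "fine_sum f g \<delta>' c d S"
  using assms
proof (induction rule: fine_sum.induct)
  case empty
  show ?case by (rule fine_sum.empty)
next
  case (snoc d S \<tau> e)
  have "c \<le> d" using snoc.hyps(1) by (rule fine_sum_le)
  with snoc have "\<delta> \<tau> \<le> \<delta>' \<tau>" by auto
  then show ?case using snoc by (intro fine_sum.snoc) auto
qed

lemma fine_sum_imp_partition:
  assumes "fine_sum f g \<delta> a b S"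
  shows "\<exists>k s \<tau>. tagged_partition a b k s \<tau> \<and> delta_fine \<delta> k s \<tau> \<and>
            S = (\<Sum>i<k. (g (s (Suc i)) - g (s i)) *\<^sub>R f (\<tau> i))"
  using assms
proof (induction rule: fine_sum.induct)
  case empty
  show ?case
    by (rule exI[of _ 0], rule exI[of _ "\<lambda>_. a"], rule exI[of _ "\<lambda>_. a"])
       (auto simp: tagged_partition_def delta_fine_def)
next
  case (snoc d S t e)
  then obtain k s \<tau> where *: "tagged_partition a d k s \<tau>" "delta_fine \<delta> k s \<tau>"
      "S = (\<Sum>i<k. (g (s (Suc i)) - g (s i)) *\<^sub>R f (\<tau> i))" by blast
  define s' where "s' = s(Suc k := e)"
  define \<tau>' where "\<tau>' = \<tau>(k := t)"
  have s': "s' i = s i" if "i \<le> k" for i using that by (auto simp: s'_def)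
  have \<tau>': "\<tau>' i = \<tau> i" if "i < k" for i using that by (auto simp: \<tau>'_def)
  have se: "s' (Suc k) = e" "\<tau>' k = t" by (auto simp: s'_def \<tau>'_def)
  have sk: "s k = d" using * by (auto simp: tagged_partition_def)
  have "tagged_partition a e (Suc k) s' \<tau>'"
    using *(1) snoc.hyps sk by (auto simp: tagged_partition_def less_Suc_eq s' \<tau>' se)
  moreover have "delta_fine \<delta> (Suc k) s' \<tau>'"
    using *(2) snoc.hyps sk by (auto simp: delta_fine_def less_Suc_eq s' \<tau>' se)
  moreover have "S + (g e - g d) *\<^sub>R f t = (\<Sum>i<Suc k. (g (s' (Suc i)) - g (s' i)) *\<^sub>R f (\<tau>' i))"
    using sk by (simp add: *(3) s' \<tau>' se)
  ultimately show ?case by blast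
qed

lemma partition_imp_fine_sum:
  assumes "tagged_partition a b k s \<tau>" "delta_fine \<delta> k s \<tau>"
  shows "fine_sum f g \<delta> a b (\<Sum>i<k. (g (s (Suc i)) - g (s i)) *\<^sub>R f (\<tau> i))"
  using assms
proof (induction k arbitrary: b)
  case 0
  then show ?case by (auto simp: tagged_partition_def intro: fine_sum.empty)
next
  case (Suc k)
  have 1: "tagged_partition a (s k) k s \<tau>" "delta_fine \<delta> k s \<tau>"
    using Suc.prems by (auto simp: tagged_partition_def delta_fine_def)
  have 2: "s k \<le> \<tau> k" "\<tau> k \<le> s (Suc k)" "s (Suc k) = b"
    using Suc.prems by (auto simp: tagged_partition_def)
  have 3: "{s k..s (Suc k)} \<subseteq> {\<tau> k - \<delta> (\<tau> k)<..<\<tau> k + \<delta> (\<tau> k)}"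
    using Suc.prems by (auto simp: delta_fine_def)
  have "s k \<in> {s k..s (Suc k)}" "s (Suc k) \<in> {s k..s (Suc k)}" using 2 by auto
  with 3 have "\<tau> k - \<delta> (\<tau> k) < s k" "s (Suc k) < \<tau> k + \<delta> (\<tau> k)" by (auto simp del: atLeastAtMost_iff)
  then show ?case
    using fine_sum.snoc[OF Suc.IH[OF 1], of "\<tau> k" b] 2 by simp
qed

text \<open>
  Cousin's lemma: intervals that have a fine partition can be concatenated, and every point has a
  neighbourhood in which an interval around it is a single fine cell.
\<close>

lemma fine_sum_exists:
  assumes "a \<le> b" "\<And>t. a \<le> t \<Longrightarrow> t \<le> b \<Longrightarrow> 0 < \<delta> t"
  shows "\<exists>S. fine_sum f g \<delta> a b S"
  using assms(1)
proof (induction rule: Bolzano)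
  case (trans a b c)
  then show ?case using fine_sum_append by blast
next
  case (local x)
  show ?case
  proof (intro exI[of _ "\<delta> x"] conjI allI impI)
    show "0 < \<delta> x" using assms(2) local by auto
    fix c d assume "c \<le> x \<and> x \<le> d \<and> d - c < \<delta> x"
    then have "fine_sum f g \<delta> c d ((g d - g c) *\<^sub>R f x)" by (intro fine_sum_single) auto
    then show "\<exists>S. fine_sum f g \<delta> c d S" ..
  qed
qed

lemma ks_has_integral_fine_sum:
  "ks_has_integral f g a b I \<longleftrightarrow> a \<le> b \<and>
    (\<forall>\<epsilon>>0. \<exists>\<delta>. (\<forall>t. 0 < \<delta> t) \<and> (\<forall>S. fine_sum f g \<delta> a b S \<longrightarrow> norm (S - I) < \<epsilon>))"
proof (intro iffI conjI allI impI)
  assume L: "ks_has_integral f g a b I"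
  then show "a \<le> b" by (simp add: ks_has_integral_def)
  fix \<epsilon> :: real assume "\<epsilon> > 0"
  then obtain \<delta> where \<delta>: "gauge_on \<delta> a b" "\<And>k s \<tau>. tagged_partition a b k s \<tau> \<and> delta_fine \<delta> k s \<tau> \<Longrightarrow>
           norm ((\<Sum>i<k. (g (s (Suc i)) - g (s i)) *\<^sub>R f (\<tau> i)) - I) < \<epsilon>"
    using L unfolding ks_has_integral_def by blast
  define \<delta>' where "\<delta>' t = (if t \<in> {a..b} then \<delta> t else 1)" for t
  show "\<exists>\<delta>. (\<forall>t. 0 < \<delta> t) \<and> (\<forall>S. fine_sum f g \<delta> a b S \<longrightarrow> norm (S - I) < \<epsilon>)"
  proof (intro exI[of _ \<delta>'] conjI allI impI)
    show "0 < \<delta>' t" for t using \<delta>(1) by (auto simp: \<delta>'_def gauge_on_def)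
    fix S assume "fine_sum f g \<delta>' a b S"
    then have "fine_sum f g \<delta> a b S" by (rule fine_sum_gauge_mono) (auto simp: \<delta>'_def)
    then show "norm (S - I) < \<epsilon>" using \<delta>(2) fine_sum_imp_partition by blast
  qed
next
  assume R: "a \<le> b \<and> (\<forall>\<epsilon>>0. \<exists>\<delta>. (\<forall>t. 0 < \<delta> t) \<and> (\<forall>S. fine_sum f g \<delta> a b S \<longrightarrow> norm (S - I) < \<epsilon>))"
  show "ks_has_integral f g a b I"
    unfolding ks_has_integral_def
  proof (intro conjI allI impI)
    show "a \<le> b" using R by simp
    fix \<epsilon> :: real assume "\<epsilon> > 0"
    then obtain \<delta> where \<delta>: "\<forall>t. 0 < \<delta> t" "\<And>S. fine_sum f g \<delta> a b S \<Longrightarrow> norm (S - I) < \<epsilon>"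
      using R by blast
    show "\<exists>\<delta>. gauge_on \<delta> a b \<and> (\<forall>k s \<tau>. tagged_partition a b k s \<tau> \<and> delta_fine \<delta> k s \<tau> \<longrightarrow>
           norm ((\<Sum>i<k. (g (s (Suc i)) - g (s i)) *\<^sub>R f (\<tau> i)) - I) < \<epsilon>)"
      using \<delta>(1) by (intro exI[of _ \<delta>]) (auto simp: gauge_on_def intro!: \<delta>(2) partition_imp_fine_sum)
  qed
qed

lemma ks_has_integral_unique:
  assumes "ks_has_integral f g a b I" "ks_has_integral f g a b J"
  shows "I = J"
proof (rule ccontr)
  assume "I \<noteq> J"
  then have e: "norm (I - J) / 2 > 0" by simp
  obtain \<delta>1 where \<delta>1: "\<forall>t. 0 < \<delta>1 t" "\<And>S. fine_sum f g \<delta>1 a b S \<Longrightarrow> norm (S - I) < norm (I - J) / 2"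
    using assms(1) e unfolding ks_has_integral_fine_sum by blast
  obtain \<delta>2 where \<delta>2: "\<forall>t. 0 < \<delta>2 t" "\<And>S. fine_sum f g \<delta>2 a b S \<Longrightarrow> norm (S - J) < norm (I - J) / 2"
    using assms(2) e unfolding ks_has_integral_fine_sum by blast
  have "a \<le> b" using assms(1) by (simp add: ks_has_integral_def)
  then obtain S where S: "fine_sum f g (\<lambda>t. min (\<delta>1 t) (\<delta>2 t)) a b S"
    using fine_sum_exists[of a b "\<lambda>t. min (\<delta>1 t) (\<delta>2 t)" f g] \<delta>1(1) \<delta>2(1) by auto
  have "norm (S - I) < norm (I - J) / 2" "norm (S - J) < norm (I - J) / 2"
    by (rule \<delta>1 \<delta>2, rule fine_sum_gauge_mono[OF S], simp)+
  then have "norm ((S - J) - (S - I)) < norm (I - J)"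
    using norm_triangle_ineq4[of "S - J" "S - I"] by linarith
  then show False by simp
qed

lemma ks_integral_unique: "ks_has_integral f g a b I \<Longrightarrow> ks_integral f g a b = I"
  unfolding ks_integral_def using ks_has_integral_unique by blast

text \<open>
  The tagged intervals that may occur in a \<open>\<delta>\<close>-fine tagged partition of \<open>[a, b]\<close>, where \<open>\<eta> = \<delta> \<tau>\<close>.
\<close>

abbreviation fine_cell :: "real \<Rightarrow> real \<Rightarrow> real \<Rightarrow> real \<Rightarrow> real \<Rightarrow> real \<Rightarrow> bool" where
  "fine_cell a b \<eta> c \<tau> d \<equiv> a \<le> c \<and> c \<le> \<tau> \<and> \<tau> \<le> d \<and> d \<le> b \<and> \<tau> - \<eta> < c \<and> d < \<tau> + \<eta>"

text \<open>
  Instead of bounding sums of errors over partitions, the errors of single cells are bounded by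
  the increments of one monotone function \<open>V\<close> of small total variation. This form of the
  Saks-Henstock lemma refers to one cell only, which is what makes it possible to carry it through
  a change of variable: partitions of the new interval need not come from partitions of the old
  one.
\<close>

definition ks_primitive ::
  "(real \<Rightarrow> 'a::real_normed_vector) \<Rightarrow> (real \<Rightarrow> real) \<Rightarrow> real \<Rightarrow> real \<Rightarrow> (real \<Rightarrow> 'a) \<Rightarrow> bool" where
  "ks_primitive f g a b \<Phi> \<longleftrightarrow> (\<forall>\<epsilon>>0. \<exists>\<delta> V. (\<forall>t. 0 < \<delta> t) \<and> mono_on {a..b} V \<and> V b - V a \<le> \<epsilon> \<and>
     (\<forall>c \<tau> d. fine_cell a b (\<delta> \<tau>) c \<tau> d \<longrightarrow>
        norm (\<Phi> d - \<Phi> c - (g d - g c) *\<^sub>R f \<tau>) \<le> V d - V c))"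

lemma ks_primitiveE:
  assumes "ks_primitive f g a b \<Phi>" "\<epsilon> > 0"
  obtains \<delta> V where "\<And>t. 0 < \<delta> t" "mono_on {a..b} V" "V b - V a \<le> \<epsilon>"
    "\<And>c \<tau> d. fine_cell a b (\<delta> \<tau>) c \<tau> d \<Longrightarrow>
        norm (\<Phi> d - \<Phi> c - (g d - g c) *\<^sub>R f \<tau>) \<le> V d - V c"
  using assms unfolding ks_primitive_def by metis

lemma ks_primitive_subinterval:
  assumes "ks_primitive f g a b \<Phi>" "a \<le> c" "c \<le> d" "d \<le> b"
  shows "ks_primitive f g c d \<Phi>"
  unfolding ks_primitive_def
proof (intro allI impI)
  fix \<epsilon> :: real assume "\<epsilon> > 0"
  from assms(1) this obtain \<delta> V where V: "\<And>t. 0 < \<delta> t" "mono_on {a..b} V" "V b - V a \<le> \<epsilon>"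
    "\<And>c \<tau> d. fine_cell a b (\<delta> \<tau>) c \<tau> d \<Longrightarrow>
        norm (\<Phi> d - \<Phi> c - (g d - g c) *\<^sub>R f \<tau>) \<le> V d - V c"
    by (rule ks_primitiveE) blast
  have "V a \<le> V c" "V d \<le> V b" using assms by (auto intro!: mono_onD[OF V(2)])
  moreover have "mono_on {c..d} V" by (rule mono_on_subset[OF V(2)]) (use assms in auto)
  ultimately show "\<exists>\<delta> V. (\<forall>t. 0 < \<delta> t) \<and> mono_on {c..d} V \<and> V d - V c \<le> \<epsilon> \<and>
     (\<forall>c' \<tau> d'. fine_cell c d (\<delta> \<tau>) c' \<tau> d' \<longrightarrow>
        norm (\<Phi> d' - \<Phi> c' - (g d' - g c') *\<^sub>R f \<tau>) \<le> V d' - V c')"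
    using V assms by (intro exI[of _ \<delta>] exI[of _ V]) auto
qed

lemma ks_primitive_imp_has_integral:
  assumes "ks_primitive f g a b \<Phi>" "a \<le> b"
  shows "ks_has_integral f g a b (\<Phi> b - \<Phi> a)"
  unfolding ks_has_integral_fine_sum
proof (intro conjI allI impI)
  show "a \<le> b" by fact
  fix \<epsilon> :: real assume \<epsilon>: "\<epsilon> > 0"
  then have "\<epsilon> / 2 > 0" by simp
  with assms(1) obtain \<delta> V where V: "\<And>t. 0 < \<delta> t" "mono_on {a..b} V" "V b - V a \<le> \<epsilon> / 2"
    "\<And>c \<tau> d. fine_cell a b (\<delta> \<tau>) c \<tau> d \<Longrightarrow>
        norm (\<Phi> d - \<Phi> c - (g d - g c) *\<^sub>R f \<tau>) \<le> V d - V c"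
    by (rule ks_primitiveE) blast
  have *: "fine_sum f g \<delta> a d S \<Longrightarrow> d \<le> b \<longrightarrow> norm (S - (\<Phi> d - \<Phi> a)) \<le> V d - V a" for d S
  proof (induction rule: fine_sum.induct)
    case (snoc d S \<tau> e)
    show ?case
    proof
      assume "e \<le> b"
      have "a \<le> d" using snoc.hyps(1) by (rule fine_sum_le)
      have 1: "norm (S - (\<Phi> d - \<Phi> a)) \<le> V d - V a" using snoc \<open>e \<le> b\<close> by auto
      have 2: "norm (\<Phi> e - \<Phi> d - (g e - g d) *\<^sub>R f \<tau>) \<le> V e - V d"
        using V(4)[of d \<tau> e] snoc \<open>e \<le> b\<close> \<open>a \<le> d\<close> by auto
      have "S + (g e - g d) *\<^sub>R f \<tau> - (\<Phi> e - \<Phi> a) = (S - (\<Phi> d - \<Phi> a)) - (\<Phi> e - \<Phi> d - (g e - g d) *\<^sub>R f \<tau>)"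
        by simp
      then have "norm (S + (g e - g d) *\<^sub>R f \<tau> - (\<Phi> e - \<Phi> a))
          = norm ((S - (\<Phi> d - \<Phi> a)) - (\<Phi> e - \<Phi> d - (g e - g d) *\<^sub>R f \<tau>))" by (rule arg_cong)
      then show "norm (S + (g e - g d) *\<^sub>R f \<tau> - (\<Phi> e - \<Phi> a)) \<le> V e - V a"
        using 1 2 norm_triangle_ineq4[of "S - (\<Phi> d - \<Phi> a)" "\<Phi> e - \<Phi> d - (g e - g d) *\<^sub>R f \<tau>"] by linarith
    qed
  qed simp
  show "\<exists>\<delta>. (\<forall>t. 0 < \<delta> t) \<and> (\<forall>S. fine_sum f g \<delta> a b S \<longrightarrow> norm (S - (\<Phi> b - \<Phi> a)) < \<epsilon>)"
  proof (intro exI[of _ \<delta>] conjI allI impI)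
    fix S assume "fine_sum f g \<delta> a b S"
    from *[OF this] V(3) \<epsilon> show "norm (S - (\<Phi> b - \<Phi> a)) < \<epsilon>" by simp
  qed (use V in auto)
qed

text \<open>
  On an interval where \<open>g\<close> is constant every Riemann-Stieltjes sum vanishes.
\<close>

lemma ks_primitive_flat:
  assumes p: "ks_primitive f g a b \<Phi>" and g: "mono_on {a..b} g"
    and st: "a \<le> s" "s \<le> t" "t \<le> b" "g s = g t"
  shows "\<Phi> s = \<Phi> t"
proof -
  have "ks_has_integral f g s t (\<Phi> t - \<Phi> s)"
    by (intro ks_primitive_imp_has_integral ks_primitive_subinterval[OF p] st)
  moreover have "ks_has_integral f g s t 0"
  proof -
    have gc: "g u = g s" if "s \<le> u" "u \<le> t" for u
      using mono_onD[OF g, of s u] mono_onD[OF g, of u t] that st by auto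
    have 0: "fine_sum f g \<delta> s d S \<Longrightarrow> d \<le> t \<longrightarrow> S = 0" for \<delta> d S
    proof (induction rule: fine_sum.induct)
      case (snoc d S \<tau> e)
      then show ?case using fine_sum_le[OF snoc.hyps(1)] gc[of d] gc[of e] by auto
    qed simp
    then show ?thesis unfolding ks_has_integral_fine_sum using st
      by (intro conjI allI impI exI[of _ "\<lambda>_. 1"]) (auto dest!: 0)
  qed
  ultimately show ?thesis using ks_has_integral_unique by fastforce
qed

text \<open>
  Perron's construction. Let \<open>U m t\<close> and \<open>L m t\<close> be the supremum and the infimum of the sums over
  \<open>[a, t]\<close> for the \<open>m\<close>-th of a decreasing sequence of gauges. Appending a cell to a partition
  shows that the increments of \<open>U m\<close> and \<open>L m\<close> over the cell bound its contribution to the sum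
  from above and from below. The two functions have a common limit \<open>\<Phi>\<close> as \<open>m\<close> grows, and the
  increments of \<open>\<Phi>\<close> lie between the same bounds. Hence \<open>U m - L m\<close> is a function \<open>V\<close> as required.
\<close>

lemma ks_has_integral_imp_primitive:
  fixes f :: "real \<Rightarrow> real"
  assumes "ks_has_integral f g a b I"
  obtains \<Phi> where "ks_primitive f g a b \<Phi>" "\<Phi> b - \<Phi> a = I"
proof -
  have ab: "a \<le> b" using assms by (simp add: ks_has_integral_def)
  have "\<forall>n. \<exists>\<delta>. (\<forall>t. 0 < \<delta> t) \<and> (\<forall>S. fine_sum f g \<delta> a b S \<longrightarrow> norm (S - I) < 1 / Suc n)"
    using assms unfolding ks_has_integral_fine_sum by simp
  then obtain \<delta>0 where \<delta>0: "\<And>n t. 0 < \<delta>0 n t" "\<And>n S. fine_sum f g (\<delta>0 n) a b S \<Longrightarrow> norm (S - I) < 1 / Suc n"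
    by metis
  define \<delta> where "\<delta> n t = Min ((\<lambda>i. \<delta>0 i t) ` {..n})" for n t
  have \<delta>pos: "0 < \<delta> n t" for n t using \<delta>0(1) by (auto simp: \<delta>_def)
  have \<delta>anti: "\<delta> n t \<le> \<delta> m t" if "m \<le> n" for m n t
    unfolding \<delta>_def by (rule Min_antimono) (use that in auto)
  have \<delta>le: "\<delta> n t \<le> \<delta>0 n t" for n t by (auto simp: \<delta>_def)
  have close: "\<bar>S - I\<bar> < 1 / Suc n" if "fine_sum f g (\<delta> n) a b S" for n S
    using \<delta>0(2)[OF fine_sum_gauge_mono[OF that]] \<delta>le by auto
  define R where "R n c d = {S. fine_sum f g (\<delta> n) c d S}" for n c d
  have R_ne: "R n c d \<noteq> {}" if "c \<le> d" for n c d
    using fine_sum_exists[of c d "\<delta> n" f g] that \<delta>pos by (auto simp: R_def)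
  have R_anti: "R n c d \<subseteq> R m c d" if "m \<le> n" for m n c d
    using fine_sum_gauge_mono[of f g "\<delta> n" c d _ "\<delta> m"] \<delta>anti[OF that] by (auto simp: R_def)
  have R_add: "S + T \<in> R n c e" if "S \<in> R n c d" "T \<in> R n d e" for S T n c d e
    using that fine_sum_append by (auto simp: R_def)
  have R_close: "\<bar>S - S'\<bar> \<le> 2 / Suc n" if "S \<in> R n a t" "S' \<in> R n a t" "t \<le> b" for S S' n t
  proof -
    \<comment> \<open>Any sum over \<open>[a, t]\<close> extends to one over \<open>[a, b]\<close>, where all sums are close to \<open>I\<close>.\<close>
    obtain T where T: "T \<in> R n t b" using R_ne[of t b n] \<open>t \<le> b\<close> by auto
    from R_add[OF that(1) T] R_add[OF that(2) T] have "\<bar>S + T - I\<bar> < 1 / Suc n" "\<bar>S' + T - I\<bar> < 1 / Suc n"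
      using close by (auto simp: R_def)
    moreover have "2 / real (Suc n) = 1 / Suc n + 1 / Suc n" by simp
    ultimately show ?thesis by linarith
  qed
  define U where "U n t = Sup (R n a t)" for n t
  define L where "L n t = Inf (R n a t)" for n t
  have bdd: "bdd_above (R n a t)" "bdd_below (R n a t)" if t: "a \<le> t" "t \<le> b" for n t
  proof -
    obtain S0 where "S0 \<in> R n a t" using R_ne[of a t n] t by auto
    from R_close[OF _ this] t have *: "\<bar>S - S0\<bar> \<le> 2 / Suc n" if "S \<in> R n a t" for S
      using that by blast
    show "bdd_above (R n a t)" using * by (intro bdd_aboveI[of _ "S0 + 2 / Suc n"]) (auto simp: abs_le_iff dest!: *)
    show "bdd_below (R n a t)" using * by (intro bdd_belowI[of _ "S0 - 2 / Suc n"]) (auto simp: abs_le_iff dest!: *)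
  qed
  have U_ge: "S \<le> U n t" and L_le: "L n t \<le> S" if "S \<in> R n a t" "t \<le> b" for S n t
  proof -
    have "a \<le> t" using that fine_sum_le by (auto simp: R_def)
    then show "S \<le> U n t" "L n t \<le> S" unfolding U_def L_def
      using bdd that by (auto intro: cSup_upper cInf_lower)
  qed
  have UL: "U n t - L n t \<le> 2 / Suc n" if "a \<le> t" "t \<le> b" for n t
  proof -
    have "S \<le> L n t + 2 / Suc n" if S: "S \<in> R n a t" for S
    proof -
      have "S - 2 / Suc n \<le> L n t" unfolding L_def
      proof (rule cInf_greatest)
        show "R n a t \<noteq> {}" using R_ne \<open>a \<le> t\<close> by auto
        fix S' assume "S' \<in> R n a t"
        from R_close[OF S this \<open>t \<le> b\<close>] show "S - 2 / Suc n \<le> S'" by linarith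
      qed
      then show ?thesis by simp
    qed
    then have "U n t \<le> L n t + 2 / Suc n" unfolding U_def
      by (intro cSup_least) (use R_ne \<open>a \<le> t\<close> in auto)
    then show ?thesis by simp
  qed
  have LU: "L m t \<le> U n t" if t: "a \<le> t" "t \<le> b" for m n t
  proof -
    obtain S where "S \<in> R (max m n) a t" using R_ne[of a t "max m n"] t by auto
    then have "S \<in> R m a t" "S \<in> R n a t"
        using subsetD[OF R_anti[OF max.cobounded1]] subsetD[OF R_anti[OF max.cobounded2]] by blast+
    then have "L m t \<le> S" "S \<le> U n t" using U_ge L_le t by auto
    then show ?thesis by linarith
  qed
  define \<Phi> where "\<Phi> t = (INF n. U n t)" for t
  have \<Phi>: "L n t \<le> \<Phi> t" "\<Phi> t \<le> U n t" if "a \<le> t" "t \<le> b" for n t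
  proof -
    show "L n t \<le> \<Phi> t" unfolding \<Phi>_def by (rule cINF_greatest) (use LU that in auto)
    show "\<Phi> t \<le> U n t" unfolding \<Phi>_def
      by (rule cINF_lower) (use LU that in \<open>auto intro!: bdd_belowI[of _ "L 0 t"]\<close>)
  qed
  have lim0: "(\<lambda>n. c / real (Suc n)) \<longlonglongrightarrow> 0" for c :: real
    using tendsto_mult[OF tendsto_const[of c] LIMSEQ_inverse_real_of_nat] by (simp add: field_simps)
  have U_lim: "(\<lambda>n. U n t) \<longlonglongrightarrow> \<Phi> t" and L_lim: "(\<lambda>n. L n t) \<longlonglongrightarrow> \<Phi> t" if t: "a \<le> t" "t \<le> b" for t
  proof -
    have l1: "(\<lambda>n. \<Phi> t + 2 / Suc n) \<longlonglongrightarrow> \<Phi> t + 0" by (intro tendsto_intros lim0)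
    have l2: "(\<lambda>n. \<Phi> t - 2 / Suc n) \<longlonglongrightarrow> \<Phi> t - 0" by (intro tendsto_intros lim0)
    show "(\<lambda>n. U n t) \<longlonglongrightarrow> \<Phi> t"
      by (rule tendsto_sandwich[OF _ _ tendsto_const l1[simplified]]) (use \<Phi>[OF t] UL[OF t] in \<open>auto simp: algebra_simps intro!: always_eventually, smt (verit)\<close>)
    show "(\<lambda>n. L n t) \<longlonglongrightarrow> \<Phi> t"
      by (rule tendsto_sandwich[OF _ _ l2[simplified] tendsto_const]) (use \<Phi>[OF t] UL[OF t] in \<open>auto simp: algebra_simps intro!: always_eventually, smt (verit)\<close>)
  qed
  have step: "U m d - U m c \<ge> S" "L m d - L m c \<le> S" if cd: "a \<le> c" "d \<le> b" and S: "S \<in> R m c d" for m c d S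
  proof -
    have "c \<le> d" using S fine_sum_le by (auto simp: R_def)
    then have "T \<le> U m d - S" "L m d - S \<le> T" if "T \<in> R m a c" for T
      using U_ge[OF R_add[OF that S]] L_le[OF R_add[OF that S]] cd by auto
    then have "U m c \<le> U m d - S" "L m d - S \<le> L m c" unfolding U_def[of m c] L_def[of m c]
      using R_ne[of a c m] cd by (auto intro!: cSup_least cInf_greatest)
    then show "U m d - U m c \<ge> S" "L m d - L m c \<le> S" by auto
  qed
  have incr: "\<Phi> d - \<Phi> c \<le> U m d - U m c" "L m d - L m c \<le> \<Phi> d - \<Phi> c" if cd: "a \<le> c" "c \<le> d" "d \<le> b" for m c d
  proof -
    have *: "L n d - U n c \<le> U m d - U m c \<and> L m d - L m c \<le> U n d - L n c" if "m \<le> n" for n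
    proof -
      obtain S where S: "S \<in> R n c d" using R_ne[of c d n] cd by auto
      obtain T where T: "T \<in> R n a c" using R_ne[of a c n] cd by auto
      have "S \<in> R m c d" using R_anti[OF that] S by auto
      note step[OF cd(1,3) this]
      moreover have "T \<le> U n c" "L n c \<le> T" "T + S \<le> U n d" "L n d \<le> T + S"
        using U_ge L_le R_add[OF T S] T cd by auto
      ultimately show ?thesis by auto
    qed
    have 1: "(\<lambda>n. L n d - U n c) \<longlonglongrightarrow> \<Phi> d - \<Phi> c" and 2: "(\<lambda>n. U n d - L n c) \<longlonglongrightarrow> \<Phi> d - \<Phi> c"
      using cd by (auto intro!: tendsto_diff U_lim L_lim)
    show "\<Phi> d - \<Phi> c \<le> U m d - U m c" by (rule LIMSEQ_le_const2[OF 1]) (use * in blast)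
    show "L m d - L m c \<le> \<Phi> d - \<Phi> c" by (rule LIMSEQ_le_const[OF 2]) (use * in blast)
  qed
  have "ks_primitive f g a b \<Phi>" unfolding ks_primitive_def
  proof (intro allI impI)
    fix \<epsilon> :: real assume \<epsilon>: "\<epsilon> > 0"
    then obtain m where m: "2 / Suc m < \<epsilon>"
      using order_tendstoD(2)[OF lim0[of 2] \<epsilon>] eventually_sequentially by auto
    define V where "V t = U m t - L m t" for t
    have "mono_on {a..b} V"
      unfolding V_def by (intro mono_onI) (use incr in \<open>auto, smt (verit)\<close>)
    moreover have "V b - V a \<le> \<epsilon>"
      using UL[of b m] LU[of a m m] m ab unfolding V_def by linarith
    moreover have "norm (\<Phi> d - \<Phi> c - (g d - g c) *\<^sub>R f \<tau>) \<le> V d - V c"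
      if "fine_cell a b (\<delta> m \<tau>) c \<tau> d" for c \<tau> d
    proof -
      have "(g d - g c) *\<^sub>R f \<tau> \<in> R m c d" unfolding R_def using fine_sum_single that by blast
      then have "(g d - g c) *\<^sub>R f \<tau> \<le> U m d - U m c" "L m d - L m c \<le> (g d - g c) *\<^sub>R f \<tau>"
        using step that by blast+
      moreover have "\<Phi> d - \<Phi> c \<le> U m d - U m c" "L m d - L m c \<le> \<Phi> d - \<Phi> c" using incr that by auto
      ultimately show ?thesis unfolding V_def real_norm_def by linarith
    qed
    ultimately show "\<exists>\<delta> V. (\<forall>t. 0 < \<delta> t) \<and> mono_on {a..b} V \<and> V b - V a \<le> \<epsilon> \<and>
     (\<forall>c \<tau> d. fine_cell a b (\<delta> \<tau>) c \<tau> d \<longrightarrow>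
        norm (\<Phi> d - \<Phi> c - (g d - g c) *\<^sub>R f \<tau>) \<le> V d - V c)"
      using \<delta>pos by (intro exI[of _ "\<delta> m"] exI[of _ V]) auto
  qed
  moreover from this have "\<Phi> b - \<Phi> a = I"
    using ks_has_integral_unique[OF assms ks_primitive_imp_has_integral] ab by simp
  ultimately show ?thesis using that by blast
qed

section \<open>Monotone error functions\<close>

text \<open>
  A gauge argument can neglect countably many tags when the errors at the \<open>n\<close>-th one can be made
  smaller than the \<open>n\<close>-th term of a convergent series. The pure jump function \<open>C\<close> expresses this
  by a monotone error bound. Each point of \<open>E\<close> contributes one jump from the left and one from the
  right, because the point can be either end of a cell.
\<close>

lemma countable_jump_function:
  fixes E :: "real set"
  assumes "countable E" "\<epsilon> > 0"
  obtains C :: "real \<Rightarrow> real" and e :: "real \<Rightarrow> real"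
  where "mono C" "\<And>x. 0 \<le> C x" "\<And>x. C x \<le> \<epsilon>" "\<And>y. 0 < e y"
    "\<And>v y w. y \<in> E \<Longrightarrow> v \<le> y \<Longrightarrow> y \<le> w \<Longrightarrow> v < w \<Longrightarrow> e y \<le> C w - C v"
proof -
  define k where "k n x = (if from_nat_into E n < x then 1 else 0) + (if from_nat_into E n
      \<le> x then 1 else (0::real))" for n x
  \<comment> \<open>The factor \<open>\<epsilon> / 2\<close> compensates for the two jumps at each point.\<close>
  define T where "T x n = \<epsilon> / 2 * (1/2) ^ Suc n * k n x" for x n
  have k: "0 \<le> k n x" "k n x \<le> 2" for n x by (auto simp: k_def)
  have kmono: "k n v \<le> k n w" if "v \<le> w" for n v w using that by (auto simp: k_def)
  have s: "(\<lambda>n. \<epsilon> * (1/2) ^ Suc n) sums (\<epsilon> * 1)"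
    by (intro sums_mult power_half_series)
  have T: "0 \<le> T x n" "T x n \<le> \<epsilon> * (1/2) ^ Suc n" for x n
    using k[of n x] assms(2) by (auto simp: T_def mult_left_mono)
  have sT: "summable (T x)" for x
    by (rule summable_comparison_test'[OF sums_summable[OF s], of 0]) (use T in auto)
  have Tmono: "T v n \<le> T w n" if "v \<le> w" for v w n
    using kmono[OF that, of n] assms(2) by (auto simp: T_def mult_left_mono)
  define C where "C x = suminf (T x)" for x
  define e where "e y = \<epsilon> / 2 * (1/2) ^ Suc (to_nat_on E y)" for y
  show thesis
  proof (rule that[of C e])
    show "mono C" unfolding C_def by (intro monoI suminf_le sT Tmono)
    show "0 \<le> C x" for x unfolding C_def by (intro suminf_nonneg sT T)
    have "C x \<le> (\<Sum>n. \<epsilon> * (1/2) ^ Suc n)" for x unfolding C_def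
      by (intro suminf_le T sT sums_summable[OF s])
    then show "C x \<le> \<epsilon>" for x using sums_unique[OF s] by simp
    show "0 < e y" for y using assms by (simp add: e_def)
    fix v y w assume *: "y \<in> E" "v \<le> y" "y \<le> w" "v < w"
    define n where "n = to_nat_on E y"
    have n: "from_nat_into E n = y" unfolding n_def by (rule from_nat_into_to_nat_on) (use * assms in auto)
    have "k n v + 1 \<le> k n w" using * n by (auto simp: k_def)
    then have "T v n + e y \<le> T w n"
      using mult_left_mono[of "k n v + 1" "k n w" "\<epsilon> / 2 * (1/2) ^ Suc n"] assms(2)
      by (simp add: T_def e_def n_def[symmetric] algebra_simps)
    moreover have "T w n - T v n \<le> (\<Sum>n. T w n - T v n)"
      using sum_le_suminf[of "\<lambda>n. T w n - T v n" "{n}"] Tmono[of v w] * by (auto intro: summable_diff sT)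
    moreover have "(\<Sum>n. T w n - T v n) = C w - C v"
      unfolding C_def by (rule suminf_diff[symmetric]) (rule sT)+
    ultimately show "e y \<le> C w - C v" by simp
  qed
qed

text \<open>
  The counterpart of \<open>ks_primitive\<close> for the Henstock-Kurzweil integral. \<open>V y\<close> is the supremum of
  the total errors over fine partial divisions of \<open>[\<alpha>, y]\<close>, finite by Henstock's lemma, and a fine
  cell \<open>[v, w]\<close> can be added to any partial division of \<open>[\<alpha>, v]\<close>.
\<close>

lemma Henstock_majorant:
  fixes F :: "real \<Rightarrow> 'a::euclidean_space"
  assumes int: "F integrable_on {\<alpha>..\<beta>}" and ab: "\<alpha> \<le> \<beta>" and \<epsilon>: "\<epsilon> > 0"
  obtains \<delta> V where "\<And>y. 0 < \<delta> y" "mono_on {\<alpha>..\<beta>} V" "V \<beta> - V \<alpha> \<le> \<epsilon>"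
    "\<And>v y w. fine_cell \<alpha> \<beta> (\<delta> y) v y w \<Longrightarrow>
        norm (integral {v..w} F - (w - v) *\<^sub>R F y) \<le> V w - V v"
proof -
  have "F integrable_on cbox \<alpha> \<beta>" using int by simp
  from Henstock_lemma[OF this \<epsilon>] obtain \<gamma> where \<gamma>: "gauge \<gamma>"
    "\<And>p. p tagged_partial_division_of {\<alpha>..\<beta>} \<Longrightarrow> \<gamma> fine p \<Longrightarrow>
        (\<Sum>(x,K)\<in>p. norm (measure lborel K *\<^sub>R F x - integral K F)) < \<epsilon>"
    unfolding box_real by blast
  have "\<forall>y. \<exists>d>0. ball y d \<subseteq> \<gamma> y"
    using \<gamma>(1) open_contains_ball unfolding gauge_def by blast
  then obtain \<delta> where \<delta>: "\<And>y. 0 < \<delta> y" "\<And>y. ball y (\<delta> y) \<subseteq> \<gamma> y" by metis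
  define P where "P y = {p. p tagged_partial_division_of {\<alpha>..y} \<and> \<gamma> fine p}" for y
  define s where "s p = (\<Sum>(x,K)\<in>p. norm (measure lborel K *\<^sub>R F x - integral K F))" for p
  define V where "V y = Sup (s ` P y)" for y
  have Pmono: "P v \<subseteq> P w" if "v \<le> w" for v w
  proof -
    have "{\<alpha>..v} \<subseteq> {\<alpha>..w}" using that by auto
    then show ?thesis unfolding P_def tagged_partial_division_of_def by blast
  qed
  have bdd: "bdd_above (s ` P y)" if "y \<le> \<beta>" for y
    using Pmono[OF that] \<gamma>(2) by (intro bdd_aboveI[of _ \<epsilon>]) (force simp: P_def s_def)
  have empty: "{} \<in> P y" for y by (auto simp: P_def fine_def tagged_partial_division_of_def)
  show thesis
  proof (rule that[of \<delta> V])
    show "mono_on {\<alpha>..\<beta>} V" unfolding V_def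
    proof (rule mono_onI)
      fix r t assume "r \<in> {\<alpha>..\<beta>}" "t \<in> {\<alpha>..\<beta>}" "r \<le> t"
      then show "Sup (s ` P r) \<le> Sup (s ` P t)"
        using Pmono[of r t] bdd[of t] empty[of r] by (intro cSup_subset_mono) auto
    qed
    have "V \<beta> \<le> \<epsilon>" unfolding V_def
      using \<gamma>(2) empty by (intro cSup_least) (force simp: P_def s_def)+
    moreover have "0 \<le> V \<alpha>" unfolding V_def
    proof (rule cSup_upper)
      have "s {} = 0" by (simp add: s_def)
      then show "0 \<in> s ` P \<alpha>" using empty by (metis image_eqI)
    qed (use bdd ab in auto)
    ultimately show "V \<beta> - V \<alpha> \<le> \<epsilon>" by simp
    fix v y w assume *: "fine_cell \<alpha> \<beta> (\<delta> y) v y w"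
    show "norm (integral {v..w} F - (w - v) *\<^sub>R F y) \<le> V w - V v"
    proof (cases "v = w")
      case False
      with * have "v < w" by simp
      have "s p + norm (integral {v..w} F - (w - v) *\<^sub>R F y) \<le> V w" if p: "p \<in> P v" for p
      proof -
        let ?q = "insert (y, {v..w}) p"
        have K: "K \<subseteq> {\<alpha>..v}" if "(x, K) \<in> p" for x K
          using p that by (auto simp: P_def tagged_partial_division_of_def)
        have fin: "finite p" using p by (auto simp: P_def tagged_partial_division_of_def)
        have new: "(y, {v..w}) \<notin> p" using K[of y "{v..w}"] \<open>v < w\<close> by auto
        have int0: "interior K \<inter> interior {v..w} = {}" if "(x, K) \<in> p" for x K
        proof -
          have "interior K \<subseteq> interior {\<alpha>..v}" using K[OF that] by (rule interior_mono)
          then show ?thesis by auto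
        qed
        have "?q tagged_partial_division_of {\<alpha>..w}"
          unfolding tagged_partial_division_of_def
        proof (intro conjI allI impI)
          show "finite ?q" using fin by simp
        next
          fix x K assume "(x, K) \<in> ?q"
          then consider "x = y" "K = {v..w}" | "(x, K) \<in> p" by auto
          then have "x \<in> K \<and> K \<subseteq> {\<alpha>..w} \<and> (\<exists>a b. K = cbox a b)"
          proof cases
            case 1
            have "{v..w} = cbox v w" by simp
            then show ?thesis using 1 * by auto
          next
            case 2
            then have "x \<in> K" "\<exists>a b. K = cbox a b" using p by (auto simp: P_def tagged_partial_division_of_def)
            then show ?thesis using K[OF 2] * by (auto simp: subset_iff)
          qed
          then show "x \<in> K" "K \<subseteq> {\<alpha>..w}" "\<exists>a b. K = cbox a b" by blast+
        next
          fix x1 K1 x2 K2 assume "(x1, K1) \<in> ?q \<and> (x2, K2) \<in> ?q \<and> (x1, K1) \<noteq> (x2, K2)"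
          then consider "(x1, K1) \<in> p" "(x2, K2) \<in> p" "(x1, K1) \<noteq> (x2, K2)"
            | "K1 = {v..w}" "(x2, K2) \<in> p" | "(x1, K1) \<in> p" "K2 = {v..w}" by auto
          then show "interior K1 \<inter> interior K2 = {}"
          proof cases
            case 1
            then show ?thesis using p unfolding P_def tagged_partial_division_of_def by blast
          next
            case 2
            then show ?thesis using int0[of x2 K2] by blast
          next
            case 3
            then show ?thesis using int0[of x1 K1] by blast
          qed
        qed
        moreover have "\<gamma> fine ?q"
        proof -
          have "{v..w} \<subseteq> ball y (\<delta> y)" using * by (auto simp: dist_real_def)
          then show ?thesis using p \<delta>(2)[of y] by (auto simp: P_def fine_def)
        qed
        ultimately have "?q \<in> P w" by (simp add: P_def)
        then have "s ?q \<le> V w" unfolding V_def using bdd[of w] * by (intro cSup_upper) auto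
        moreover have "s ?q = norm ((w - v) *\<^sub>R F y - integral {v..w} F) + s p"
          unfolding s_def by (subst sum.insert) (use fin new \<open>v < w\<close> in auto)
        ultimately show ?thesis by (simp add: norm_minus_commute)
      qed
      then have "V v \<le> V w - norm (integral {v..w} F - (w - v) *\<^sub>R F y)"
        unfolding V_def[of v] using empty by (intro cSup_least) (auto simp: algebra_simps)
      then show ?thesis by simp
    qed auto
  qed (rule \<delta>(1))
qed

section \<open>The pseudo-inverse of the integrator\<close>

locale left_continuous_integrator =
  fixes g :: "real \<Rightarrow> real" and a b :: real
  assumes ab: "a \<le> b"
    and g_mono: "mono_on {a..b} g"
    and g_left: "\<And>t. a < t \<Longrightarrow> t \<le> b \<Longrightarrow> (g \<longlongrightarrow> g t) (at_left t)"
begin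

definition ginv :: "real \<Rightarrow> real" where
  "ginv y = Sup {t \<in> {a..b}. g t \<le> y}"

lemma g_le: "a \<le> s \<Longrightarrow> s \<le> t \<Longrightarrow> t \<le> b \<Longrightarrow> g s \<le> g t"
  using mono_onD[OF g_mono, of s t] by auto

lemma g_bounds: "t \<in> {a..b} \<Longrightarrow> g t \<in> {g a..g b}"
  using g_le by auto

lemma left_close:
  assumes "a < t" "t \<le> b" "e > 0"
  obtains s where "a \<le> s" "s < t" "g t - e < g s"
proof -
  have "\<forall>\<^sub>F s in at_left t. g t - e < g s"
    using order_tendstoD(1)[OF g_left[OF assms(1,2)], of "g t - e"] assms(3) by simp
  moreover have "\<forall>\<^sub>F s in at_left t. s \<in> {a<..<t}" using assms(1) eventually_at_left_real by blast
  ultimately have "\<forall>\<^sub>F s in at_left t. a \<le> s \<and> s < t \<and> g t - e < g s" by eventually_elim auto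
  then obtain s where "a \<le> s \<and> s < t \<and> g t - e < g s"
    using eventually_happens' trivial_limit_at_left_real by blast
  then show ?thesis using that by blast
qed

lemma ginv_bounds:
  assumes "g a \<le> y" shows "a \<le> ginv y" "ginv y \<le> b"
proof -
  have "a \<in> {t \<in> {a..b}. g t \<le> y}" using assms ab by auto
  then show "a \<le> ginv y" "ginv y \<le> b" unfolding ginv_def
    by (auto intro!: cSup_upper cSup_least bdd_aboveI[of _ b])
qed

text \<open>
  Left-continuity is what makes the supremum in \<open>ginv\<close> a maximum. All further properties of \<open>ginv\<close>
  follow from this equivalence.
\<close>

lemma ginv_galois:
  assumes t: "a \<le> t" "t \<le> b" and y: "g a \<le> y"
  shows "g t \<le> y \<longleftrightarrow> t \<le> ginv y"
proof
  assume "g t \<le> y"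
  then show "t \<le> ginv y" unfolding ginv_def using t by (auto intro!: cSup_upper bdd_aboveI[of _ b])
next
  have ne: "{t \<in> {a..b}. g t \<le> y} \<noteq> {}" using y ab by auto
  have "g (ginv y) \<le> y"
  proof (rule ccontr)
    assume "\<not> g (ginv y) \<le> y"
    then have "a < ginv y" using ginv_bounds[OF y] y by (metis order_le_less)
    obtain s where s: "a \<le> s" "s < ginv y" "g (ginv y) - (g (ginv y) - y) < g s"
      using left_close[OF \<open>a < ginv y\<close> ginv_bounds(2)[OF y], of "g (ginv y) - y"] \<open>\<not> g (ginv y) \<le> y\<close> by auto
    obtain u where "u \<in> {t \<in> {a..b}. g t \<le> y}" "s < u"
      using less_cSupD[OF ne] s(2) unfolding ginv_def by blast
    then have "g s \<le> y" using g_le[of s u] s by auto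
    then show False using s by simp
  qed
  moreover assume "t \<le> ginv y"
  ultimately show "g t \<le> y" using g_le[of t "ginv y"] t ginv_bounds[OF y] by auto
qed

lemma ginv_less: "a \<le> t \<Longrightarrow> t \<le> b \<Longrightarrow> g a \<le> y \<Longrightarrow> y < g t \<longleftrightarrow> ginv y < t"
  using ginv_galois by (meson not_le)

lemma g_ginv_le: "g a \<le> y \<Longrightarrow> g (ginv y) \<le> y"
  using ginv_galois[of "ginv y" y] ginv_bounds by auto

lemma ginv_mono: "g a \<le> x \<Longrightarrow> x \<le> y \<Longrightarrow> ginv x \<le> ginv y"
  using ginv_galois[of "ginv x" y] g_ginv_le[of x] ginv_bounds[of x] by auto

lemma ginv_eqI:
  assumes "a \<le> t" "t \<le> b" "g t \<le> y" "\<And>s. t < s \<Longrightarrow> s \<le> b \<Longrightarrow> y < g s"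
  shows "ginv y = t"
proof -
  have y: "g a \<le> y" using g_le[of a t] assms by auto
  have "t \<le> ginv y" using ginv_galois[of t y] assms y by auto
  moreover have "\<not> t < ginv y"
    using assms(4)[of "ginv y"] g_ginv_le[OF y] ginv_bounds[OF y] by auto
  ultimately show ?thesis by simp
qed

definition right_lim :: "real \<Rightarrow> real" where
  "right_lim t = Inf (g ` {t<..b})"

lemma right_lim:
  assumes "a \<le> t" "t < b"
  shows "g t \<le> right_lim t" "\<And>s. t < s \<Longrightarrow> s \<le> b \<Longrightarrow> right_lim t \<le> g s"
    "\<And>e. e > 0 \<Longrightarrow> \<exists>s. t < s \<and> s \<le> b \<and> g s < right_lim t + e"
proof -
  have ne: "g ` {t<..b} \<noteq> {}" using assms by auto
  have bd: "bdd_below (g ` {t<..b})" using g_le assms by (intro bdd_belowI[of _ "g a"]) auto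
  show "g t \<le> right_lim t" unfolding right_lim_def using ne g_le assms by (intro cInf_greatest) auto
  show "right_lim t \<le> g s" if "t < s" "s \<le> b" for s
    unfolding right_lim_def using bd that by (intro cInf_lower) auto
  show "\<exists>s. t < s \<and> s \<le> b \<and> g s < right_lim t + e" if "e > 0" for e
    using cInf_lessD[OF ne, of "right_lim t + e"] that unfolding right_lim_def by auto
qed

lemma ginv_gap: "a \<le> t \<Longrightarrow> t < b \<Longrightarrow> g t \<le> y \<Longrightarrow> y < right_lim t \<Longrightarrow> ginv y = t"
  using right_lim[of t] by (intro ginv_eqI) force+

lemma right_lim_le: "a \<le> t \<Longrightarrow> t < b \<Longrightarrow> right_lim t \<le> g b"
  using right_lim(2)[of t b] by auto

lemma right_lim_tendsto:
  assumes "a \<le> t" "t < b"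
  shows "(g \<longlongrightarrow> right_lim t) (at_right t)"
proof (rule order_tendstoI)
  fix y assume "y < right_lim t"
  have "\<forall>\<^sub>F s in at_right t. s \<in> {t<..<b}" using assms eventually_at_right_real by blast
  then show "\<forall>\<^sub>F s in at_right t. y < g s"
    by eventually_elim (use right_lim(2)[OF assms] \<open>y < right_lim t\<close> in force)
next
  fix y assume "right_lim t < y"
  then obtain u where u: "t < u" "u \<le> b" "g u < y" using right_lim(3)[OF assms, of "y - right_lim t"] by auto
  have "\<forall>\<^sub>F s in at_right t. s \<in> {t<..<u}" using u eventually_at_right_real by blast
  then show "\<forall>\<^sub>F s in at_right t. g s < y"
  proof eventually_elim
    case (elim s)
    then show ?case using g_le[of s u] u assms by auto
  qed
qed

text \<open>
  A jump of \<open>g\<close> at \<open>\<tau>\<close> contributes its height times \<open>f \<tau>\<close>, as in the Stieltjes integral.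
\<close>

lemma has_integral_gap:
  fixes f :: "real \<Rightarrow> 'a::euclidean_space"
  assumes "a \<le> \<tau>" "\<tau> < b"
  shows "((\<lambda>y. f (ginv y)) has_integral (right_lim \<tau> - g \<tau>) *\<^sub>R f \<tau>) {g \<tau>..right_lim \<tau>}"
proof -
  have "((\<lambda>y. f \<tau>) has_integral (right_lim \<tau> - g \<tau>) *\<^sub>R f \<tau>) {g \<tau>..right_lim \<tau>}"
    using has_integral_const_real[of "f \<tau>" "g \<tau>" "right_lim \<tau>"] right_lim(1)[OF assms] by simp
  then show ?thesis
    by (rule has_integral_spike[of "{right_lim \<tau>}", rotated 2]) (use ginv_gap[OF assms] in auto)
qed

section \<open>Integrals over levels give integrals over times\<close>

text \<open>
  To the left of \<open>\<tau>\<close> the levels \<open>g c\<close> tend to \<open>g \<tau>\<close>, to the right the levels \<open>g d\<close> tend to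
  \<open>right_lim \<tau>\<close>. Continuity of \<open>H\<close> controls both sides, and across the jump the increment of \<open>H\<close>
  is exact by assumption.
\<close>

lemma cell_increment_small:
  fixes H :: "real \<Rightarrow> 'a::real_normed_vector"
  assumes cont: "continuous_on {g a..g b} H"
    and \<tau>: "a \<le> \<tau>" "\<tau> \<le> b"
    and gap: "\<tau> < b \<Longrightarrow> H (right_lim \<tau>) - H (g \<tau>) = (right_lim \<tau> - g \<tau>) *\<^sub>R z"
    and e: "e > 0"
  obtains \<eta> where "\<eta> > 0"
    "\<And>c d. fine_cell a b \<eta> c \<tau> d \<Longrightarrow> norm (H (g d) - H (g c) - (g d - g c) *\<^sub>R z) \<le> e"
proof -
  have near: "\<exists>\<delta>>0. \<forall>y\<in>{g a..g b}. \<bar>y - r\<bar> < \<delta> \<longrightarrow> norm (H y - H r - (y - r) *\<^sub>R z) \<le> e / 2"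
    if r: "r \<in> {g a..g b}" for r
  proof -
    have "continuous_on {g a..g b} (\<lambda>y. H y - H r - (y - r) *\<^sub>R z)"
      by (intro continuous_intros cont)
    with r e obtain \<delta> where "\<delta> > 0" "\<forall>y\<in>{g a..g b}. dist y r < \<delta> \<longrightarrow>
        dist (H y - H r - (y - r) *\<^sub>R z) (H r - H r - (r - r) *\<^sub>R z) < e / 2"
      unfolding continuous_on_iff by (meson half_gt_zero)
    then show ?thesis by (intro exI[of _ \<delta>]) (auto simp: dist_real_def intro: less_imp_le)
  qed
  have "\<exists>\<eta>>0. \<forall>c. a \<le> c \<longrightarrow> c \<le> \<tau> \<longrightarrow> \<tau> - \<eta> < c \<longrightarrow> norm (H (g \<tau>) - H (g c) - (g \<tau> - g c) *\<^sub>R z) \<le> e / 2"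
  proof (cases "\<tau> = a")
    case True
    then show ?thesis using e by (intro exI[of _ 1]) auto
  next
    case False
    obtain \<delta> where \<delta>: "\<delta> > 0" "\<forall>y\<in>{g a..g b}. \<bar>y - g \<tau>\<bar> < \<delta> \<longrightarrow> norm (H y - H (g \<tau>) - (y - g \<tau>) *\<^sub>R z) \<le> e / 2"
      using near[of "g \<tau>"] g_bounds \<tau> by auto
    obtain s where s: "a \<le> s" "s < \<tau>" "g \<tau> - \<delta> < g s" using left_close[of \<tau> \<delta>] False \<tau> \<delta> by auto
    show ?thesis
    proof (intro exI[of _ "\<tau> - s"] conjI allI impI)
      fix c assume c: "a \<le> c" "c \<le> \<tau>" "\<tau> - (\<tau> - s) < c"
      then have "g s \<le> g c" "g c \<le> g \<tau>" using g_le s \<tau> by auto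
      then have "norm (H (g c) - H (g \<tau>) - (g c - g \<tau>) *\<^sub>R z) \<le> e / 2"
        using \<delta> s c \<tau> g_bounds[of c] by auto
      moreover have "H (g \<tau>) - H (g c) - (g \<tau> - g c) *\<^sub>R z = - (H (g c) - H (g \<tau>) - (g c - g \<tau>) *\<^sub>R z)"
        by (simp add: algebra_simps)
      ultimately show "norm (H (g \<tau>) - H (g c) - (g \<tau> - g c) *\<^sub>R z) \<le> e / 2"
        by (simp only: norm_minus_cancel)
    qed (use s in auto)
  qed
  then obtain \<eta>1 where \<eta>1: "\<eta>1 > 0" "\<And>c. a \<le> c \<Longrightarrow> c \<le> \<tau> \<Longrightarrow> \<tau> - \<eta>1 < c \<Longrightarrow>
    norm (H (g \<tau>) - H (g c) - (g \<tau> - g c) *\<^sub>R z) \<le> e / 2" by blast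
  have "\<exists>\<eta>>0. \<forall>d. \<tau> \<le> d \<longrightarrow> d \<le> b \<longrightarrow> d < \<tau> + \<eta> \<longrightarrow> norm (H (g d) - H (g \<tau>) - (g d - g \<tau>) *\<^sub>R z) \<le> e / 2"
  proof (cases "\<tau> = b")
    case True
    then show ?thesis using e by (intro exI[of _ 1]) auto
  next
    case False
    with \<tau> have "\<tau> < b" by simp
    define r where "r = right_lim \<tau>"
    note rl = right_lim[OF \<tau>(1) \<open>\<tau> < b\<close>, folded r_def]
    have ra: "g a \<le> g \<tau>" "r \<le> g b" using g_le \<tau> right_lim_le[OF \<tau>(1) \<open>\<tau> < b\<close>] by (auto simp: r_def)
    obtain \<delta> where \<delta>: "\<delta> > 0" "\<forall>y\<in>{g a..g b}. \<bar>y - r\<bar> < \<delta> \<longrightarrow> norm (H y - H r - (y - r) *\<^sub>R z) \<le> e / 2"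
      using near[of r] rl(1) ra by auto
    obtain s where s: "\<tau> < s" "s \<le> b" "g s < r + \<delta>" using rl(3)[OF \<delta>(1)] by auto
    show ?thesis
    proof (intro exI[of _ "s - \<tau>"] conjI allI impI)
      fix d assume d: "\<tau> \<le> d" "d \<le> b" "d < \<tau> + (s - \<tau>)"
      show "norm (H (g d) - H (g \<tau>) - (g d - g \<tau>) *\<^sub>R z) \<le> e / 2"
      proof (cases "d = \<tau>")
        case False
        with d have d': "\<tau> < d" by simp
        have "g d \<le> g s" using g_le d s \<tau> by auto
        moreover have "r \<le> g d" using rl(2) d' d by auto
        ultimately have "norm (H (g d) - H r - (g d - r) *\<^sub>R z) \<le> e / 2"
          using \<delta>(2) s g_bounds[of d] d \<tau> by auto
        moreover have "H (g d) - H (g \<tau>) - (g d - g \<tau>) *\<^sub>R z = H (g d) - H r - (g d - r) *\<^sub>R z"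
          using gap \<open>\<tau> < b\<close> by (simp add: r_def algebra_simps)
        ultimately show ?thesis by (simp only:)
      qed (use e in auto)
    qed (use s in auto)
  qed
  then obtain \<eta>2 where \<eta>2: "\<eta>2 > 0" "\<And>d. \<tau> \<le> d \<Longrightarrow> d \<le> b \<Longrightarrow> d < \<tau> + \<eta>2 \<Longrightarrow>
    norm (H (g d) - H (g \<tau>) - (g d - g \<tau>) *\<^sub>R z) \<le> e / 2" by blast
  show ?thesis
  proof (rule that[of "min \<eta>1 \<eta>2"])
    fix c d assume cd: "fine_cell a b (min \<eta>1 \<eta>2) c \<tau> d"
    have "norm ((H (g \<tau>) - H (g c) - (g \<tau> - g c) *\<^sub>R z) + (H (g d) - H (g \<tau>) - (g d - g \<tau>) *\<^sub>R z)) \<le> e / 2 + e / 2"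
      by (intro norm_triangle_mono \<eta>1 \<eta>2) (use cd in auto)
    moreover have "(H (g \<tau>) - H (g c) - (g \<tau> - g c) *\<^sub>R z) + (H (g d) - H (g \<tau>) - (g d - g \<tau>) *\<^sub>R z)
        = H (g d) - H (g c) - (g d - g c) *\<^sub>R z" by (simp add: algebra_simps)
    ultimately show "norm (H (g d) - H (g c) - (g d - g c) *\<^sub>R z) \<le> e" by simp
  qed (use \<eta>1 \<eta>2 in auto)
qed

text \<open>
  Around a flat time short cells have no increment. A regular time is no jump and is the last one
  at its level, so a short cell with this tag corresponds to a short cell of levels with tag
  \<open>g \<tau>\<close>, whose own time \<open>ginv (g \<tau>)\<close> is again \<open>\<tau>\<close>.
\<close>

definition flat_at :: "real \<Rightarrow> bool" where
  "flat_at \<tau> \<longleftrightarrow> (\<exists>\<eta>>0. \<forall>t\<in>{a..b}. \<bar>t - \<tau>\<bar> < \<eta> \<longrightarrow> g t = g \<tau>)"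

definition regular_time :: "real \<Rightarrow> bool" where
  "regular_time \<tau> \<longleftrightarrow> (\<tau> = b \<or> right_lim \<tau> = g \<tau>) \<and> ginv (g \<tau>) = \<tau>"

text \<open>
  A jump is determined by a rational level in the gap, and the left end of an interval of
  constancy by a rational time in that interval.
\<close>

lemma countable_exceptional_times: "countable {\<tau> \<in> {a..b}. \<not> flat_at \<tau> \<and> \<not> regular_time \<tau>}"
proof -
  have "{\<tau> \<in> {a..b}. \<not> flat_at \<tau> \<and> \<not> regular_time \<tau>}
      \<subseteq> ginv ` \<rat> \<union> (\<lambda>q. Inf {t \<in> {a..b}. g q \<le> g t}) ` \<rat>" (is "_ \<subseteq> ?R")
  proof
    fix \<tau> assume "\<tau> \<in> {\<tau> \<in> {a..b}. \<not> flat_at \<tau> \<and> \<not> regular_time \<tau>}"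
    then have \<tau>: "a \<le> \<tau>" "\<tau> \<le> b" "\<not> flat_at \<tau>" "\<not> regular_time \<tau>" by auto
    show "\<tau> \<in> ?R"
    proof (cases "\<tau> < b \<and> g \<tau> < right_lim \<tau>")
      case True
      then obtain q where q: "q \<in> \<rat>" "g \<tau> < q" "q < right_lim \<tau>" using Rats_dense_in_real by blast
      then have "ginv q = \<tau>" using ginv_gap[of \<tau> q] \<tau> True by auto
      then show ?thesis using q(1) by auto
    next
      case False
      then have "\<tau> = b \<or> right_lim \<tau> = g \<tau>" using right_lim(1)[of \<tau>] \<tau> by force
      then have "ginv (g \<tau>) \<noteq> \<tau>" using \<tau>(4) by (auto simp: regular_time_def)
      have ga: "g a \<le> g \<tau>" using g_le \<tau> by auto
      define \<sigma> where "\<sigma> = ginv (g \<tau>)"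
      have \<sigma>: "\<tau> < \<sigma>" "\<sigma> \<le> b" "g \<sigma> \<le> g \<tau>"
        using ginv_galois[of \<tau> "g \<tau>"] ga \<tau> \<open>ginv (g \<tau>) \<noteq> \<tau>\<close> ginv_bounds[OF ga] g_ginv_le[OF ga]
        by (auto simp: \<sigma>_def)
      have left: "g c < g \<tau>" if c: "a \<le> c" "c < \<tau>" for c
      proof (rule ccontr)
        assume "\<not> g c < g \<tau>"
        have const: "g t = g \<tau>" if "c \<le> t" "t \<le> \<sigma>" for t
          using g_le[of c t] g_le[of t \<sigma>] g_le[of c \<tau>] that c \<sigma> \<tau> \<open>\<not> g c < g \<tau>\<close> by auto
        have "\<forall>t\<in>{a..b}. \<bar>t - \<tau>\<bar> < min (\<tau> - c) (\<sigma> - \<tau>) \<longrightarrow> g t = g \<tau>"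
          by (intro ballI impI const) auto
        moreover have "0 < min (\<tau> - c) (\<sigma> - \<tau>)" using c \<sigma> by simp
        ultimately have "flat_at \<tau>" unfolding flat_at_def by blast
        then show False using \<tau> by simp
      qed
      obtain q where q: "q \<in> \<rat>" "\<tau> < q" "q < \<sigma>" using Rats_dense_in_real \<sigma> by blast
      have "g q = g \<tau>" using g_le[of \<tau> q] g_le[of q \<sigma>] q \<sigma> \<tau> by auto
      then have "Inf {t \<in> {a..b}. g q \<le> g t} = \<tau>"
        using left \<tau> by (intro cInf_eq_minimum) (auto, metis not_le)
      then show ?thesis using q(1) by auto
    qed
  qed
  then show ?thesis using countable_rat by (meson countable_Un countable_image countable_subset)
qed

lemma regular_time_close:
  assumes \<tau>: "a \<le> \<tau>" "\<tau> \<le> b" "regular_time \<tau>" and e: "e > 0"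
  obtains \<eta> where "\<eta> > 0" "\<And>c d. fine_cell a b \<eta> c \<tau> d \<Longrightarrow> g \<tau> - e < g c \<and> g d < g \<tau> + e"
proof -
  have "\<exists>s1<\<tau>. \<forall>c. a \<le> c \<longrightarrow> s1 < c \<longrightarrow> c \<le> b \<longrightarrow> g \<tau> - e < g c"
  proof (cases "\<tau> = a")
    case True
    then have "g \<tau> - e < g c" if "a \<le> c" "c \<le> b" for c using g_le[of a c] that e by simp
    then show ?thesis using lt_ex by blast
  next
    case False
    obtain s where s: "a \<le> s" "s < \<tau>" "g \<tau> - e < g s" using left_close[of \<tau> e] False \<tau> e by auto
    have "g \<tau> - e < g c" if "s < c" "c \<le> b" for c using g_le[of s c] that s by simp
    then show ?thesis using s(2) by blast
  qed
  then obtain s1 where s1: "s1 < \<tau>" "\<And>c. a \<le> c \<Longrightarrow> s1 < c \<Longrightarrow> c \<le> b \<Longrightarrow> g \<tau> - e < g c" by blast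
  have "\<exists>s2>\<tau>. \<forall>d. a \<le> d \<longrightarrow> d < s2 \<longrightarrow> d \<le> b \<longrightarrow> g d < g \<tau> + e"
  proof (cases "\<tau> = b")
    case True
    then have "g d < g \<tau> + e" if "a \<le> d" "d \<le> b" for d using g_le[of d b] that e by simp
    then show ?thesis using gt_ex by blast
  next
    case False
    then obtain s where s: "\<tau> < s" "s \<le> b" "g s < g \<tau> + e"
      using right_lim(3)[of \<tau> e] \<tau> e by (auto simp: regular_time_def)
    have "g d < g \<tau> + e" if "a \<le> d" "d < s" for d using g_le[of d s] that s by simp
    then show ?thesis using s(1) by blast
  qed
  then obtain s2 where s2: "s2 > \<tau>" "\<And>d. a \<le> d \<Longrightarrow> d < s2 \<Longrightarrow> d \<le> b \<Longrightarrow> g d < g \<tau> + e" by blast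
  show ?thesis
    by (rule that[of "min (\<tau> - s1) (s2 - \<tau>)"]) (use s1 s2 in auto)
qed

text \<open>
  A cell \<open>[c, d]\<close> with a regular tag \<open>\<tau>\<close> is sent to the cell \<open>[g c, g d]\<close> with tag \<open>g \<tau>\<close>, where
  the Henstock majorant applies. A short cell around a flat tag has no increment at all, and the
  countably many remaining tags are absorbed by a jump function.
\<close>

lemma ks_primitive_of_integral:
  fixes f :: "real \<Rightarrow> 'a::euclidean_space"
  assumes int: "(\<lambda>y. f (ginv y)) integrable_on {g a..g b}"
  shows "ks_primitive f g a b (\<lambda>t. integral {g a..g t} (\<lambda>y. f (ginv y)))"
proof -
  define F where "F y = f (ginv y)" for y
  define H where "H y = integral {g a..y} F" for y
  have intF: "F integrable_on {g a..g b}" using int by (simp add: F_def[abs_def])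
  have intF': "F integrable_on {u..v}" if "g a \<le> u" "v \<le> g b" for u v
    by (rule integrable_subinterval_real[OF intF]) (use that in auto)
  have Hdiff: "H v - H u = integral {u..v} F" if "g a \<le> u" "u \<le> v" "v \<le> g b" for u v
    unfolding H_def using Henstock_Kurzweil_Integration.integral_combine[OF that(1,2) intF'[OF order_refl that(3)]]
    by (simp add: algebra_simps)
  have Hcont: "continuous_on {g a..g b} H"
    unfolding H_def by (rule indefinite_integral_continuous_1[OF intF])
  have gap: "H (right_lim \<tau>) - H (g \<tau>) = (right_lim \<tau> - g \<tau>) *\<^sub>R f \<tau>" if \<tau>: "a \<le> \<tau>" "\<tau> < b" for \<tau>
  proof -
    have "(F has_integral (right_lim \<tau> - g \<tau>) *\<^sub>R f \<tau>) {g \<tau>..right_lim \<tau>}"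
      using has_integral_gap[OF \<tau>, of f] by (simp add: F_def[abs_def])
    then show ?thesis
      using Hdiff[of "g \<tau>" "right_lim \<tau>"] right_lim(1)[OF \<tau>] right_lim_le[OF \<tau>] g_le[of a \<tau>] \<tau>
      by (simp add: integral_unique)
  qed
  define D where "D = {\<tau> \<in> {a..b}. \<not> flat_at \<tau> \<and> \<not> regular_time \<tau>}"
  have "countable D" unfolding D_def by (rule countable_exceptional_times)
  show ?thesis unfolding ks_primitive_def
  proof (intro allI impI)
    fix \<epsilon> :: real assume "\<epsilon> > 0"
    then have \<epsilon>2: "\<epsilon> / 2 > 0" by simp
    obtain \<delta>' V' where V': "\<And>y. 0 < \<delta>' y" "mono_on {g a..g b} V'" "V' (g b) - V' (g a) \<le> \<epsilon> / 2"
      "\<And>v y w. fine_cell (g a) (g b) (\<delta>' y) v y w \<Longrightarrow>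
        norm (integral {v..w} F - (w - v) *\<^sub>R F y) \<le> V' w - V' v"
      using Henstock_majorant[OF intF g_le[OF order_refl ab order_refl] \<epsilon>2] by blast
    obtain C e where C: "mono C" "\<And>x. 0 \<le> C x" "\<And>x. C x \<le> \<epsilon> / 2" "\<And>y. 0 < e y"
      "\<And>v y w. y \<in> D \<Longrightarrow> v \<le> y \<Longrightarrow> y \<le> w \<Longrightarrow> v < w \<Longrightarrow> e y \<le> C w - C v"
      using countable_jump_function[OF \<open>countable D\<close> \<epsilon>2] by blast
    define V where "V t = V' (g t) + C t" for t
    have V'mono: "V' (g s) \<le> V' (g t)" if "a \<le> s" "s \<le> t" "t \<le> b" for s t
      using mono_onD[OF V'(2), of "g s" "g t"] g_le[of s t] g_bounds[of s] g_bounds[of t] that by auto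
    have Vmono: "mono_on {a..b} V" unfolding V_def
      by (intro mono_onI add_mono V'mono monoD[OF C(1)]) auto
    have Vtot: "V b - V a \<le> \<epsilon>" using V'(3) C(2)[of a] C(3)[of b] unfolding V_def by linarith
    have gauge: "\<exists>\<delta>>0. \<forall>c d. fine_cell a b \<delta> c \<tau> d \<longrightarrow>
      norm (H (g d) - H (g c) - (g d - g c) *\<^sub>R f \<tau>) \<le> V d - V c" if \<tau>: "a \<le> \<tau>" "\<tau> \<le> b" for \<tau>
    proof -
      consider "flat_at \<tau>" | "regular_time \<tau>" | "\<tau> \<in> D" using \<tau> by (auto simp: D_def)
      then show ?thesis
      proof cases
        case 1
        then obtain \<eta> where \<eta>: "\<eta> > 0" "\<forall>t\<in>{a..b}. \<bar>t - \<tau>\<bar> < \<eta> \<longrightarrow> g t = g \<tau>" by (auto simp: flat_at_def)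
        show ?thesis
        proof (intro exI[of _ \<eta>] conjI allI impI)
          fix c d assume cd: "fine_cell a b \<eta> c \<tau> d"
          have "g c = g \<tau>" by (rule \<eta>(2)[rule_format]) (use cd \<tau> in auto)
          moreover have "g d = g \<tau>" by (rule \<eta>(2)[rule_format]) (use cd \<tau> in auto)
          moreover have "V c \<le> V d" using mono_onD[OF Vmono] cd by auto
          ultimately show "norm (H (g d) - H (g c) - (g d - g c) *\<^sub>R f \<tau>) \<le> V d - V c" by simp
        qed (use \<eta> in auto)
      next
        case 2
        obtain \<eta> where \<eta>: "\<eta> > 0" "\<And>c d. fine_cell a b \<eta> c \<tau> d \<Longrightarrow>
            g \<tau> - \<delta>' (g \<tau>) < g c \<and> g d < g \<tau> + \<delta>' (g \<tau>)"
          using regular_time_close[OF \<tau> 2 V'(1)] by blast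
        show ?thesis
        proof (intro exI[of _ \<eta>] conjI allI impI)
          fix c d assume cd: "fine_cell a b \<eta> c \<tau> d"
          have gs: "g a \<le> g c" "g c \<le> g \<tau>" "g \<tau> \<le> g d" "g d \<le> g b" using g_le cd by auto
          have "norm (integral {g c..g d} F - (g d - g c) *\<^sub>R F (g \<tau>)) \<le> V' (g d) - V' (g c)"
            by (rule V'(4)) (use gs \<eta>(2)[OF cd] in auto)
          moreover have "F (g \<tau>) = f \<tau>" using 2 by (simp add: F_def regular_time_def)
          moreover have "C c \<le> C d" using monoD[OF C(1)] cd by auto
          ultimately show "norm (H (g d) - H (g c) - (g d - g c) *\<^sub>R f \<tau>) \<le> V d - V c"
            using Hdiff[of "g c" "g d"] gs by (simp add: V_def)
        qed (use \<eta> in auto)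
      next
        case 3
        obtain \<eta> where \<eta>: "\<eta> > 0" "\<And>c d. fine_cell a b \<eta> c \<tau> d \<Longrightarrow>
            norm (H (g d) - H (g c) - (g d - g c) *\<^sub>R f \<tau>) \<le> e \<tau>"
          using cell_increment_small[OF Hcont \<tau> gap[OF \<tau>(1)] C(4)[of \<tau>]] by blast
        show ?thesis
        proof (intro exI[of _ \<eta>] conjI allI impI)
          fix c d assume cd: "fine_cell a b \<eta> c \<tau> d"
          show "norm (H (g d) - H (g c) - (g d - g c) *\<^sub>R f \<tau>) \<le> V d - V c"
          proof (cases "c = d")
            case False
            then have "e \<tau> \<le> C d - C c" using C(5)[OF 3, of c d] cd by auto
            moreover have "V' (g c) \<le> V' (g d)" using V'mono cd by auto
            ultimately show ?thesis using \<eta>(2)[OF cd] by (simp add: V_def)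
          qed auto
        qed (use \<eta> in auto)
      qed
    qed
    have "\<exists>\<delta>>0. \<forall>c d. fine_cell a b \<delta> c \<tau> d \<longrightarrow>
      norm (H (g d) - H (g c) - (g d - g c) *\<^sub>R f \<tau>) \<le> V d - V c" for \<tau>
    proof (cases "a \<le> \<tau> \<and> \<tau> \<le> b")
      case True
      then show ?thesis using gauge by blast
    next
      case False
      then show ?thesis by (intro exI[of _ 1]) auto
    qed
    then obtain \<delta> where "\<And>\<tau>. 0 < \<delta> \<tau>" "\<And>\<tau> c d. fine_cell a b (\<delta> \<tau>) c \<tau> d \<Longrightarrow>
      norm (H (g d) - H (g c) - (g d - g c) *\<^sub>R f \<tau>) \<le> V d - V c" by metis
    then show "\<exists>\<delta> V. (\<forall>t. 0 < \<delta> t) \<and> mono_on {a..b} V \<and> V b - V a \<le> \<epsilon> \<and>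
     (\<forall>c \<tau> d. fine_cell a b (\<delta> \<tau>) c \<tau> d \<longrightarrow>
        norm (integral {g a..g d} (\<lambda>y. f (ginv y)) - integral {g a..g c} (\<lambda>y. f (ginv y)) - (g d - g c) *\<^sub>R f \<tau>)
            \<le> V d - V c)"
      using Vmono Vtot unfolding H_def F_def[abs_def] by (intro exI[of _ \<delta>] exI[of _ V]) auto
  qed
qed

end

section \<open>Integrals over times give integrals over levels\<close>

context left_continuous_integrator
begin

text \<open>
  The pseudo-inverse is continuous from the right; continuity from the left fails at the level of
  an interval of constancy.
\<close>

lemma ginv_right_near:
  assumes y: "g a \<le> y" and \<eta>0: "\<eta>0 > 0"
  obtains \<eta> where "\<eta> > 0" "\<And>w. y \<le> w \<Longrightarrow> w \<le> g b \<Longrightarrow> w < y + \<eta> \<Longrightarrow> ginv w < ginv y + \<eta>0"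
proof (cases "ginv y + \<eta>0 \<le> b")
  case True
  have 1: "a \<le> ginv y + \<eta>0" using ginv_bounds[OF y] \<eta>0 by auto
  have "y < g (ginv y + \<eta>0)" using ginv_less[OF 1 True y] \<eta>0 by simp
  then show ?thesis using ginv_less[OF 1 True] y by (intro that[of "g (ginv y + \<eta>0) - y"]) auto
next
  case False
  have "ginv w < ginv y + \<eta>0" if "y \<le> w" for w using ginv_bounds(2)[of w] that y False by linarith
  then show ?thesis by (intro that[of 1]) auto
qed

text \<open>
  A level is treated without further ado if it lies strictly inside a gap of the range of \<open>g\<close>, or
  if it is attained exactly once. The others are the levels of intervals of constancy and the
  upper ends of gaps that are not attained, again countably many.
\<close>

definition gap_level :: "real \<Rightarrow> bool" where
  "gap_level y \<longleftrightarrow> g (ginv y) < y \<and> (\<exists>w0>y. \<forall>d. ginv y < d \<longrightarrow> d \<le> b \<longrightarrow> w0 \<le> g d)"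

definition regular_level :: "real \<Rightarrow> bool" where
  "regular_level y \<longleftrightarrow> g (ginv y) = y \<and> (\<forall>t\<in>{a..b}. g t = y \<longrightarrow> t = ginv y)"

lemma countable_exceptional_levels: "countable {y \<in> {g a..g b}. \<not> gap_level y \<and> \<not> regular_level y}"
proof -
  have "{y \<in> {g a..g b}. \<not> gap_level y \<and> \<not> regular_level y} \<subseteq> g ` \<rat> \<union> (\<lambda>q. right_lim (ginv q)) ` \<rat>"
    (is "_ \<subseteq> ?R")
  proof
    fix y assume "y \<in> {y \<in> {g a..g b}. \<not> gap_level y \<and> \<not> regular_level y}"
    then have y: "g a \<le> y" "y \<le> g b" "\<not> gap_level y" "\<not> regular_level y" by auto
    define \<tau> where "\<tau> = ginv y"
    have \<tau>: "a \<le> \<tau>" "\<tau> \<le> b" "g \<tau> \<le> y" using ginv_bounds[OF y(1)] g_ginv_le[OF y(1)] by (auto simp: \<tau>_def)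
    show "y \<in> ?R"
    proof (cases "g \<tau> = y")
      case True
      then obtain t where t: "a \<le> t" "t \<le> b" "g t = y" "t \<noteq> \<tau>"
        using y(4) by (auto simp: regular_level_def \<tau>_def)
      then have "t < \<tau>" using ginv_galois[OF t(1,2) y(1)] by (simp add: \<tau>_def)
      then obtain q where q: "q \<in> \<rat>" "t < q" "q < \<tau>" using Rats_dense_in_real by blast
      have "g q = y" using g_le[of t q] g_le[of q \<tau>] q t \<tau> True by auto
      then show ?thesis using q(1) by auto
    next
      case False
      with \<tau> have lt: "g \<tau> < y" by simp
      have "\<tau> < b" using lt y \<tau> by (metis order_le_less not_less)
      have "y \<le> right_lim \<tau>"
      proof (rule field_le_epsilon)
        fix e :: real assume "e > 0"
        then obtain s where "\<tau> < s" "s \<le> b" "g s < right_lim \<tau> + e" using right_lim(3)[OF \<tau>(1) \<open>\<tau> < b\<close>] by blast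
        moreover have "y < g s" using ginv_less[of s y] calculation \<tau> y by (auto simp: \<tau>_def)
        ultimately show "y \<le> right_lim \<tau> + e" by simp
      qed
      moreover have "\<not> y < right_lim \<tau>"
        using y(3) lt right_lim(2)[OF \<tau>(1) \<open>\<tau> < b\<close>] unfolding gap_level_def \<tau>_def[symmetric] by blast
      ultimately have eq: "right_lim \<tau> = y" by simp
      obtain q where q: "q \<in> \<rat>" "g \<tau> < q" "q < y" using Rats_dense_in_real lt by blast
      then have "ginv q = \<tau>" using ginv_gap[OF \<tau>(1) \<open>\<tau> < b\<close>] eq by auto
      then show ?thesis using q(1) eq by auto
    qed
  qed
  then show ?thesis using countable_rat by (meson countable_Un countable_image countable_subset)
qed

lemma leftmost_time:
  assumes y: "g a \<le> y" "y \<le> g b"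
  obtains \<alpha> where "a \<le> \<alpha>" "\<alpha> \<le> b" "g \<alpha> \<le> y"
    "\<And>t. a \<le> t \<Longrightarrow> t < \<alpha> \<Longrightarrow> g t < y" "\<And>t. \<alpha> < t \<Longrightarrow> t \<le> b \<Longrightarrow> y \<le> g t"
proof -
  define A where "A = {t \<in> {a..b}. y \<le> g t}"
  have A: "A \<noteq> {}" "bdd_below A" using ab y by (auto simp: A_def intro!: bdd_belowI[of _ a])
  have \<alpha>: "a \<le> Inf A" "Inf A \<le> b"
    using A ab y by (auto intro!: cInf_greatest cInf_lower simp: A_def)
  have below: "g t < y" if "a \<le> t" "t < Inf A" for t
    using cInf_lower[OF _ A(2), of t] that \<alpha> by (fastforce simp: A_def)
  have above: "y \<le> g t" if t: "Inf A < t" "t \<le> b" for t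
  proof -
    obtain s where "s \<in> A" "s < t" using cInf_lessD[OF A(1), of t] t by blast
    then show ?thesis using g_le[of s t] t by (auto simp: A_def)
  qed
  have "g (Inf A) \<le> y"
  proof (rule ccontr)
    assume "\<not> g (Inf A) \<le> y"
    moreover from this have "a < Inf A" using y \<alpha> by (metis order_le_less)
    ultimately obtain s where "a \<le> s" "s < Inf A" "g (Inf A) - (g (Inf A) - y) < g s"
      using left_close[of "Inf A" "g (Inf A) - y"] \<alpha> by auto
    then show False using below[of s] by auto
  qed
  with \<alpha> below above show ?thesis using that by blast
qed

end

lemma affine_abs_le:
  fixes A B :: real
  assumes "\<bar>A + B * x\<bar> \<le> C" "\<bar>A + B * z\<bar> \<le> C" "x \<le> v" "v \<le> z"
  shows "\<bar>A + B * v\<bar> \<le> C"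
proof (cases "B \<ge> 0")
  case True
  with assms have "B * x \<le> B * v" "B * v \<le> B * z" by (auto intro: mult_left_mono)
  then show ?thesis using assms by linarith
next
  case False
  with assms have "B * x \<ge> B * v" "B * v \<ge> B * z" by (auto intro: mult_left_mono_neg)
  then show ?thesis using assms by linarith
qed

text \<open>
  A primitive \<open>\<Phi>\<close> of \<open>f\<close> with respect to \<open>g\<close> becomes a function of the level by setting its value
  at \<open>g t\<close> to \<open>\<Phi> t\<close> and interpolating linearly in the gaps of the range. The slope in the gap at
  \<open>t\<close> must be \<open>f t\<close>, because a primitive jumps by \<open>f t\<close> times the jump of \<open>g\<close>. The task is to show
  that the interpolant is an indefinite integral of \<open>f (ginv y)\<close>.
\<close>

locale integrator_with_primitive = left_continuous_integrator g a b
  for g :: "real \<Rightarrow> real" and a b :: real +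
  fixes f \<Phi> :: "real \<Rightarrow> real"
  assumes prim: "ks_primitive f g a b \<Phi>"
begin

definition interpolant :: "real \<Rightarrow> real" where
  "interpolant y = \<Phi> (ginv y) + f (ginv y) * (y - g (ginv y))"

lemma interpolant_g:
  assumes t: "a \<le> t" "t \<le> b"
  shows "interpolant (g t) = \<Phi> t"
proof -
  have ga: "g a \<le> g t" using g_le t by auto
  have 1: "t \<le> ginv (g t)" using ginv_galois[OF t ga] by simp
  have 2: "ginv (g t) \<le> b" using ginv_bounds[OF ga] by simp
  have "g (ginv (g t)) = g t" using g_ginv_le[OF ga] g_le[OF t(1) 1 2] by simp
  then show ?thesis using ks_primitive_flat[OF prim g_mono t(1) 1 2] by (simp add: interpolant_def)
qed

lemma primitive_increment_small:
  assumes e: "e > 0"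
  obtains \<eta> where "\<eta> > 0" "\<And>c d. fine_cell a b \<eta> c \<tau> d \<Longrightarrow> \<bar>\<Phi> d - \<Phi> c - (g d - g c) * f \<tau>\<bar> \<le> e"
proof -
  obtain \<delta> V where V: "\<And>t. 0 < \<delta> t" "mono_on {a..b} V" "V b - V a \<le> e"
    "\<And>c \<tau> d. fine_cell a b (\<delta> \<tau>) c \<tau> d \<Longrightarrow> norm (\<Phi> d - \<Phi> c - (g d - g c) *\<^sub>R f \<tau>) \<le> V d - V c"
    using ks_primitiveE[OF prim e] by blast
  show ?thesis
  proof (rule that[OF V(1)[of \<tau>]])
    fix c d assume cd: "fine_cell a b (\<delta> \<tau>) c \<tau> d"
    have "V a \<le> V c" "V d \<le> V b" using mono_onD[OF V(2), of a c] mono_onD[OF V(2), of d b] cd by auto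
    then show "\<bar>\<Phi> d - \<Phi> c - (g d - g c) * f \<tau>\<bar> \<le> e" using V(4)[OF cd] V(3) by simp
  qed
qed

text \<open>
  This is where cells of levels that end inside a gap are handled. In the gap, the interpolant
  minus an affine function is affine, so a bound for its absolute value at the two ends of the gap
  holds throughout. At the upper end the bound is available as a limit of times decreasing to
  \<open>ginv v\<close>.
\<close>

lemma interpolant_affine_bound:
  assumes v: "g a \<le> v" "v \<le> g b" and x: "ginv v < x"
    and est: "\<And>d. ginv v \<le> d \<Longrightarrow> d < x \<Longrightarrow> d \<le> b \<Longrightarrow> \<bar>\<Phi> d - q - p * g d\<bar> \<le> C"
  shows "\<bar>interpolant v - q - p * v\<bar> \<le> C"
proof -
  define t where "t = ginv v"
  have t: "a \<le> t" "t \<le> b" "g t \<le> v" using ginv_bounds[OF v(1)] g_ginv_le[OF v(1)] by (auto simp: t_def)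
  show ?thesis
  proof (cases "g t = v")
    case True
    then have "interpolant v = \<Phi> t" by (simp add: interpolant_def t_def)
    then show ?thesis using est[of t] True x t by (simp add: t_def)
  next
    case False
    then have "t < b" using t v by (metis order_le_less not_less)
    show ?thesis
    proof (rule field_le_epsilon)
      fix e :: real assume "e > 0"
      then obtain \<eta> where \<eta>: "\<eta> > 0"
        "\<And>c d. fine_cell a b \<eta> c t d \<Longrightarrow> \<bar>\<Phi> d - \<Phi> c - (g d - g c) * f t\<bar> \<le> e"
        using primitive_increment_small by metis
      have "t < min (min x (t + \<eta>)) b" using x \<eta> \<open>t < b\<close> by (simp add: t_def)
      then obtain d where d: "t < d" "d < min (min x (t + \<eta>)) b" using dense by blast
      have gd: "v < g d" using ginv_less[of d v] d t v by (auto simp: t_def)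
      have 1: "\<bar>\<Phi> d - \<Phi> t - (g d - g t) * f t\<bar> \<le> e" using \<eta>(2)[of t d] d t \<eta>(1) by auto
      have 2: "\<bar>\<Phi> d - q - p * g d\<bar> \<le> C" "\<bar>\<Phi> t - q - p * g t\<bar> \<le> C"
        using est[of d] est[of t] d t x by (auto simp: t_def)
      have "\<bar>(\<Phi> t - f t * g t - q) + (f t - p) * v\<bar> \<le> C + e"
      proof (rule affine_abs_le[of _ _ "g t" _ "g d"])
        have "(\<Phi> t - f t * g t - q) + (f t - p) * g t = \<Phi> t - q - p * g t" by (simp add: algebra_simps)
        then show "\<bar>(\<Phi> t - f t * g t - q) + (f t - p) * g t\<bar> \<le> C + e" using 2 \<open>e > 0\<close> by simp
        have "(\<Phi> t - f t * g t - q) + (f t - p) * g d = (\<Phi> d - q - p * g d) - (\<Phi> d - \<Phi> t - (g d - g t) * f t)"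
          by (simp add: algebra_simps)
        then show "\<bar>(\<Phi> t - f t * g t - q) + (f t - p) * g d\<bar> \<le> C + e" using 1 2 by linarith
      qed (use t gd in auto)
      then show "\<bar>interpolant v - q - p * v\<bar> \<le> C + e" by (simp add: interpolant_def t_def algebra_simps)
    qed
  qed
qed

lemma interpolant_right:
  assumes y: "g a \<le> y" and w: "y \<le> w" "w \<le> g b" and x: "ginv w < x"
    and est: "\<And>d. ginv w \<le> d \<Longrightarrow> d < x \<Longrightarrow> d \<le> b \<Longrightarrow>
      \<bar>\<Phi> d - \<Phi> (ginv y) - (g d - g (ginv y)) * f (ginv y)\<bar> \<le> C"
  shows "\<bar>interpolant w - interpolant y - (w - y) * f (ginv y)\<bar> \<le> C"
proof -
  define \<tau> where "\<tau> = ginv y"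
  have "\<bar>interpolant w - (\<Phi> \<tau> - f \<tau> * g \<tau>) - f \<tau> * w\<bar> \<le> C"
  proof (rule interpolant_affine_bound[OF _ w(2) x])
    fix d assume "ginv w \<le> d" "d < x" "d \<le> b"
    from est[OF this] show "\<bar>\<Phi> d - (\<Phi> \<tau> - f \<tau> * g \<tau>) - f \<tau> * g d\<bar> \<le> C"
      by (simp add: \<tau>_def algebra_simps)
  qed (use y w in auto)
  then show ?thesis by (simp add: interpolant_def[of y] \<tau>_def algebra_simps)
qed

lemma interpolant_left:
  assumes \<tau>: "a \<le> \<tau>" "\<tau> \<le> b" and v: "g a \<le> v" "v < g \<tau>"
    and est: "\<And>d. ginv v \<le> d \<Longrightarrow> d < \<tau> \<Longrightarrow> \<bar>\<Phi> \<tau> - \<Phi> d - (g \<tau> - g d) * f \<tau>\<bar> \<le> C"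
  shows "\<bar>interpolant (g \<tau>) - interpolant v - (g \<tau> - v) * f \<tau>\<bar> \<le> C"
proof -
  have "\<bar>interpolant v - (\<Phi> \<tau> - f \<tau> * g \<tau>) - f \<tau> * v\<bar> \<le> C"
  proof (rule interpolant_affine_bound[where x = \<tau>])
    show "v \<le> g b" using v g_le[of \<tau> b] \<tau> by simp
    show "ginv v < \<tau>" using ginv_less[OF \<tau> v(1)] v(2) by simp
    fix d assume d: "ginv v \<le> d" "d < \<tau>" "d \<le> b"
    have "\<Phi> d - (\<Phi> \<tau> - f \<tau> * g \<tau>) - f \<tau> * g d = - (\<Phi> \<tau> - \<Phi> d - (g \<tau> - g d) * f \<tau>)"
      by (simp add: algebra_simps)
    then show "\<bar>\<Phi> d - (\<Phi> \<tau> - f \<tau> * g \<tau>) - f \<tau> * g d\<bar> \<le> C"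
      using est[OF d(1,2)] by (simp only: abs_minus_cancel)
  qed (rule v)
  moreover have "interpolant v - (\<Phi> \<tau> - f \<tau> * g \<tau>) - f \<tau> * v = - (interpolant (g \<tau>) - interpolant v - (g \<tau> - v) * f \<tau>)"
    using interpolant_g[OF \<tau>] by (simp add: algebra_simps)
  ultimately show ?thesis by (simp only: abs_minus_cancel)
qed

text \<open>
  Left continuity, in the form of an affine approximation. The relevant time is the infimum \<open>\<alpha>\<close> of
  the times that reach the level \<open>y\<close>, which may precede \<open>ginv y\<close>. If \<open>g \<alpha> < y\<close> then \<open>y\<close> lies in
  the closed gap at \<open>\<alpha>\<close>, where the interpolant is affine with slope \<open>f \<alpha>\<close>; otherwise the levels
  below \<open>y\<close> belong to times increasing to \<open>\<alpha>\<close>.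
\<close>

lemma interpolant_left_slope:
  assumes y: "g a \<le> y" "y \<le> g b" and e: "e > 0"
  obtains p \<eta> where "\<eta> > 0"
    "\<And>v. g a \<le> v \<Longrightarrow> v \<le> y \<Longrightarrow> y - \<eta> < v \<Longrightarrow> \<bar>interpolant y - interpolant v - (y - v) * p\<bar> \<le> e"
proof (cases "y = g a")
  case True
  have "\<bar>interpolant y - interpolant v - (y - v) * 0\<bar> \<le> e" if "g a \<le> v" "v \<le> y" for v
  proof -
    have "v = y" using that True by simp
    then show ?thesis using e by simp
  qed
  then show ?thesis using that[of 1 0] by simp
next
  case False
  define \<tau> where "\<tau> = ginv y"
  have \<tau>: "a \<le> \<tau>" "\<tau> \<le> b" "g \<tau> \<le> y" using ginv_bounds[OF y(1)] g_ginv_le[OF y(1)] by (auto simp: \<tau>_def)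
  obtain \<alpha> where \<alpha>: "a \<le> \<alpha>" "\<alpha> \<le> b" and g\<alpha>: "g \<alpha> \<le> y"
    and below: "\<And>t. a \<le> t \<Longrightarrow> t < \<alpha> \<Longrightarrow> g t < y" and above: "\<And>t. \<alpha> < t \<Longrightarrow> t \<le> b \<Longrightarrow> y \<le> g t"
    using leftmost_time[OF y] by blast
  show ?thesis
  proof (cases "g \<alpha> = y")
    case True
    have "a < \<alpha>" using False True \<alpha> by (metis order_le_less)
    obtain \<eta>0 where \<eta>0: "\<eta>0 > 0" "\<And>c d. fine_cell a b \<eta>0 c \<alpha> d \<Longrightarrow> \<bar>\<Phi> d - \<Phi> c - (g d - g c) * f \<alpha>\<bar> \<le> e"
      using primitive_increment_small[OF e] by metis
    have "max a (\<alpha> - \<eta>0) < \<alpha>" using \<open>a < \<alpha>\<close> \<eta>0 by auto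
    then obtain s where s: "max a (\<alpha> - \<eta>0) < s" "s < \<alpha>" using dense by blast
    have gs: "g s < y" using below[of s] s by auto
    show ?thesis
    proof (rule that[of "y - g s" "f \<alpha>"])
      fix v assume v: "g a \<le> v" "v \<le> y" "y - (y - g s) < v"
      show "\<bar>interpolant y - interpolant v - (y - v) * f \<alpha>\<bar> \<le> e"
      proof (cases "v = y")
        case False
        have "s \<le> ginv v" using ginv_galois[of s v] v s \<alpha> by auto
        then have "\<bar>interpolant (g \<alpha>) - interpolant v - (g \<alpha> - v) * f \<alpha>\<bar> \<le> e"
          using v False \<open>g \<alpha> = y\<close> \<alpha> s \<eta>0(1) by (intro interpolant_left \<eta>0(2)) auto
        then show ?thesis using True by simp
      qed (use e in auto)
    qed (use gs in auto)
  next
    case False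
    with g\<alpha> have lt: "g \<alpha> < y" by simp
    have \<alpha>\<tau>: "\<alpha> \<le> \<tau>" using ginv_galois[OF \<alpha> y(1)] g\<alpha> by (simp add: \<tau>_def)
    have iy: "interpolant y = \<Phi> \<alpha> + f \<alpha> * (y - g \<alpha>)"
    proof (cases "\<tau> = \<alpha>")
      case True
      then show ?thesis by (simp add: interpolant_def \<tau>_def)
    next
      case False
      with \<alpha>\<tau> have "\<alpha> < \<tau>" by simp
      have g\<tau>: "g t = y" "\<Phi> t = \<Phi> \<tau>" if "\<alpha> < t" "t \<le> \<tau>" for t
      proof -
        show "g t = y" using above[of t] g_le[of t \<tau>] that \<tau> \<alpha> by auto
        moreover have "g \<tau> = y" using above[of \<tau>] \<tau> \<open>\<alpha> < \<tau>\<close> by auto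
        ultimately show "\<Phi> t = \<Phi> \<tau>" using ks_primitive_flat[OF prim g_mono, of t \<tau>] that \<alpha> \<tau> by auto
      qed
      have "interpolant y = \<Phi> \<tau>" using g\<tau>(1)[of \<tau>] \<open>\<alpha> < \<tau>\<close> interpolant_g[OF \<tau>(1,2)] by simp
      moreover have "\<bar>\<Phi> \<tau> - \<Phi> \<alpha> - (y - g \<alpha>) * f \<alpha>\<bar> \<le> 0"
      proof (rule field_le_epsilon)
        fix e' :: real assume "e' > 0"
        then obtain \<eta> where \<eta>: "\<eta> > 0" "\<And>c d. fine_cell a b \<eta> c \<alpha> d \<Longrightarrow> \<bar>\<Phi> d - \<Phi> c - (g d - g c) * f \<alpha>\<bar> \<le> e'"
          using primitive_increment_small by metis
        have "\<alpha> < min \<tau> (\<alpha> + \<eta>)" using \<open>\<alpha> < \<tau>\<close> \<eta> by simp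
        then obtain t where t: "\<alpha> < t" "t < min \<tau> (\<alpha> + \<eta>)" using dense by blast
        have "\<bar>\<Phi> t - \<Phi> \<alpha> - (g t - g \<alpha>) * f \<alpha>\<bar> \<le> e'" using \<eta>(2)[of \<alpha> t] \<eta>(1) t \<alpha> \<tau> by auto
        then show "\<bar>\<Phi> \<tau> - \<Phi> \<alpha> - (y - g \<alpha>) * f \<alpha>\<bar> \<le> 0 + e'" using g\<tau>[of t] t by simp
      qed
      ultimately show ?thesis by (simp add: algebra_simps)
    qed
    show ?thesis
    proof (rule that[of "y - g \<alpha>" "f \<alpha>"])
      fix v assume v: "g a \<le> v" "v \<le> y" "y - (y - g \<alpha>) < v"
      show "\<bar>interpolant y - interpolant v - (y - v) * f \<alpha>\<bar> \<le> e"
      proof (cases "v = y")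
        case False
        have "ginv v = \<alpha>"
          by (rule ginv_eqI[OF \<alpha>]) (use v False above in force)+
        then have "interpolant v = \<Phi> \<alpha> + f \<alpha> * (v - g \<alpha>)" by (simp add: interpolant_def)
        then have "interpolant y - interpolant v - (y - v) * f \<alpha> = 0" using iy by (simp add: algebra_simps)
        then show ?thesis using e by simp
      qed (use e in auto)
    qed (use lt in auto)
  qed
qed

text \<open>
  Since the interpolant is continuous, the error of a short cell is small whatever value the
  integrand has at the tag. This suffices at the exceptional levels.
\<close>

lemma interpolant_increment_small:
  assumes y: "g a \<le> y" "y \<le> g b" and e: "e > 0"
  obtains \<eta> where "\<eta> > 0" "\<And>v w. fine_cell (g a) (g b) \<eta> v y w \<Longrightarrow>
    \<bar>interpolant w - interpolant v - (w - v) * f (ginv y)\<bar> \<le> e"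
proof -
  define \<tau> where "\<tau> = ginv y"
  have \<tau>: "a \<le> \<tau>" "\<tau> \<le> b" using ginv_bounds[OF y(1)] by (auto simp: \<tau>_def)
  have e2: "e / 2 > 0" and e4: "e / 4 > 0" using e by simp_all
  obtain p \<eta>1 where \<eta>1: "\<eta>1 > 0"
    "\<And>v. g a \<le> v \<Longrightarrow> v \<le> y \<Longrightarrow> y - \<eta>1 < v \<Longrightarrow> \<bar>interpolant y - interpolant v - (y - v) * p\<bar> \<le> e / 4"
    using interpolant_left_slope[OF y e4] by blast
  obtain \<eta>0 where \<eta>0: "\<eta>0 > 0" "\<And>c d. fine_cell a b \<eta>0 c \<tau> d \<Longrightarrow> \<bar>\<Phi> d - \<Phi> c - (g d - g c) * f \<tau>\<bar> \<le> e / 2"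
    using primitive_increment_small[OF e2] by metis
  obtain \<eta>2 where \<eta>2: "\<eta>2 > 0" "\<And>w. y \<le> w \<Longrightarrow> w \<le> g b \<Longrightarrow> w < y + \<eta>2 \<Longrightarrow> ginv w < \<tau> + \<eta>0"
    using ginv_right_near[OF y(1) \<eta>0(1)] unfolding \<tau>_def by blast
  \<comment> \<open>The radius \<open>\<eta>3\<close> limits the effect of replacing the left slope \<open>p\<close> by \<open>f \<tau>\<close>.\<close>
  define \<eta>3 where "\<eta>3 = e / 4 / (\<bar>p - f \<tau>\<bar> + 1)"
  have k: "0 < \<bar>p - f \<tau>\<bar> + 1" by linarith
  have \<eta>3: "\<eta>3 > 0" unfolding \<eta>3_def by (intro divide_pos_pos k) (use e in auto)
  show ?thesis
  proof (rule that[of "min \<eta>1 (min \<eta>2 \<eta>3)"])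
    fix v w assume vw: "fine_cell (g a) (g b) (min \<eta>1 (min \<eta>2 \<eta>3)) v y w"
    have 1: "\<bar>interpolant y - interpolant v - (y - v) * p\<bar> \<le> e / 4" using \<eta>1(2) vw by auto
    have gw: "\<tau> \<le> ginv w" "ginv w < \<tau> + \<eta>0" using ginv_mono[OF y(1), of w] \<eta>2(2)[of w] vw by (auto simp: \<tau>_def)
    have 2: "\<bar>interpolant w - interpolant y - (w - y) * f \<tau>\<bar> \<le> e / 2"
      unfolding \<tau>_def
    proof (rule interpolant_right[OF y(1) _ _ gw(2)])
      fix d assume "ginv w \<le> d" "d < \<tau> + \<eta>0" "d \<le> b"
      then show "\<bar>\<Phi> d - \<Phi> (ginv y) - (g d - g (ginv y)) * f (ginv y)\<bar> \<le> e / 2"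
        using \<eta>0(2)[of \<tau> d] \<eta>0(1) gw(1) \<tau> by (auto simp: \<tau>_def)
    qed (use vw in auto)
    have "\<bar>(y - v) * (p - f \<tau>)\<bar> \<le> \<eta>3 * (\<bar>p - f \<tau>\<bar> + 1)"
      unfolding abs_mult using vw by (intro mult_mono) auto
    also have "\<dots> = e / 4" unfolding \<eta>3_def using k by (metis nonzero_eq_divide_eq order_less_irrefl)
    finally have 3: "\<bar>(y - v) * (p - f \<tau>)\<bar> \<le> e / 4" .
    have "interpolant w - interpolant v - (w - v) * f \<tau>
        = (interpolant y - interpolant v - (y - v) * p) + (interpolant w - interpolant y - (w - y) * f \<tau>)
          + (y - v) * (p - f \<tau>)"
      by (simp add: algebra_simps)
    then show "\<bar>interpolant w - interpolant v - (w - v) * f (ginv y)\<bar> \<le> e"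
      using 1 2 3 unfolding \<tau>_def by linarith
  qed (use \<eta>1 \<eta>2 \<eta>3 in auto)
qed

text \<open>
  The error of a fine cell of levels is bounded by an increment of \<open>W\<close>, a sum of three monotone
  functions. For a regular tag the left part of the cell costs an increment of \<open>V (ginv y)\<close>. The
  right part costs an increment of \<open>Vh\<close>: the end \<open>w\<close> may lie in a gap, so \<open>V\<close> has to be taken at
  times whose level reaches \<open>w\<close>. The jump function \<open>C\<close> pays for the exceptional levels, and tags
  in the interior of gaps cause no error. The increments of \<open>W\<close> telescope over any tagged
  division.
\<close>

theorem has_integral_of_ks_primitive:
  "((\<lambda>y. f (ginv y)) has_integral \<Phi> b - \<Phi> a) {g a..g b}"
  unfolding has_integral_real
proof (intro allI impI)
  fix \<epsilon> :: real assume "\<epsilon> > 0"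
  then have \<epsilon>4: "\<epsilon> / 4 > 0" by simp
  obtain \<delta> V where V: "\<And>t. 0 < \<delta> t" "mono_on {a..b} V" "V b - V a \<le> \<epsilon> / 4"
    "\<And>c \<tau> d. fine_cell a b (\<delta> \<tau>) c \<tau> d \<Longrightarrow> norm (\<Phi> d - \<Phi> c - (g d - g c) *\<^sub>R f \<tau>) \<le> V d - V c"
    using ks_primitiveE[OF prim \<epsilon>4] by blast
  have Vm: "V s \<le> V t" if "a \<le> s" "s \<le> t" "t \<le> b" for s t using mono_onD[OF V(2)] that by auto
  define E where "E = {y \<in> {g a..g b}. \<not> gap_level y \<and> \<not> regular_level y}"
  have "countable E" unfolding E_def by (rule countable_exceptional_levels)
  obtain C e where C: "mono C" "\<And>x. 0 \<le> C x" "\<And>x. C x \<le> \<epsilon> / 4" "\<And>y. 0 < e y"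
    "\<And>v y w. y \<in> E \<Longrightarrow> v \<le> y \<Longrightarrow> y \<le> w \<Longrightarrow> v < w \<Longrightarrow> e y \<le> C w - C v"
    using countable_jump_function[OF \<open>countable E\<close> \<epsilon>4] by blast
  define Vh where "Vh y = Inf (V ` {t \<in> {a..b}. y \<le> g t})" for y
  have Vh_le: "Vh y \<le> V t" if "a \<le> t" "t \<le> b" "y \<le> g t" for y t
    unfolding Vh_def using that Vm by (intro cInf_lower bdd_belowI[of _ "V a"]) auto
  have Vh_ge: "c \<le> Vh y" if "y \<le> g b" "\<And>t. a \<le> t \<Longrightarrow> t \<le> b \<Longrightarrow> y \<le> g t \<Longrightarrow> c \<le> V t" for y c
    unfolding Vh_def using that ab by (intro cInf_greatest) auto
  have Vh_mono: "Vh v \<le> Vh w" if "v \<le> w" "w \<le> g b" for v w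
    using that by (intro Vh_ge Vh_le) auto
  have Vg_mono: "V (ginv v) \<le> V (ginv w)" if "g a \<le> v" "v \<le> w" for v w
    using ginv_mono[OF that] ginv_bounds[of v] ginv_bounds[of w] that by (intro Vm) auto
  define W where "W y = V (ginv y) + Vh y + C y" for y
  have W_mono: "W v \<le> W w" if "g a \<le> v" "v \<le> w" "w \<le> g b" for v w
    unfolding W_def using Vg_mono[OF that(1,2)] Vh_mono[OF that(2,3)] monoD[OF C(1) that(2)] by linarith
  have gab: "g a \<le> g b" using g_le ab by auto
  have Wtot: "W (g b) - W (g a) \<le> 3 * (\<epsilon> / 4)"
  proof -
    have "V (ginv (g b)) \<le> V b" "V a \<le> V (ginv (g a))"
      using ginv_bounds[OF gab] ginv_bounds[of "g a"] by (auto intro!: Vm)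
    moreover have "Vh (g b) \<le> V b" "V a \<le> Vh (g a)"
      using gab ab by (auto intro!: Vh_le Vh_ge Vm)
    ultimately show ?thesis unfolding W_def using V(3) C(2)[of "g a"] C(3)[of "g b"] by linarith
  qed
  have gauge: "\<exists>\<eta>>0. \<forall>v w. fine_cell (g a) (g b) \<eta> v y w \<longrightarrow>
      \<bar>interpolant w - interpolant v - (w - v) * f (ginv y)\<bar> \<le> W w - W v"
    if y: "g a \<le> y" "y \<le> g b" for y
  proof -
    define \<tau> where "\<tau> = ginv y"
    have \<tau>: "a \<le> \<tau>" "\<tau> \<le> b" "g \<tau> \<le> y" using ginv_bounds[OF y(1)] g_ginv_le[OF y(1)] by (auto simp: \<tau>_def)
    consider "gap_level y" | "regular_level y" | "y \<in> E" using y by (auto simp: E_def)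
    then show ?thesis
    proof cases
      case 1
      then obtain w0 where w0: "g \<tau> < y" "y < w0" "\<And>d. \<tau> < d \<Longrightarrow> d \<le> b \<Longrightarrow> w0 \<le> g d"
        by (auto simp: gap_level_def \<tau>_def)
      show ?thesis
      proof (intro exI[of _ "min (y - g \<tau>) (w0 - y)"] conjI allI impI)
        fix v w assume vw: "fine_cell (g a) (g b) (min (y - g \<tau>) (w0 - y)) v y w"
        have "ginv v = \<tau>" "ginv w = \<tau>"
          by (rule ginv_eqI[OF \<tau>(1,2)]; use vw w0 in force)+
        then have "interpolant w - interpolant v - (w - v) * f (ginv y) = 0"
          by (simp add: interpolant_def \<tau>_def algebra_simps)
        then show "\<bar>interpolant w - interpolant v - (w - v) * f (ginv y)\<bar> \<le> W w - W v"
          using W_mono[of v w] vw by simp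
      qed (use w0 in auto)
    next
      case 2
      then have reg: "g \<tau> = y" "\<And>t. a \<le> t \<Longrightarrow> t \<le> b \<Longrightarrow> g t = y \<Longrightarrow> t = \<tau>"
        by (auto simp: regular_level_def \<tau>_def)
      have iy: "interpolant y = \<Phi> \<tau>" using interpolant_g[OF \<tau>(1,2)] reg by simp
      obtain \<eta>1 where \<eta>1: "\<eta>1 > 0" "\<And>w. y \<le> w \<Longrightarrow> w \<le> g b \<Longrightarrow> w < y + \<eta>1 \<Longrightarrow> ginv w < \<tau> + \<delta> \<tau>"
        using ginv_right_near[OF y(1) V(1)[of \<tau>]] unfolding \<tau>_def by blast
      have "\<exists>\<eta>2>0. \<forall>v. g a \<le> v \<longrightarrow> y - \<eta>2 < v \<longrightarrow> \<tau> - \<delta> \<tau> < ginv v"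
      proof (cases "\<tau> = a")
        case True
        have "\<tau> - \<delta> \<tau> < ginv v" if "g a \<le> v" for v using ginv_bounds(1)[OF that] V(1)[of \<tau>] True by simp
        then show ?thesis by (intro exI[of _ 1]) auto
      next
        case False
        have "max a (\<tau> - \<delta> \<tau>) < \<tau>" using False \<tau> V(1)[of \<tau>] by auto
        then obtain s where s: "max a (\<tau> - \<delta> \<tau>) < s" "s < \<tau>" using dense by blast
        have "g s < y" using g_le[of s \<tau>] reg(2)[of s] s \<tau> by force
        moreover have "\<tau> - \<delta> \<tau> < ginv v" if "g a \<le> v" "g s < v" for v
          using ginv_galois[of s v] that s \<tau> by auto
        ultimately show ?thesis by (intro exI[of _ "y - g s"]) auto
      qed
      then obtain \<eta>2 where \<eta>2: "\<eta>2 > 0" "\<And>v. g a \<le> v \<Longrightarrow> y - \<eta>2 < v \<Longrightarrow> \<tau> - \<delta> \<tau> < ginv v" by blast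
      show ?thesis
      proof (intro exI[of _ "min \<eta>1 \<eta>2"] conjI allI impI)
        fix v w assume vw: "fine_cell (g a) (g b) (min \<eta>1 \<eta>2) v y w"
        define D where "D = ginv w"
        have D: "\<tau> \<le> D" "D < \<tau> + \<delta> \<tau>" "D \<le> b" "g D \<le> w"
          using ginv_mono[OF y(1), of w] \<eta>1(2)[of w] ginv_bounds[of w] g_ginv_le[of w] y vw
              by (auto simp: D_def \<tau>_def)
        have R: "\<bar>interpolant w - interpolant y - (w - y) * f \<tau>\<bar> + V \<tau> \<le> Vh w"
        proof (rule Vh_ge)
          show "w \<le> g b" using vw by simp
          fix t assume t: "a \<le> t" "t \<le> b" "w \<le> g t"
          have "\<tau> \<le> t"
          proof (rule ccontr)
            assume "\<not> \<tau> \<le> t"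
            then have "g t \<le> g \<tau>" using g_le t \<tau> by auto
            then have "g t = y" using reg t vw by auto
            then show False using reg(2)[of t] t \<open>\<not> \<tau> \<le> t\<close> by auto
          qed
          show "\<bar>interpolant w - interpolant y - (w - y) * f \<tau>\<bar> + V \<tau> \<le> V t"
          proof (cases "t \<le> D")
            case True
            have "g t = w" using g_le[of t D] True t D by auto
            then have "interpolant w = \<Phi> t" using interpolant_g t by auto
            moreover have "norm (\<Phi> t - \<Phi> \<tau> - (g t - g \<tau>) *\<^sub>R f \<tau>) \<le> V t - V \<tau>"
              using V(1)[of \<tau>] \<open>\<tau> \<le> t\<close> t(2) \<tau>(1) D(2) True by (intro V(4)) auto
            ultimately show ?thesis using iy reg(1) \<open>g t = w\<close> by simp
          next
            case False
            have "\<bar>interpolant w - interpolant y - (w - y) * f (ginv y)\<bar> \<le> V t - V \<tau>"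
            proof (rule interpolant_right[OF y(1), of _ "min t (\<tau> + \<delta> \<tau>)"])
              fix d assume d: "ginv w \<le> d" "d < min t (\<tau> + \<delta> \<tau>)" "d \<le> b"
              have "\<bar>\<Phi> d - \<Phi> \<tau> - (g d - g \<tau>) * f \<tau>\<bar> \<le> V d - V \<tau>"
                using V(4)[of \<tau> \<tau> d] V(1)[of \<tau>] d D \<tau> by (auto simp: D_def)
              moreover have "V d \<le> V t" using Vm[of d t] d D t \<tau> by (auto simp: D_def)
              ultimately show "\<bar>\<Phi> d - \<Phi> (ginv y) - (g d - g (ginv y)) * f (ginv y)\<bar> \<le> V t - V \<tau>"
                by (simp add: \<tau>_def)
            qed (use vw False D in \<open>auto simp: D_def\<close>)
            then show ?thesis by (simp add: \<tau>_def)
          qed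
        qed
        have L: "\<bar>interpolant y - interpolant v - (y - v) * f \<tau>\<bar> \<le> V \<tau> - V (ginv v)"
        proof (cases "v = y")
          case False
          have gv: "a \<le> ginv v" "\<tau> - \<delta> \<tau> < ginv v" using ginv_bounds[of v] \<eta>2(2)[of v] vw by auto
          have "\<bar>interpolant (g \<tau>) - interpolant v - (g \<tau> - v) * f \<tau>\<bar> \<le> V \<tau> - V (ginv v)"
          proof (rule interpolant_left[OF \<tau>(1,2)])
            fix d assume d: "ginv v \<le> d" "d < \<tau>"
            have "\<bar>\<Phi> \<tau> - \<Phi> d - (g \<tau> - g d) * f \<tau>\<bar> \<le> V \<tau> - V d"
              using V(4)[of d \<tau> \<tau>] V(1)[of \<tau>] d gv \<tau> by auto
            moreover have "V (ginv v) \<le> V d" using Vm[of "ginv v" d] d gv \<tau> by auto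
            ultimately show "\<bar>\<Phi> \<tau> - \<Phi> d - (g \<tau> - g d) * f \<tau>\<bar> \<le> V \<tau> - V (ginv v)" by linarith
          qed (use vw False reg in auto)
          then show ?thesis by (simp only: reg(1))
        qed (simp add: \<tau>_def)
        have "interpolant w - interpolant v - (w - v) * f (ginv y)
            = (interpolant w - interpolant y - (w - y) * f \<tau>) + (interpolant y - interpolant v - (y - v) * f \<tau>)"
          by (simp add: algebra_simps \<tau>_def)
        moreover have "V \<tau> \<le> V (ginv w)" using Vg_mono[OF y(1), of w] vw by (simp add: \<tau>_def)
        moreover have "Vh v \<le> V \<tau>" using Vh_le[OF \<tau>(1,2), of v] vw reg by auto
        moreover have "C v \<le> C w" using monoD[OF C(1), of v w] vw by auto
        ultimately show "\<bar>interpolant w - interpolant v - (w - v) * f (ginv y)\<bar> \<le> W w - W v"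
          using R L unfolding W_def by linarith
      qed (use \<eta>1 \<eta>2 in auto)
    next
      case 3
      obtain \<eta> where \<eta>: "\<eta> > 0" "\<And>v w. fine_cell (g a) (g b) \<eta> v y w \<Longrightarrow>
        \<bar>interpolant w - interpolant v - (w - v) * f (ginv y)\<bar> \<le> e y"
        using interpolant_increment_small[OF y C(4)[of y]] by blast
      show ?thesis
      proof (intro exI[of _ \<eta>] conjI allI impI)
        fix v w assume vw: "fine_cell (g a) (g b) \<eta> v y w"
        show "\<bar>interpolant w - interpolant v - (w - v) * f (ginv y)\<bar> \<le> W w - W v"
        proof (cases "v = w")
          case False
          then have "e y \<le> C w - C v" using C(5)[OF 3, of v w] vw by auto
          moreover have "V (ginv v) \<le> V (ginv w)" "Vh v \<le> Vh w" using Vg_mono Vh_mono vw by auto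
          ultimately show ?thesis using \<eta>(2)[OF vw] unfolding W_def by linarith
        qed auto
      qed (use \<eta> in auto)
    qed
  qed
  have "\<exists>\<eta>>0. \<forall>v w. fine_cell (g a) (g b) \<eta> v y w \<longrightarrow>
      \<bar>interpolant w - interpolant v - (w - v) * f (ginv y)\<bar> \<le> W w - W v" for y
  proof (cases "g a \<le> y \<and> y \<le> g b")
    case True
    then show ?thesis using gauge by blast
  next
    case False
    then show ?thesis by (intro exI[of _ 1]) auto
  qed
  then obtain \<eta> where \<eta>: "\<And>y. 0 < \<eta> y" "\<And>y v w. fine_cell (g a) (g b) (\<eta> y) v y w \<Longrightarrow>
    \<bar>interpolant w - interpolant v - (w - v) * f (ginv y)\<bar> \<le> W w - W v" by metis
  show "\<exists>\<gamma>. gauge \<gamma> \<and> (\<forall>\<D>. \<D> tagged_division_of {g a..g b} \<and> \<gamma> fine \<D> \<longrightarrow>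
      norm ((\<Sum>(x, K)\<in>\<D>. measure lborel K *\<^sub>R f (ginv x)) - (\<Phi> b - \<Phi> a)) < \<epsilon>)"
  proof (intro exI[of _ "\<lambda>y. ball y (\<eta> y)"] conjI allI impI)
    show "gauge (\<lambda>y. ball y (\<eta> y))" using \<eta>(1) by (intro gauge_ball_dependent) auto
    fix p assume p: "p tagged_division_of {g a..g b} \<and> (\<lambda>y. ball y (\<eta> y)) fine p"
    note tel = additive_tagged_division_1[OF gab conjunct1[OF p]]
    have "(\<Sum>(x, K)\<in>p. measure lborel K *\<^sub>R f (ginv x) - (interpolant (Sup K) - interpolant (Inf K)))
        = (\<Sum>(x, K)\<in>p. measure lborel K *\<^sub>R f (ginv x)) - (\<Phi> b - \<Phi> a)"
      using tel[of interpolant] interpolant_g ab by (simp add: sum_subtractf split_def)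
    moreover have "norm (\<Sum>(x, K)\<in>p. measure lborel K *\<^sub>R f (ginv x) - (interpolant (Sup K) - interpolant (Inf K)))
        \<le> (\<Sum>(x, K)\<in>p. W (Sup K) - W (Inf K))"
    proof (rule sum_norm_le, clarify)
      fix x K assume xK: "(x, K) \<in> p"
      then obtain v w where K: "K = {v..w}" using p by (metis box_real(2) tagged_division_ofD(4))
      have 1: "x \<in> K" "K \<subseteq> {g a..g b}" using p xK by (blast dest: tagged_division_ofD)+
      have 2: "K \<subseteq> ball x (\<eta> x)" using p xK by auto
      have vx: "v \<le> x" "x \<le> w" using 1(1) by (auto simp: K)
      then have "v \<in> K" "w \<in> K" by (auto simp: K)
      then have "v \<in> {g a..g b}" "w \<in> {g a..g b}" "v \<in> ball x (\<eta> x)" "w \<in> ball x (\<eta> x)"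
        using 1(2) 2 by blast+
      with vx have "fine_cell (g a) (g b) (\<eta> x) v x w" by (auto simp: dist_real_def)
      from \<eta>(2)[OF this] show "norm (measure lborel K *\<^sub>R f (ginv x) - (interpolant (Sup K) - interpolant (Inf K)))
          \<le> W (Sup K) - W (Inf K)"
        using vx by (simp add: K abs_minus_commute)
    qed
    moreover have "(\<Sum>(x, K)\<in>p. W (Sup K) - W (Inf K)) = W (g b) - W (g a)" by (rule tel)
    moreover have "W (g b) - W (g a) < \<epsilon>" using Wtot \<open>\<epsilon> > 0\<close> by linarith
    ultimately show "norm ((\<Sum>(x, K)\<in>p. measure lborel K *\<^sub>R f (ginv x)) - (\<Phi> b - \<Phi> a)) < \<epsilon>" by simp
  qed
qed

end

section \<open>The change of variable on the half-line\<close>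

text \<open>
  Perron's construction needs the order of the reals, so vector-valued integrands are treated
  componentwise.
\<close>

lemma ks_has_integral_inner_Basis:
  fixes f :: "real \<Rightarrow> 'a::euclidean_space"
  assumes "ks_has_integral f g a b I" "i \<in> Basis"
  shows "ks_has_integral (\<lambda>s. f s \<bullet> i) g a b (I \<bullet> i)"
  unfolding ks_has_integral_def
proof (intro conjI allI impI)
  show "a \<le> b" using assms by (simp add: ks_has_integral_def)
  fix \<epsilon> :: real assume "\<epsilon> > 0"
  then obtain \<delta> where \<delta>: "gauge_on \<delta> a b" "\<And>k s \<tau>. tagged_partition a b k s \<tau> \<and> delta_fine \<delta> k s \<tau> \<Longrightarrow>
           norm ((\<Sum>i<k. (g (s (Suc i)) - g (s i)) *\<^sub>R f (\<tau> i)) - I) < \<epsilon>"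
    using assms(1) unfolding ks_has_integral_def by blast
  show "\<exists>\<delta>. gauge_on \<delta> a b \<and> (\<forall>k s \<tau>. tagged_partition a b k s \<tau> \<and> delta_fine \<delta> k s \<tau> \<longrightarrow>
           norm ((\<Sum>j<k. (g (s (Suc j)) - g (s j)) *\<^sub>R (f (\<tau> j) \<bullet> i)) - I \<bullet> i) < \<epsilon>)"
  proof (intro exI[of _ \<delta>] conjI allI impI \<delta>(1))
    fix k s \<tau> assume *: "tagged_partition a b k s \<tau> \<and> delta_fine \<delta> k s \<tau>"
    let ?S = "\<Sum>j<k. (g (s (Suc j)) - g (s j)) *\<^sub>R f (\<tau> j)"
    have "(\<Sum>j<k. (g (s (Suc j)) - g (s j)) *\<^sub>R (f (\<tau> j) \<bullet> i)) - I \<bullet> i = (?S - I) \<bullet> i"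
      by (simp add: inner_diff_left inner_sum_left)
    moreover have "\<bar>(?S - I) \<bullet> i\<bar> \<le> norm (?S - I)" using assms(2) by (rule Basis_le_norm)
    ultimately show "norm ((\<Sum>j<k. (g (s (Suc j)) - g (s j)) *\<^sub>R (f (\<tau> j) \<bullet> i)) - I \<bullet> i) < \<epsilon>"
      using \<delta>(2)[OF *] by simp
  qed
qed

locale stieltjes_integrator =
  fixes g :: "real \<Rightarrow> real"
  assumes g_mono: "mono_on {0..} g"
    and g_left: "\<And>t. t > 0 \<Longrightarrow> (g \<longlongrightarrow> g t) (at_left t)"
begin

definition ginv :: "real \<Rightarrow> real" where
  "ginv y = Sup {t. 0 \<le> t \<and> g t \<le> y}"

text \<open>
  The supremum of the range is excluded even if it is attained: when \<open>g\<close> is eventually constant,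
  the last time at that level does not exist. It is a single level and thus negligible.
\<close>

definition levels :: "real set" where
  "levels = {y. g 0 \<le> y \<and> (\<exists>t\<ge>0. y < g t)}"

lemma g_le: "0 \<le> s \<Longrightarrow> s \<le> t \<Longrightarrow> g s \<le> g t"
  using mono_onD[OF g_mono, of s t] by auto

lemma on_interval: "0 \<le> c \<Longrightarrow> c \<le> d \<Longrightarrow> left_continuous_integrator g c d"
  by unfold_locales (auto intro: g_left mono_on_subset[OF g_mono])

lemma ginv_on_interval:
  assumes "0 \<le> c" "c \<le> d" "g c \<le> y" "y < g d"
  shows "left_continuous_integrator.ginv g c d y = ginv y"
proof -
  interpret I: left_continuous_integrator g c d using assms by (intro on_interval)
  have "ginv y = I.ginv y"
    unfolding ginv_def
  proof (rule cSup_eq_maximum)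
    show "I.ginv y \<in> {t. 0 \<le> t \<and> g t \<le> y}"
      using I.ginv_bounds[OF assms(3)] I.g_ginv_le[OF assms(3)] assms by auto
    fix t assume t: "t \<in> {t. 0 \<le> t \<and> g t \<le> y}"
    have "t \<le> d" using g_le[of d t] t assms by (cases "d \<le> t") auto
    show "t \<le> I.ginv y"
    proof (cases "c \<le> t")
      case True
      then show ?thesis using I.ginv_galois[of t y] t \<open>t \<le> d\<close> assms by auto
    qed (use I.ginv_bounds[OF assms(3)] in auto)
  qed
  then show ?thesis by simp
qed

lemma ginv_galois:
  assumes "y \<in> levels" "0 \<le> t"
  shows "g t \<le> y \<longleftrightarrow> t \<le> ginv y"
proof -
  obtain s where s: "0 \<le> s" "y < g s" "g 0 \<le> y" using assms by (auto simp: levels_def)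
  define d where "d = max s t"
  have "y < g d" using g_le[of s d] s by (auto simp: d_def)
  interpret I: left_continuous_integrator g 0 d using s by (intro on_interval) (auto simp: d_def)
  have "I.ginv y = ginv y" using s \<open>y < g d\<close> by (intro ginv_on_interval) (auto simp: d_def)
  then show ?thesis using I.ginv_galois[of t y] s assms by (auto simp: d_def)
qed

lemma ginv_nonneg: "y \<in> levels \<Longrightarrow> 0 \<le> ginv y"
  using ginv_galois[of y 0] by (auto simp: levels_def)

lemma g_ginv_le: "y \<in> levels \<Longrightarrow> g (ginv y) \<le> y"
  using ginv_galois[of y "ginv y"] ginv_nonneg by auto

lemma ginv_mono: "mono_on levels ginv"
  using ginv_galois g_ginv_le ginv_nonneg by (intro mono_onI) (meson order_trans)

lemma levelsI: "0 \<le> c \<Longrightarrow> 0 \<le> d \<Longrightarrow> g c \<le> y \<Longrightarrow> y < g d \<Longrightarrow> y \<in> levels"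
  using g_le[of 0 c] by (auto simp: levels_def intro: order_trans)

lemma has_integral_of_ks:
  fixes f :: "real \<Rightarrow> 'a::euclidean_space"
  assumes "ks_has_integral f g c d I" "0 \<le> c"
  shows "((\<lambda>y. f (ginv y)) has_integral I) {g c..g d}"
proof -
  have "c \<le> d" using assms by (simp add: ks_has_integral_def)
  interpret I: left_continuous_integrator g c d by (intro on_interval assms \<open>c \<le> d\<close>)
  have "((\<lambda>y. f (ginv y) \<bullet> i) has_integral I \<bullet> i) {g c..g d}" if i: "i \<in> Basis" for i
  proof -
    obtain \<Phi> where \<Phi>: "ks_primitive (\<lambda>s. f s \<bullet> i) g c d \<Phi>" "\<Phi> d - \<Phi> c = I \<bullet> i"
      using ks_has_integral_imp_primitive[OF ks_has_integral_inner_Basis[OF assms(1) i]] .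
    interpret P: integrator_with_primitive g c d "\<lambda>s. f s \<bullet> i" \<Phi> by unfold_locales (rule \<Phi>(1))
    have "((\<lambda>y. f (I.ginv y) \<bullet> i) has_integral I \<bullet> i) {g c..g d}"
      using P.has_integral_of_ks_primitive \<Phi>(2) by simp
    then show ?thesis
      by (rule has_integral_spike[of "{g d}", rotated 2]) (use ginv_on_interval[OF assms(2) \<open>c \<le> d\<close>] in auto)
  qed
  then show ?thesis by (subst has_integral_componentwise_iff) blast
qed

lemma ks_of_integrable:
  fixes f :: "real \<Rightarrow> 'a::euclidean_space"
  assumes "0 \<le> c" "c \<le> d" and int: "(\<lambda>y. f (ginv y)) integrable_on {g c..g d}"
  shows "ks_has_integral f g c d (integral {g c..g d} (\<lambda>y. f (ginv y)))"
proof -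
  interpret I: left_continuous_integrator g c d by (intro on_interval assms)
  have eq: "f (I.ginv y) = f (ginv y)" if "y \<in> {g c..g d} - {g d}" for y
    using ginv_on_interval[OF assms(1,2)] that by auto
  have "(\<lambda>y. f (I.ginv y)) integrable_on {g c..g d}"
    by (rule integrable_spike[OF int, of "{g d}"]) (use eq in auto)
  from ks_primitive_imp_has_integral[OF I.ks_primitive_of_integral[OF this] assms(2)]
  have "ks_has_integral f g c d (integral {g c..g d} (\<lambda>y. f (I.ginv y)))" by simp
  moreover have "integral {g c..g d} (\<lambda>y. f (I.ginv y)) = integral {g c..g d} (\<lambda>y. f (ginv y))"
    by (rule integral_spike[of "{g d}"]) (use eq in auto)
  ultimately show ?thesis by simp
qed

lemma ks_integral_eq:
  fixes f :: "real \<Rightarrow> 'a::euclidean_space"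
  assumes "\<And>a. a > 0 \<Longrightarrow> ks_integrable f g 0 a"
  shows integrable_levels: "\<And>t. t \<ge> 0 \<Longrightarrow> (\<lambda>y. f (ginv y)) integrable_on {g 0..g t}"
    and "0 \<le> c \<Longrightarrow> c \<le> d \<Longrightarrow> ks_integral f g c d = integral {g c..g d} (\<lambda>y. f (ginv y))"
proof -
  show 1: "(\<lambda>y. f (ginv y)) integrable_on {g 0..g t}" if "t \<ge> 0" for t
  proof (cases "t = 0")
    case False
    with assms that obtain I where "ks_has_integral f g 0 t I" unfolding ks_integrable_def by fastforce
    from has_integral_of_ks[OF this] show ?thesis by blast
  qed (use integrable_on_refl[of _ "g 0"] in \<open>simp add: box_real\<close>)
  show "ks_integral f g c d = integral {g c..g d} (\<lambda>y. f (ginv y))" if "0 \<le> c" "c \<le> d"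
  proof (intro ks_integral_unique ks_of_integrable that)
    have "(\<lambda>y. f (ginv y)) integrable_on {g 0..g d}" using 1 that by simp
    then show "(\<lambda>y. f (ginv y)) integrable_on {g c..g d}"
      by (rule integrable_subinterval_real) (use g_le[of 0 c] that in auto)
  qed
qed

text \<open>
  A Lebesgue differentiation theorem with respect to \<open>g\<close>. If \<open>y\<close> belongs to a jump of \<open>g\<close>, the
  averages tend to the average over the gap, where the integrand is constant. Otherwise
  \<open>y = g (ginv y)\<close> and the level \<open>g d\<close> decreases to \<open>y\<close>, so the differentiation theorem on the
  line applies.
\<close>

lemma integral_averages_tendsto:
  fixes F :: "real \<Rightarrow> 'a::euclidean_space"
  assumes int: "\<And>t. t \<ge> 0 \<Longrightarrow> (\<lambda>y. F (ginv y)) integrable_on {g 0..g t}"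
  obtains Z where "negligible Z"
    "\<And>y. y \<in> levels - Z \<Longrightarrow>
       ((\<lambda>d. integral {g (ginv y)..g d} (\<lambda>s. F (ginv s)) /\<^sub>R (g d - g (ginv y))) \<longlongrightarrow> F (ginv y)) (at_right (ginv y))"
proof -
  define Fk where "Fk k y = (if y \<in> {g 0..g (real k)} then F (ginv y) else 0)" for k y
  have "Fk k integrable_on cbox u v" for k u v
  proof -
    have "Fk k integrable_on UNIV"
      unfolding Fk_def using int[of "real k"]
      by (subst Henstock_Kurzweil_Integration.integrable_restrict_UNIV) auto
    then show ?thesis by (rule integrable_on_subcbox) auto
  qed
  then have "\<forall>k. \<exists>N. negligible N \<and> (\<forall>x e. x \<notin> N \<longrightarrow> 0 < e \<longrightarrow> (\<exists>d>0. \<forall>h. 0 < h \<and> h < d \<longrightarrow>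
      norm (integral (cbox x (x + h *\<^sub>R One)) (Fk k) /\<^sub>R h ^ DIM(real) - Fk k x) < e))"
    using integrable_ccontinuous_explicit by metis
  then obtain N where N: "\<And>k. negligible (N k)" "\<And>k x e. x \<notin> N k \<Longrightarrow> 0 < e \<Longrightarrow> \<exists>d>0. \<forall>h. 0 < h \<and> h < d \<longrightarrow>
      norm (integral (cbox x (x + h *\<^sub>R One)) (Fk k) /\<^sub>R h ^ DIM(real) - Fk k x) < e"
    by metis
  have N': "\<exists>d>0. \<forall>h. 0 < h \<and> h < d \<longrightarrow> norm (integral {x..x + h} (Fk k) /\<^sub>R h - Fk k x) < e"
    if "x \<notin> N k" "0 < e" for k x e
    using N(2)[OF that] by simp
  show ?thesis
  proof (rule that[of "\<Union>k. N k"])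
    show "negligible (\<Union>k. N k)" by (rule negligible_Union_nat) (rule N(1))
    fix y assume y: "y \<in> levels - (\<Union>k. N k)"
    then obtain t where t: "0 \<le> t" "y < g t" "g 0 \<le> y" by (auto simp: levels_def)
    obtain k where k: "t < real k" using reals_Archimedean2 by blast
    have yk: "y < g (real k)" using g_le[of t "real k"] t k by simp
    interpret I: left_continuous_integrator g 0 "real k" by (intro on_interval) auto
    define \<tau> where "\<tau> = ginv y"
    have \<tau>y: "I.ginv y = \<tau>" using ginv_on_interval[of 0 "real k" y] t yk by (simp add: \<tau>_def)
    have \<tau>: "0 \<le> \<tau>" "\<tau> < real k" "g \<tau> \<le> y"
      using I.ginv_bounds[OF t(3)] I.ginv_less[of "real k" y] I.g_ginv_le[OF t(3)] \<tau>y yk t k by auto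
    have above: "y < g d" if "\<tau> < d" "d \<le> real k" for d
      using I.ginv_less[of d y] that \<tau> \<tau>y t by auto
    define r where "r = I.right_lim \<tau>"
    note rl = I.right_lim[OF \<tau>(1,2), folded r_def] I.right_lim_le[OF \<tau>(1,2), folded r_def]
    have glim: "(g \<longlongrightarrow> r) (at_right \<tau>)" using I.right_lim_tendsto[OF \<tau>(1,2)] by (simp add: r_def)
    have ev: "\<forall>\<^sub>F d in at_right \<tau>. d \<in> {\<tau><..<real k}" using \<tau>(2) eventually_at_right_real by blast
    have g0\<tau>: "g 0 \<le> g \<tau>" using g_le \<tau> by simp
    show "((\<lambda>d. integral {g (ginv y)..g d} (\<lambda>s. F (ginv s)) /\<^sub>R (g d - g (ginv y))) \<longlongrightarrow> F (ginv y)) (at_right (ginv y))"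
      unfolding \<tau>_def[symmetric]
    proof (cases "g \<tau> < r")
      case True
      define H where "H z = integral {g 0..z} (\<lambda>s. F (ginv s))" for z
      have intk: "(\<lambda>s. F (ginv s)) integrable_on {g 0..g (real k)}" using int[of "real k"] by simp
      have Hc: "continuous_on {g 0..g (real k)} H" unfolding H_def by (rule indefinite_integral_continuous_1[OF intk])
      have Hd: "integral {u..v} (\<lambda>s. F (ginv s)) = H v - H u" if "g 0 \<le> u" "u \<le> v" "v \<le> g (real k)" for u v
      proof -
        have "(\<lambda>s. F (ginv s)) integrable_on {g 0..v}"
          by (rule integrable_subinterval_real[OF intk]) (use that in auto)
        from Henstock_Kurzweil_Integration.integral_combine[OF that(1,2) this] show ?thesis
          by (simp add: H_def algebra_simps)
      qed
      have "((\<lambda>d. H (g d)) \<longlongrightarrow> H r) (at_right \<tau>)"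
      proof (rule continuous_on_tendsto_compose[OF Hc glim])
        show "r \<in> {g 0..g (real k)}" using rl(1,4) g0\<tau> by auto
        show "\<forall>\<^sub>F d in at_right \<tau>. g d \<in> {g 0..g (real k)}"
          using ev by eventually_elim (use g_le \<tau> in auto)
      qed
      then have 1: "((\<lambda>d. (H (g d) - H (g \<tau>)) /\<^sub>R (g d - g \<tau>)) \<longlongrightarrow> (H r - H (g \<tau>)) /\<^sub>R (r - g \<tau>)) (at_right \<tau>)"
        by (intro tendsto_intros glim) (use True in auto)
      have "((\<lambda>s. F (ginv s)) has_integral (r - g \<tau>) *\<^sub>R F \<tau>) {g \<tau>..r}"
      proof (rule has_integral_spike[of "{r}"])
        show "((\<lambda>s. F (I.ginv s)) has_integral (r - g \<tau>) *\<^sub>R F \<tau>) {g \<tau>..r}"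
          using I.has_integral_gap[OF \<tau>(1,2)] by (simp add: r_def)
        show "F (ginv x) = F (I.ginv x)" if "x \<in> {g \<tau>..r} - {r}" for x
          using ginv_on_interval[of 0 "real k" x] that rl(4) g0\<tau> by auto
      qed auto
      then have "H r - H (g \<tau>) = (r - g \<tau>) *\<^sub>R F \<tau>"
        using Hd[of "g \<tau>" r] rl(1,4) g0\<tau> by (simp add: integral_unique)
      then have 2: "(H r - H (g \<tau>)) /\<^sub>R (r - g \<tau>) = F \<tau>" using True by simp
      show "((\<lambda>d. integral {g \<tau>..g d} (\<lambda>s. F (ginv s)) /\<^sub>R (g d - g \<tau>)) \<longlongrightarrow> F \<tau>) (at_right \<tau>)"
        by (rule Lim_transform_eventually[OF 1[unfolded 2]])
           (use ev in eventually_elim, use Hd g_le \<tau> g0\<tau> in auto)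
    next
      case False
      with rl(1) have r: "r = g \<tau>" by simp
      have yg: "y = g \<tau>"
      proof -
        have "y \<le> r"
        proof (rule field_le_epsilon)
          fix e :: real assume "e > 0"
          then obtain s where "\<tau> < s" "s \<le> real k" "g s < r + e" using rl(3) by blast
          then show "y \<le> r + e" using above[of s] by simp
        qed
        then show ?thesis using r \<tau>(3) by simp
      qed
      have hlim: "((\<lambda>d. g d - g \<tau>) \<longlongrightarrow> 0) (at_right \<tau>)"
        using tendsto_diff[OF glim tendsto_const[of "g \<tau>"]] r by simp
      show "((\<lambda>d. integral {g \<tau>..g d} (\<lambda>s. F (ginv s)) /\<^sub>R (g d - g \<tau>)) \<longlongrightarrow> F \<tau>) (at_right \<tau>)"
      proof (rule tendstoI)
        fix e :: real assume "e > 0"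
        have "y \<notin> N k" using y by blast
        from N'[OF this \<open>e > 0\<close>] obtain \<delta> where \<delta>: "\<delta> > 0" "\<And>h. 0 < h \<Longrightarrow> h < \<delta> \<Longrightarrow> norm (integral {y..y
            + h} (Fk k) /\<^sub>R h - Fk k y) < e"
          by blast
        have "\<forall>\<^sub>F d in at_right \<tau>. g d - g \<tau> < \<delta>" by (rule order_tendstoD(2)[OF hlim \<delta>(1)])
        with ev show "\<forall>\<^sub>F d in at_right \<tau>. dist (integral {g \<tau>..g d} (\<lambda>s. F (ginv s)) /\<^sub>R (g d - g \<tau>)) (F \<tau>) < e"
        proof eventually_elim
          case (elim d)
          have h: "0 < g d - g \<tau>" using above[of d] elim yg by auto
          have gdk: "g d \<le> g (real k)" using g_le elim \<tau> by auto
          have "integral {y..y + (g d - g \<tau>)} (Fk k) = integral {g \<tau>..g d} (\<lambda>s. F (ginv s))"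
            unfolding yg using gdk g0\<tau> by (auto simp: Fk_def intro!: Henstock_Kurzweil_Integration.integral_cong)
          moreover have "Fk k y = F \<tau>" using t yk by (simp add: Fk_def \<tau>_def)
          ultimately show ?case using \<delta>(2)[OF h elim(2)] by (simp add: dist_norm)
        qed
      qed
    qed
  qed
qed

end

section \<open>Arbitrary norms on Euclidean space\<close>

lemma is_normD:
  assumes "is_norm n"
  shows "0 \<le> n x" "n x = 0 \<longleftrightarrow> x = 0" "n (c *\<^sub>R x) = \<bar>c\<bar> * n x" "n (x + y) \<le> n x + n y" "n 0 = 0"
    "n (- x) = n x" "n (x - y) \<le> n x + n y" "n (x - y) = n (y - x)" "n x - n y \<le> n (x - y)"
proof -
  show 1: "0 \<le> n x" "n x = 0 \<longleftrightarrow> x = 0" "n (c *\<^sub>R x) = \<bar>c\<bar> * n x" "n (x + y) \<le> n x + n y"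
    for x y c using assms by (auto simp: is_norm_def)
  show "n 0 = 0" using 1(2) by simp
  show m: "n (- x) = n x" for x using 1(3)[of "-1" x] by simp
  show "n (x - y) \<le> n x + n y" using 1(4)[of x "- y"] m by simp
  show "n (x - y) = n (y - x)" using m[of "x - y"] by simp
  show "n x - n y \<le> n (x - y)" using 1(4)[of "x - y" y] by simp
qed

lemma is_norm_bound:
  fixes n :: "'a::euclidean_space \<Rightarrow> real"
  assumes n: "is_norm n"
  obtains C where "C > 0" "\<And>x. n x \<le> C * norm x"
proof -
  define C where "C = (\<Sum>i\<in>Basis. n i) + 1"
  have sum: "n (sum h A) \<le> (\<Sum>i\<in>A. n (h i))" if "finite A" for h and A :: "'a set"
    using that
  proof (induction A)
    case empty
    then show ?case using is_normD(5)[OF n] by simp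
  next
    case (insert x A)
    then show ?case using is_normD(4)[OF n, of "h x" "sum h A"] by simp
  qed
  have pos: "0 \<le> (\<Sum>i\<in>Basis. n i)" by (intro sum_nonneg is_normD[OF n])
  have "n x \<le> C * norm x" for x
  proof -
    have "n x = n (\<Sum>i\<in>Basis. (x \<bullet> i) *\<^sub>R i)" by (simp add: euclidean_representation)
    also have "\<dots> \<le> (\<Sum>i\<in>Basis. n ((x \<bullet> i) *\<^sub>R i))" by (rule sum) simp
    also have "\<dots> = (\<Sum>i\<in>Basis. \<bar>x \<bullet> i\<bar> * n i)" using is_normD(3)[OF n] by simp
    also have "\<dots> \<le> (\<Sum>i\<in>Basis. norm x * n i)"
      by (intro sum_mono mult_right_mono Basis_le_norm is_normD[OF n])
    also have "\<dots> \<le> C * norm x" unfolding C_def by (simp add: sum_distrib_left algebra_simps)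
    finally show ?thesis .
  qed
  then show ?thesis using that[of C] pos by (auto simp: C_def)
qed

lemma is_norm_continuous:
  fixes n :: "'a::euclidean_space \<Rightarrow> real"
  assumes n: "is_norm n"
  shows "continuous_on S n"
proof -
  obtain C where C: "C > 0" "\<And>x. n x \<le> C * norm x" using is_norm_bound[OF n] by blast
  have "isCont n x" for x
  proof -
    have "((\<lambda>y. C * norm (y - x)) \<longlongrightarrow> C * norm (x - x)) (at x)" by (intro tendsto_intros)
    then have 1: "((\<lambda>y. C * norm (y - x)) \<longlongrightarrow> 0) (at x)" by simp
    have "norm (n y - n x) \<le> C * norm (y - x)" for y
      using is_normD(9)[OF n, of y x] is_normD(9)[OF n, of x y] is_normD(8)[OF n, of x y] C(2)[of "y - x"] by simp
    then have "((\<lambda>y. n y - n x) \<longlongrightarrow> 0) (at x)" by (intro Lim_null_comparison[OF always_eventually 1]) blast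
    then show ?thesis by (simp add: isCont_def LIM_zero_iff)
  qed
  then show ?thesis by (simp add: continuous_at_imp_continuous_on)
qed

lemma norm_le_is_norm:
  fixes n :: "'a::euclidean_space \<Rightarrow> real"
  assumes n: "is_norm n"
  obtains C where "C > 0" "\<And>x. norm x \<le> C * n x"
proof -
  obtain z :: 'a where z: "norm z = 1" "\<And>y. norm y = 1 \<Longrightarrow> n z \<le> n y"
  proof -
    have "sphere (0::'a) 1 \<noteq> {}" by simp
    from continuous_attains_inf[OF compact_sphere this is_norm_continuous[OF n]] that show ?thesis by auto
  qed
  have "n z \<noteq> 0" using z is_normD(2)[OF n, of z] by auto
  then have "n z > 0" using is_normD(1)[OF n, of z] by simp
  have "norm x \<le> (1 / n z) * n x" for x
  proof (cases "x = 0")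
    case False
    have "n z \<le> n ((1 / norm x) *\<^sub>R x)" by (rule z(2)) (use False in simp)
    also have "\<dots> = n x / norm x" using is_normD(3)[OF n, of "1 / norm x" x] by simp
    finally show ?thesis using False \<open>n z > 0\<close> by (simp add: field_simps)
  qed (use is_normD(5)[OF n] in simp)
  then show ?thesis using that[of "1 / n z"] \<open>n z > 0\<close> by simp
qed

lemma is_norm_ball:
  fixes n :: "'a::euclidean_space \<Rightarrow> real"
  assumes n: "is_norm n"
  shows "compact {x. n x \<le> r}" "convex {x. n x \<le> r}"
proof -
  obtain C where C: "C > 0" "\<And>x. norm x \<le> C * n x" using norm_le_is_norm[OF n] by blast
  have "norm x \<le> C * r" if "n x \<le> r" for x using C(2)[of x] mult_left_mono[OF that, of C] C(1) by linarith
  then have "bounded {x. n x \<le> r}" by (auto intro: boundedI)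
  moreover have "closed {x. n x \<le> r}"
    by (rule closed_Collect_le[OF is_norm_continuous[OF n] continuous_on_const])
  ultimately show "compact {x. n x \<le> r}" by (simp add: compact_eq_bounded_closed)
  show "convex {x. n x \<le> r}"
  proof (rule convexI, clarify)
    fix x y :: 'a and u v :: real assume *: "n x \<le> r" "n y \<le> r" "0 \<le> u" "0 \<le> v" "u + v = 1"
    have "n (u *\<^sub>R x + v *\<^sub>R y) \<le> u * n x + v * n y"
      using is_normD(4)[OF n, of "u *\<^sub>R x" "v *\<^sub>R y"] is_normD(3)[OF n] * by simp
    also have "\<dots> \<le> u * r + v * r" using * by (intro add_mono mult_left_mono) auto
    also have "\<dots> = r" using * by (simp add: distrib_right[symmetric])
    finally show "n (u *\<^sub>R x + v *\<^sub>R y) \<le> r" .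
  qed
qed

lemma tendsto_is_norm_zero:
  fixes n :: "'a::euclidean_space \<Rightarrow> real"
  assumes n: "is_norm n" and "((\<lambda>t. n (x t)) \<longlongrightarrow> 0) F"
  shows "(x \<longlongrightarrow> 0) F"
proof -
  obtain C where C: "C > 0" "\<And>x. norm x \<le> C * n x" using norm_le_is_norm[OF n] by blast
  have "((\<lambda>t. C * n (x t)) \<longlongrightarrow> C * 0) F" by (intro tendsto_intros assms)
  then have "((\<lambda>t. C * n (x t)) \<longlongrightarrow> 0) F" by simp
  then show ?thesis by (rule Lim_null_comparison[OF always_eventually, rotated]) (use C in blast)
qed

text \<open>
  The growth condition compares with \<open>1\<close> in the given norm, so a constant of equivalence with the
  Euclidean norm cannot be afforded here. Jensen's inequality for the norm is obtained by
  separating a point from the closed convex cone \<open>{(v, r). n v \<le> r}\<close>: a linear functional that is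
  nonnegative on the cone is nonnegative on the integral of a function with values in the cone.
\<close>

lemma is_norm_integral_le:
  fixes F :: "real \<Rightarrow> 'a::euclidean_space"
  assumes n: "is_norm n" and F: "F integrable_on S" and m: "m integrable_on S"
    and le: "\<And>y. y \<in> S \<Longrightarrow> n (F y) \<le> m y"
  shows "n (integral S F) \<le> integral S m"
proof (rule ccontr)
  define K where "K = {p :: 'a \<times> real. n (fst p) \<le> snd p}"
  assume "\<not> n (integral S F) \<le> integral S m"
  then have z: "(integral S F, integral S m) \<notin> K" by (simp add: K_def)
  have "convex K"
  proof (rule convexI)
    fix x y :: "'a \<times> real" and u v :: real assume *: "x \<in> K" "y \<in> K" "0 \<le> u" "0 \<le> v" "u + v = 1"
    have "n (u *\<^sub>R fst x + v *\<^sub>R fst y) \<le> u * n (fst x) + v * n (fst y)"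
      using is_normD(4)[OF n, of "u *\<^sub>R fst x" "v *\<^sub>R fst y"] is_normD(3)[OF n] * by simp
    also have "\<dots> \<le> u * snd x + v * snd y" using * by (intro add_mono mult_left_mono) (auto simp: K_def)
    finally show "u *\<^sub>R x + v *\<^sub>R y \<in> K" by (simp add: K_def)
  qed
  moreover have "closed K"
    unfolding K_def by (intro closed_Collect_le continuous_on_compose2[OF is_norm_continuous[OF n, of UNIV]] continuous_intros) auto
  ultimately obtain a b where ab: "a \<bullet> (integral S F, integral S m) < b" "\<And>x. x \<in> K \<Longrightarrow> a \<bullet> x > b"
    using separating_hyperplane_closed_point[OF _ _ z] by blast
  have "b < 0" using ab(2)[of 0] is_normD(5)[OF n] by (simp add: K_def)
  have cone: "0 \<le> a \<bullet> x" if "x \<in> K" for x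
  proof (rule ccontr)
    assume neg: "\<not> 0 \<le> a \<bullet> x"
    define t where "t = b / (a \<bullet> x)"
    have "t > 0" using neg \<open>b < 0\<close> by (simp add: t_def divide_neg_neg)
    then have "t *\<^sub>R x \<in> K" using that is_normD(3)[OF n] by (simp add: K_def mult_left_mono)
    from ab(2)[OF this] show False using neg by (simp add: t_def)
  qed
  have "((\<lambda>y. fst a \<bullet> F y + snd a * m y) has_integral (fst a \<bullet> integral S F + snd a * integral S m)) S"
    using has_integral_linear[OF integrable_integral[OF F] bounded_linear_inner_right[of "fst a"]]
      integrable_integral[OF m] by (intro has_integral_add has_integral_mult_right) (auto simp: o_def)
  moreover have "0 \<le> fst a \<bullet> F y + snd a * m y" if "y \<in> S" for y
    using cone[of "(F y, m y)"] le[OF that] by (simp add: K_def inner_prod_def)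
  ultimately have "0 \<le> fst a \<bullet> integral S F + snd a * integral S m" by (rule has_integral_nonneg)
  then show False using ab(1) \<open>b < 0\<close> by (simp add: inner_prod_def)
qed

section \<open>A Caratheodory equation with retarded argument\<close>

text \<open>
  Approximate \<open>u\<close> by simple functions; for these the composition is a countable gluing of
  measurable functions.
\<close>

lemma caratheodory_measurable:
  fixes H :: "'a \<Rightarrow> 'b::{metric_space, second_countable_topology} \<Rightarrow> 'c::metric_space"
  assumes meas: "\<And>w. (\<lambda>y. H y w) \<in> borel_measurable M"
    and cont: "\<And>y. y \<in> space M \<Longrightarrow> continuous_on UNIV (H y)"
    and u: "u \<in> borel_measurable M"
  shows "(\<lambda>y. H y (u y)) \<in> borel_measurable M"
proof -
  obtain s where s: "\<And>i. simple_function M (s i)" "\<And>x. x \<in> space M \<Longrightarrow> (\<lambda>i. s i x) \<longlonglongrightarrow> u x"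
    using borel_measurable_implies_sequence_metric[OF u, of undefined] by blast
  show ?thesis
  proof (rule borel_measurable_LIMSEQ_metric)
    fix i
    have "finite (s i ` space M)" using s(1) by (simp add: simple_function_def)
    moreover have "s i \<in> measurable M (count_space (s i ` space M))"
      using s(1)[of i] by (subst measurable_count_space_eq2) (auto simp: simple_function_def)
    ultimately show "(\<lambda>x. H x (s i x)) \<in> borel_measurable M"
      using measurable_compose_countable'[where f = "\<lambda>w y. H y w" and g = "s i" and I = "s i ` space M"] meas
      by (simp add: countable_finite)
  next
    fix x assume x: "x \<in> space M"
    show "(\<lambda>i. H x (s i x)) \<longlonglongrightarrow> H x (u x)"
      using continuous_on_tendsto_compose[OF cont[OF x] s(2)[OF x]] by simp
  qed
qed

lemma indefinite_integral_isCont: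
  fixes m :: "real \<Rightarrow> real"
  assumes m: "\<And>\<beta>. m integrable_on {\<alpha>..\<beta>}"
  shows "isCont (\<lambda>y. integral {\<alpha>..y} m) x"
proof -
  define m' where "m' y = (if y \<in> {\<alpha>..} then m y else 0)" for y
  define c where "c = min \<alpha> x - 1"
  have 1: "integral {c..y} m' = integral {\<alpha>..y} m \<and> m' integrable_on {c..y}" for y
  proof -
    have eq: "{c..y} \<inter> {\<alpha>..} = {\<alpha>..y}" by (auto simp: c_def)
    have mx: "max \<alpha> c = \<alpha>" by (simp add: c_def)
    have "m' integrable_on {c..y} \<longleftrightarrow> m integrable_on {\<alpha>..y}"
      unfolding m'_def integrable_restrict_Int by (simp add: mx)
    moreover have "integral {c..y} m' = integral {\<alpha>..y} m"
      unfolding m'_def integral_restrict_Int by (simp add: mx)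
    ultimately show ?thesis using m by simp
  qed
  have "continuous_on {c..x + 1} (\<lambda>y. integral {c..y} m')"
    by (rule indefinite_integral_continuous_1) (use 1 in blast)
  then have "continuous_on {c..x + 1} (\<lambda>y. integral {\<alpha>..y} m)" using 1 by simp
  then show ?thesis by (rule continuous_on_interior) (auto simp: c_def)
qed

text \<open>
  Tonelli's method. With an additional delay \<open>d\<close> the right-hand side at \<open>s\<close> involves the unknown
  only up to \<open>s - d\<close>, so iterating the integral operator \<open>T d\<close> from zero becomes stationary on
  \<open>[\<alpha>, \<alpha> + j * d]\<close> after \<open>j\<close> steps. The increments of all iterates are bounded by those of the
  continuous function \<open>P y = integral {\<alpha>..y} m\<close>. This equicontinuity turns convergence at rational
  points, obtained by a diagonal argument, into convergence everywhere, and it removes the delay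
  in the limit.
\<close>

theorem caratheodory_delay_solution:
  fixes H :: "real \<Rightarrow> 'a::euclidean_space \<Rightarrow> 'a" and G m :: "real \<Rightarrow> real"
  assumes meas: "\<And>w. (\<lambda>y. H y w) \<in> borel_measurable (lebesgue_on {\<alpha>..})"
    and cont: "\<And>y. y \<ge> \<alpha> \<Longrightarrow> continuous_on UNIV (H y)"
    and bound: "\<And>y w. y \<ge> \<alpha> \<Longrightarrow> norm (H y w) \<le> m y"
    and m: "\<And>\<beta>. m integrable_on {\<alpha>..\<beta>}"
    and m_bdd: "\<And>\<beta>. integral {\<alpha>..\<beta>} m \<le> B"
    and G: "\<And>y. y \<ge> \<alpha> \<Longrightarrow> G y \<le> y" "G \<in> borel_measurable (lebesgue_on {\<alpha>..})"
  obtains W where "continuous_on UNIV W"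
    "\<And>y. (\<lambda>s. H s (W (G s))) integrable_on {\<alpha>..y}"
    "\<And>y. W y = integral {\<alpha>..y} (\<lambda>s. H s (W (G s)))"
proof -
  define P where "P y = integral {\<alpha>..y} m" for y
  have Pcont: "isCont P x" for x unfolding P_def by (rule indefinite_integral_isCont[OF m])
  have m0: "0 \<le> m y" if "y \<ge> \<alpha>" for y using bound[OF that, of 0] norm_ge_zero order_trans by blast
  have m': "m integrable_on {u..v}" if "\<alpha> \<le> u" for u v
    by (rule integrable_subinterval_real[OF m]) (use that in auto)
  have P0: "P y = 0" if "y \<le> \<alpha>" for y
    using that by (cases "y = \<alpha>") (auto simp: P_def)
  have Pdiff: "P z - P y = integral {y..z} m" if "\<alpha> \<le> y" "y \<le> z" for y z
    unfolding P_def using Henstock_Kurzweil_Integration.integral_combine[OF that m] by simp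
  have Pmono: "P y \<le> P z" if "y \<le> z" for y z
  proof (cases "\<alpha> \<le> y")
    case True
    have "0 \<le> integral {y..z} m" by (rule integral_nonneg) (use m0 m' True in auto)
    then show ?thesis using Pdiff[OF True that] by simp
  next
    case False
    have "0 \<le> P z" unfolding P_def by (rule integral_nonneg) (use m0 m in auto)
    then show ?thesis using P0[of y] False by simp
  qed
  have PB: "P y \<le> B" for y using m_bdd by (simp add: P_def)
  define adm where "adm V \<longleftrightarrow> (\<forall>y z. norm (V z - V y) \<le> \<bar>P z - P y\<bar>) \<and> (\<forall>y\<le>\<alpha>. V y = 0)" for V :: "real \<Rightarrow> 'a"
  have adm_cont: "continuous_on UNIV V" if "adm V" for V
  proof -
    have "isCont V x" for x
    proof -
      have "((\<lambda>y. \<bar>P y - P x\<bar>) \<longlongrightarrow> \<bar>P x - P x\<bar>) (at x)"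
        using Pcont[of x] by (intro tendsto_intros) (simp add: isCont_def)
      then have 1: "((\<lambda>y. \<bar>P y - P x\<bar>) \<longlongrightarrow> 0) (at x)" by simp
      have "norm (V y - V x) \<le> \<bar>P y - P x\<bar>" for y using that unfolding adm_def by blast
      then have "((\<lambda>y. V y - V x) \<longlongrightarrow> 0) (at x)"
        by (intro Lim_null_comparison[OF always_eventually 1]) blast
      then show ?thesis by (simp add: isCont_def LIM_zero_iff)
    qed
    then show ?thesis by (simp add: continuous_at_imp_continuous_on)
  qed
  have meas_comp: "(\<lambda>s. H s (V (G s - d))) \<in> borel_measurable (lebesgue_on {\<alpha>..y})" if "continuous_on UNIV V"
      for V d y
  proof -
    have V: "V \<in> borel_measurable borel" using that by (rule borel_measurable_continuous_onI)
    have "(\<lambda>s. V (G s - d)) \<in> borel_measurable (lebesgue_on {\<alpha>..})"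
      by (rule measurable_compose[OF _ V]) (use G(2) in measurable)
    then have "(\<lambda>s. H s (V (G s - d))) \<in> borel_measurable (lebesgue_on {\<alpha>..})"
      by (rule caratheodory_measurable[where H = H, OF meas, rotated]) (simp add: cont)
    then show ?thesis by (rule measurable_restrict_mono) auto
  qed
  have intH: "(\<lambda>s. H s (V (G s - d))) integrable_on {\<alpha>..y}" if "continuous_on UNIV V" for V d y
    by (rule measurable_bounded_by_integrable_imp_integrable[OF meas_comp[OF that] m]) (use bound in auto)
  define T where "T d V y = integral {\<alpha>..y} (\<lambda>s. H s (V (G s - d)))" for d V y
  have adm_T: "adm (T d V)" if "adm V" for d V
  proof -
    note c = adm_cont[OF that]
    have i: "(\<lambda>s. H s (V (G s - d))) integrable_on {u..v}" if "\<alpha> \<le> u" for u v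
      by (rule integrable_subinterval_real[OF intH[OF c]]) (use that in auto)
    have T0: "T d V y = 0" if "y \<le> \<alpha>" for y
      using that by (cases "y = \<alpha>") (auto simp: T_def)
    have main: "norm (T d V z - T d V y) \<le> P z - P y" if "\<alpha> \<le> y" "y \<le> z" for y z
    proof -
      have "T d V z - T d V y = integral {y..z} (\<lambda>s. H s (V (G s - d)))"
        unfolding T_def using Henstock_Kurzweil_Integration.integral_combine[OF that intH[OF c], of d]
            by (simp add: algebra_simps)
      also have "norm \<dots> \<le> integral {y..z} m"
        by (rule Henstock_Kurzweil_Integration.integral_norm_bound_integral) (use i m' bound that in auto)
      finally show ?thesis using Pdiff that by simp
    qed
    have main': "norm (T d V z - T d V y) \<le> P z - P y" if "y \<le> z" for y z
    proof (cases "\<alpha> \<le> y")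
      case True
      then show ?thesis using main that by simp
    next
      case False
      show ?thesis
      proof (cases "\<alpha> \<le> z")
        case True
        then show ?thesis using main[of \<alpha> z] T0[of y] T0[of \<alpha>] P0[of y] P0[of \<alpha>] False by simp
      qed (use False T0 P0 in simp)
    qed
    show ?thesis unfolding adm_def
    proof (intro conjI allI impI)
      show "norm (T d V z - T d V y) \<le> \<bar>P z - P y\<bar>" for y z
      proof (cases "y \<le> z")
        case True
        then show ?thesis using main'[OF True] by linarith
      next
        case False
        then have "z \<le> y" by simp
        from main'[OF this] show ?thesis by (subst norm_minus_commute) linarith
      qed
    qed (rule T0)
  qed
  have adm0: "adm (\<lambda>_. 0)" by (simp add: adm_def)
  have adm_it: "adm ((T d ^^ j) (\<lambda>_. 0))" for d j
    by (induction j) (use adm0 adm_T in auto)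
  have stable: "(T d ^^ Suc j) (\<lambda>_. 0) y = (T d ^^ j) (\<lambda>_. 0) y" if "d > 0" "y \<le> \<alpha> + real j * d" for d j y
    using that(2)
  proof (induction j arbitrary: y)
    case 0
    have "adm (T d (\<lambda>_. 0))" using adm_T adm0 by simp
    then show ?case using 0 by (simp add: adm_def)
  next
    case (Suc j)
    have "(T d ^^ Suc (Suc j)) (\<lambda>_. 0) y = T d ((T d ^^ Suc j) (\<lambda>_. 0)) y" by simp
    also have "\<dots> = T d ((T d ^^ j) (\<lambda>_. 0)) y"
      unfolding T_def[of d _ y]
    proof (rule Henstock_Kurzweil_Integration.integral_cong)
      fix s assume "s \<in> {\<alpha>..y}"
      then have "G s - d \<le> \<alpha> + real j * d" using G(1)[of s] Suc.prems by (simp add: algebra_simps)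
      then show "H s ((T d ^^ Suc j) (\<lambda>_. 0) (G s - d)) = H s ((T d ^^ j) (\<lambda>_. 0) (G s - d))"
        using Suc.IH by simp
    qed
    finally show ?case by simp
  qed
  define dl where "dl k = 1 / real (Suc k)" for k
  \<comment> \<open>With delay \<open>1 / Suc k\<close> these many steps solve the delayed equation on an interval of length
    \<open>Suc k\<close>, so every point is eventually covered.\<close>
  define V where "V k = (T (dl k) ^^ (Suc k * Suc k)) (\<lambda>_. 0)" for k
  have dl: "dl k > 0" for k by (simp add: dl_def)
  have dl0: "dl \<longlonglongrightarrow> 0" unfolding dl_def using LIMSEQ_inverse_real_of_nat by (simp add: inverse_eq_divide)
  have V_adm: "adm (V k)" for k unfolding V_def by (rule adm_it)
  have V_eq: "V k y = T (dl k) (V k) y" if "y \<le> \<alpha> + real (Suc k)" for k y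
  proof -
    have "real (Suc k * Suc k) * dl k = real (Suc k)" by (simp add: dl_def field_simps)
    then show ?thesis using stable[OF dl, of y "Suc k * Suc k" k] that unfolding V_def by simp
  qed
  have V_bd: "norm (V k x) \<le> B" for k x
  proof -
    have "norm (V k x - V k \<alpha>) \<le> \<bar>P x - P \<alpha>\<bar>" using V_adm[of k] unfolding adm_def by blast
    moreover have "V k \<alpha> = 0" using V_adm[of k] by (simp add: adm_def)
    moreover have "\<bar>P x\<bar> \<le> B" using PB[of x] Pmono[of "min x \<alpha>" x] P0[of "min x \<alpha>"] by simp
    ultimately show ?thesis using P0[of \<alpha>] by simp
  qed
  obtain r where r: "strict_mono (r :: nat \<Rightarrow> nat)" "\<And>x. x \<in> \<rat> \<Longrightarrow> \<exists>l. (\<lambda>n. V (r n) x) \<longlonglongrightarrow> l"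
    using function_convergent_subsequence[OF countable_rat, of V B] V_bd by blast
  have conv: "convergent (\<lambda>n. V (r n) y)" for y
  proof -
    have "Cauchy (\<lambda>n. V (r n) y)"
    proof (rule metric_CauchyI)
      fix e :: real assume "e > 0"
      then have "e / 3 > 0" by simp
      then obtain \<delta> where \<delta>: "\<delta> > 0" "\<And>x. \<bar>x - y\<bar> < \<delta> \<Longrightarrow> \<bar>P x - P y\<bar> < e / 3"
        using Pcont[of y] unfolding continuous_at_real_range real_norm_def by blast
      obtain q where q: "q \<in> \<rat>" "y < q" "q < y + \<delta>" using Rats_dense_in_real[of y "y + \<delta>"] \<delta> by auto
      have Pq: "\<bar>P q - P y\<bar> < e / 3" using \<delta> q by auto
      have "Cauchy (\<lambda>n. V (r n) q)" using r(2)[OF q(1)] convergent_Cauchy convergent_def by blast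
      then obtain N where N: "\<And>i j. i \<ge> N \<Longrightarrow> j \<ge> N \<Longrightarrow> dist (V (r i) q) (V (r j) q) < e / 3"
        using \<open>e / 3 > 0\<close> unfolding Cauchy_def by blast
      have close: "dist (V k q) (V k y) < e / 3" for k
      proof -
        have "norm (V k q - V k y) \<le> \<bar>P q - P y\<bar>" using V_adm[of k] unfolding adm_def by blast
        then show ?thesis using Pq by (simp add: dist_norm)
      qed
      show "\<exists>M. \<forall>m\<ge>M. \<forall>n\<ge>M. dist (V (r m) y) (V (r n) y) < e"
      proof (intro exI[of _ N] allI impI)
        fix i j assume "N \<le> i" "N \<le> j"
        then have "dist (V (r i) q) (V (r j) q) < e / 3" by (rule N)
        moreover have "dist (V (r i) y) (V (r j) y) \<le> dist (V (r i) y) (V (r i) q)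
            + dist (V (r i) q) (V (r j) q) + dist (V (r j) q) (V (r j) y)"
          using dist_triangle[of "V (r i) y" "V (r j) y" "V (r i) q"] dist_triangle[of "V (r i) q" "V (r j) y"
              "V (r j) q"] by linarith
        ultimately show "dist (V (r i) y) (V (r j) y) < e"
          using close[of "r i"] close[of "r j"] dist_commute[of "V (r i) y" "V (r i) q"] by linarith
      qed
    qed
    then show ?thesis by (rule Cauchy_convergent)
  qed
  define W where "W y = lim (\<lambda>n. V (r n) y)" for y
  have lim: "(\<lambda>n. V (r n) y) \<longlonglongrightarrow> W y" for y
    using conv[of y] unfolding W_def by (simp add: convergent_LIMSEQ_iff)
  have W_adm: "adm W"
    unfolding adm_def
  proof (intro conjI allI impI)
    fix y z
    have "(\<lambda>n. norm (V (r n) z - V (r n) y)) \<longlonglongrightarrow> norm (W z - W y)" by (intro tendsto_intros lim)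
    then show "norm (W z - W y) \<le> \<bar>P z - P y\<bar>"
      by (rule LIMSEQ_le_const2) (use V_adm in \<open>auto simp: adm_def\<close>)
  next
    fix y assume "y \<le> \<alpha>"
    then have "V (r n) y = 0" for n using V_adm[of "r n"] by (simp add: adm_def)
    then show "W y = 0" by (simp add: W_def)
  qed
  have lim_shift: "(\<lambda>n. V (r n) (x - dl (r n))) \<longlonglongrightarrow> W x" for x
  proof -
    have "(\<lambda>n. dl (r n)) \<longlonglongrightarrow> 0" using LIMSEQ_subseq_LIMSEQ[OF dl0 r(1)] by (simp add: o_def)
    then have "(\<lambda>n. x - dl (r n)) \<longlonglongrightarrow> x - 0" by (intro tendsto_intros)
    then have "(\<lambda>n. x - dl (r n)) \<longlonglongrightarrow> x" by simp
    then have "(\<lambda>n. \<bar>P (x - dl (r n)) - P x\<bar>) \<longlonglongrightarrow> \<bar>P x - P x\<bar>"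
      by (intro tendsto_intros isCont_tendsto_compose[OF Pcont])
    then have 1: "(\<lambda>n. \<bar>P (x - dl (r n)) - P x\<bar>) \<longlonglongrightarrow> 0" by simp
    have "norm (V (r n) (x - dl (r n)) - V (r n) x) \<le> \<bar>P (x - dl (r n)) - P x\<bar>" for n
      using V_adm[of "r n"] unfolding adm_def by blast
    then have "(\<lambda>n. V (r n) (x - dl (r n)) - V (r n) x) \<longlonglongrightarrow> 0"
      by (intro Lim_null_comparison[OF always_eventually 1]) blast
    from tendsto_add[OF this lim[of x]] show ?thesis by simp
  qed
  show ?thesis
  proof (rule that[of W])
    show "continuous_on UNIV W" by (rule adm_cont[OF W_adm])
    fix y
    show "(\<lambda>s. H s (W (G s))) integrable_on {\<alpha>..y}" using intH[OF adm_cont[OF W_adm], of 0] by simp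
    have "(\<lambda>n. integral {\<alpha>..y} (\<lambda>s. H s (V (r n) (G s - dl (r n))))) \<longlonglongrightarrow> integral {\<alpha>..y} (\<lambda>s. H s (W (G s)))"
    proof (rule dominated_convergence(2)[where h = m])
      fix k show "(\<lambda>s. H s (V (r k) (G s - dl (r k)))) integrable_on {\<alpha>..y}"
        by (rule intH[OF adm_cont[OF V_adm]])
    next
      fix s assume "s \<in> {\<alpha>..y}"
      then have "s \<ge> \<alpha>" by simp
      from continuous_on_tendsto_compose[OF cont[OF this] lim_shift]
      show "(\<lambda>k. H s (V (r k) (G s - dl (r k)))) \<longlonglongrightarrow> H s (W (G s))" by simp
    qed (use m bound in auto)
    moreover have "\<forall>\<^sub>F n in sequentially. integral {\<alpha>..y} (\<lambda>s. H s (V (r n) (G s - dl (r n)))) = V (r n) y"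
    proof -
      obtain N :: nat where N: "y - \<alpha> \<le> real N" using real_arch_simple by blast
      show ?thesis
      proof (rule eventually_sequentiallyI[of N])
        fix n assume "N \<le> n"
        then have "N \<le> r n" using seq_suble[OF r(1), of n] by simp
        then have "y \<le> \<alpha> + real (Suc (r n))" using N by simp
        from V_eq[OF this] show "integral {\<alpha>..y} (\<lambda>s. H s (V (r n) (G s - dl (r n)))) = V (r n) y"
          by (simp add: T_def)
      qed
    qed
    ultimately have "(\<lambda>n. V (r n) y) \<longlonglongrightarrow> integral {\<alpha>..y} (\<lambda>s. H s (W (G s)))"
      by (rule Lim_transform_eventually)
    then show "W y = integral {\<alpha>..y} (\<lambda>s. H s (W (G s)))" using lim LIMSEQ_unique by blast
  qed
qed

section \<open>Majorants at almost every level\<close>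

context stieltjes_integrator
begin

text \<open>
  Compare the averages of both sides over \<open>[g (ginv y), g d]\<close> and let \<open>d\<close> decrease to \<open>ginv y\<close>.
  Only intervals with end points in the range of \<open>g\<close> enter, as the hypothesis says nothing about
  others.
\<close>

lemma ae_is_norm_le:
  fixes F :: "real \<Rightarrow> 'a::euclidean_space" and m :: "real \<Rightarrow> real"
  assumes n: "is_norm n"
    and F: "\<And>t. t \<ge> 0 \<Longrightarrow> (\<lambda>y. F (ginv y)) integrable_on {g 0..g t}"
    and m: "\<And>t. t \<ge> 0 \<Longrightarrow> (\<lambda>y. m (ginv y)) integrable_on {g 0..g t}"
    and le: "\<And>c d. 0 \<le> c \<Longrightarrow> c \<le> d \<Longrightarrow>
      n (integral {g c..g d} (\<lambda>y. F (ginv y))) \<le> integral {g c..g d} (\<lambda>y. m (ginv y))"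
  obtains Z where "negligible Z" "\<And>y. y \<in> levels - Z \<Longrightarrow> n (F (ginv y)) \<le> m (ginv y)"
proof -
  obtain Z1 where Z1: "negligible Z1" "\<And>y. y \<in> levels - Z1 \<Longrightarrow>
       ((\<lambda>d. integral {g (ginv y)..g d} (\<lambda>s. F (ginv s)) /\<^sub>R (g d - g (ginv y))) \<longlongrightarrow> F (ginv y)) (at_right (ginv y))"
    using integral_averages_tendsto[OF F] by blast
  obtain Z2 where Z2: "negligible Z2" "\<And>y. y \<in> levels - Z2 \<Longrightarrow>
       ((\<lambda>d. integral {g (ginv y)..g d} (\<lambda>s. m (ginv s)) /\<^sub>R (g d - g (ginv y))) \<longlongrightarrow> m (ginv y)) (at_right (ginv y))"
    using integral_averages_tendsto[OF m] by blast
  show ?thesis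
  proof (rule that[of "Z1 \<union> Z2"])
    show "negligible (Z1 \<union> Z2)" using Z1 Z2 by (simp add: negligible_Un)
    fix y assume y: "y \<in> levels - (Z1 \<union> Z2)"
    define \<tau> where "\<tau> = ginv y"
    have "0 \<le> \<tau>" using ginv_nonneg y by (auto simp: \<tau>_def)
    have "((\<lambda>d. n (integral {g \<tau>..g d} (\<lambda>s. F (ginv s)) /\<^sub>R (g d - g \<tau>))) \<longlongrightarrow> n (F \<tau>)) (at_right \<tau>)"
      using continuous_on_tendsto_compose[OF is_norm_continuous[OF n, of UNIV] Z1(2)[of y]] y by (simp add: \<tau>_def)
    moreover have "((\<lambda>d. integral {g \<tau>..g d} (\<lambda>s. m (ginv s)) /\<^sub>R (g d - g \<tau>)) \<longlongrightarrow> m \<tau>) (at_right \<tau>)"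
      using Z2(2)[of y] y by (simp add: \<tau>_def)
    moreover have "\<forall>\<^sub>F d in at_right \<tau>. n (integral {g \<tau>..g d} (\<lambda>s. F (ginv s)) /\<^sub>R (g d - g \<tau>))
        \<le> integral {g \<tau>..g d} (\<lambda>s. m (ginv s)) /\<^sub>R (g d - g \<tau>)"
    proof -
      have "\<forall>\<^sub>F d in at_right \<tau>. \<tau> < d" by (rule eventually_at_right_less)
      then show ?thesis
      proof eventually_elim
        case (elim d)
        have "0 \<le> inverse (g d - g \<tau>)" using g_le[of \<tau> d] elim \<open>0 \<le> \<tau>\<close> by simp
        then show ?case using le[of \<tau> d] elim \<open>0 \<le> \<tau>\<close> is_normD(3)[OF n] by (simp add: mult_left_mono)
      qed
    qed
    ultimately have "n (F \<tau>) \<le> m \<tau>" by (intro tendsto_le[OF trivial_limit_at_right_real])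
    then show "n (F (ginv y)) \<le> m (ginv y)" by (simp add: \<tau>_def)
  qed
qed

lemma levels_eq: "levels = (\<Union>k. {g 0..<g (real k)})"
proof (intro equalityI subsetI)
  fix y assume "y \<in> levels"
  then obtain t where t: "0 \<le> t" "y < g t" "g 0 \<le> y" by (auto simp: levels_def)
  obtain k where "t \<le> real k" using real_arch_simple by blast
  then have "y < g (real k)" using g_le[of t "real k"] t by simp
  then show "y \<in> (\<Union>k. {g 0..<g (real k)})" using t by auto
next
  fix y assume "y \<in> (\<Union>k. {g 0..<g (real k)})"
  then obtain k where "g 0 \<le> y" "y < g (real k)" by auto
  then show "y \<in> levels" using levelsI[of 0 "real k"] by simp
qed

lemma levels_borel: "levels \<in> sets borel"
  unfolding levels_eq by auto

lemma has_integral_levels: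
  fixes q :: "real \<Rightarrow> 'a::euclidean_space"
  assumes int: "\<And>t. t \<ge> 0 \<Longrightarrow> (\<lambda>y. q (ginv y)) integrable_on {g 0..g t}" and "0 \<le> c" "c \<le> d"
  shows "((\<lambda>y. if y \<in> levels then q (ginv y) else 0) has_integral
    integral {g c..g d} (\<lambda>y. q (ginv y))) {g c..g d}"
proof (rule has_integral_spike[of "{g d}"])
  have "(\<lambda>y. q (ginv y)) integrable_on {g 0..g d}" using int assms by simp
  then have "(\<lambda>y. q (ginv y)) integrable_on {g c..g d}"
    by (rule integrable_subinterval_real) (use g_le[of 0 c] assms in auto)
  then show "((\<lambda>y. q (ginv y)) has_integral integral {g c..g d} (\<lambda>y. q (ginv y))) {g c..g d}"
    by (rule integrable_integral)
  show "(if y \<in> levels then q (ginv y) else 0) = q (ginv y)" if "y \<in> {g c..g d} - {g d}" for y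
    using levelsI[of c d y] that assms by auto
qed auto

lemma integral_levels:
  fixes q :: "real \<Rightarrow> real"
  assumes nonneg: "\<And>t. t \<ge> 0 \<Longrightarrow> 0 \<le> q t"
    and int: "\<And>t. t \<ge> 0 \<Longrightarrow> (\<lambda>y. q (ginv y)) integrable_on {g 0..g t}"
    and bd: "\<And>t. t \<ge> 0 \<Longrightarrow> integral {g 0..g t} (\<lambda>y. q (ginv y)) \<le> B"
  defines "m \<equiv> \<lambda>y. if y \<in> levels then q (ginv y) else 0"
  shows "m integrable_on {a..b}" "integral {a..b} m \<le> B"
proof -
  have m0: "0 \<le> m y" for y using nonneg ginv_nonneg by (auto simp: m_def)
  have on: "(m has_integral integral {g c..g d} (\<lambda>y. q (ginv y))) {g c..g d}" if "0 \<le> c" "c \<le> d" for c d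
    unfolding m_def by (rule has_integral_levels[OF int that])
  define mk where "mk k y = (if y \<in> {g 0..g (real k)} then m y else 0)" for k y
  have mk: "(mk k has_integral integral {g 0..g (real k)} (\<lambda>y. q (ginv y))) UNIV" for k
    unfolding mk_def using on[of 0 "real k"] by (subst has_integral_restrict_UNIV) simp
  have conv: "m integrable_on UNIV \<and> (\<lambda>k. integral UNIV (mk k)) \<longlonglongrightarrow> integral UNIV m"
  proof (rule monotone_convergence_increasing)
    show "mk k integrable_on UNIV" for k using mk by blast
    show "mk k y \<le> mk (Suc k) y" for k y
      using g_le[of "real k" "real (Suc k)"] m0[of y] by (auto simp: mk_def)
    show "(\<lambda>k. mk k y) \<longlonglongrightarrow> m y" for y
    proof (cases "y \<in> levels")
      case True
      then obtain N where N: "g 0 \<le> y" "y < g (real N)" by (auto simp: levels_eq)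
      have "mk k y = m y" if "N \<le> k" for k
        using N g_le[of "real N" "real k"] that by (auto simp: mk_def)
      then show ?thesis by (intro tendsto_eventually eventually_sequentiallyI)
    next
      case False
      then have "mk k y = m y" for k by (simp add: mk_def m_def)
      then show ?thesis by simp
    qed
    have "\<bar>integral UNIV (mk k)\<bar> \<le> B" for k
    proof -
      have "0 \<le> integral UNIV (mk k)"
        by (rule integral_nonneg) (use mk m0 in \<open>auto simp: mk_def\<close>)
      then show ?thesis using bd[of "real k"] mk[of k] by (simp add: integral_unique)
    qed
    then show "bounded (range (\<lambda>k. integral UNIV (mk k)))"
      by (intro boundedI[of _ B]) auto
  qed
  then show i: "m integrable_on {a..b}" using integrable_on_subinterval[of m UNIV a b] by simp
  have "integral UNIV (mk k) \<le> B" for k using bd[of "real k"] mk[of k] by (simp add: integral_unique)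
  then have "integral UNIV m \<le> B" by (intro LIMSEQ_le_const2[OF conjunct2[OF conv]]) blast
  moreover have "integral {a..b} m \<le> integral UNIV m"
    by (rule integral_subset_le) (use i conv m0 in auto)
  ultimately show "integral {a..b} m \<le> B" by simp
qed

end

section \<open>Nonlinear contractions\<close>

locale contractive_family =
  fixes n :: "'a::euclidean_space \<Rightarrow> real" and h :: "real \<Rightarrow> 'a \<Rightarrow> 'a" and \<phi> :: "real \<Rightarrow> real" and r :: real
  assumes norm: "is_norm n"
    and \<phi>_cont: "continuous_on {0..} \<phi>"
    and \<phi>_less: "\<And>s. s > 0 \<Longrightarrow> \<phi> s < s" and \<phi>_0: "\<phi> 0 = 0"
    and contr: "\<And>t u v. t \<ge> 0 \<Longrightarrow> n u \<le> r \<Longrightarrow> n v \<le> r \<Longrightarrow> n (h t u - h t v) \<le> \<phi> (n (u - v))"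
begin

lemma \<phi>_le: "s \<ge> 0 \<Longrightarrow> \<phi> s \<le> s"
  using \<phi>_less[of s] \<phi>_0 by (cases "s = 0") auto

lemma lipschitz: "t \<ge> 0 \<Longrightarrow> n u \<le> r \<Longrightarrow> n v \<le> r \<Longrightarrow> n (h t u - h t v) \<le> n (u - v)"
  using contr[of t u v] \<phi>_le[of "n (u - v)"] is_normD(1)[OF norm] by (meson order_trans)

text \<open>
  If the residuals \<open>u - h t u\<close> and \<open>v - h t v\<close> differ by less than \<open>\<eta>\<close>, then \<open>s = n (u - v)\<close>
  satisfies \<open>s - \<phi> s < \<eta>\<close>. By compactness \<open>s - \<phi> s\<close> has a positive minimum on \<open>[\<epsilon>, 2 r]\<close>, and this
  minimum does not depend on \<open>t\<close>.
\<close>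

lemma modulus:
  assumes "\<epsilon> > 0"
  obtains \<eta> where "\<eta> > 0" "\<And>t u v. t \<ge> 0 \<Longrightarrow> n u \<le> r \<Longrightarrow> n v \<le> r \<Longrightarrow>
    n ((u - h t u) - (v - h t v)) < \<eta> \<Longrightarrow> n (u - v) < \<epsilon>"
proof -
  have "\<exists>\<eta>>0. \<forall>s. \<epsilon> \<le> s \<longrightarrow> s \<le> 2 * r \<longrightarrow> \<eta> \<le> s - \<phi> s"
  proof (cases "\<epsilon> \<le> 2 * r")
    case True
    have "continuous_on {\<epsilon>..2 * r} (\<lambda>s. s - \<phi> s)"
      by (intro continuous_intros continuous_on_subset[OF \<phi>_cont]) (use assms in auto)
    then obtain s0 where s0: "s0 \<in> {\<epsilon>..2 * r}" "\<And>s. s \<in> {\<epsilon>..2 * r} \<Longrightarrow> s0 - \<phi> s0 \<le> s - \<phi> s"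
      using continuous_attains_inf[of "{\<epsilon>..2 * r}" "\<lambda>s. s - \<phi> s"] True by fastforce
    then show ?thesis using \<phi>_less[of s0] assms by (intro exI[of _ "s0 - \<phi> s0"]) auto
  qed (auto intro: exI[of _ 1])
  then obtain \<eta> where \<eta>: "\<eta> > 0" "\<And>s. \<epsilon> \<le> s \<Longrightarrow> s \<le> 2 * r \<Longrightarrow> \<eta> \<le> s - \<phi> s" by blast
  show ?thesis
  proof (rule that[OF \<eta>(1)])
    fix t u v assume *: "t \<ge> 0" "n u \<le> r" "n v \<le> r" "n ((u - h t u) - (v - h t v)) < \<eta>"
    have "u - v = ((u - h t u) - (v - h t v)) + (h t u - h t v)" by simp
    then have "n (u - v) \<le> n ((u - h t u) - (v - h t v)) + n (h t u - h t v)"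
      using is_normD(4)[OF norm] by metis
    then have "n (u - v) - \<phi> (n (u - v)) < \<eta>" using * contr[OF *(1-3)] by linarith
    moreover have "n (u - v) \<le> 2 * r" using is_normD(7)[OF norm, of u v] * by simp
    ultimately show "n (u - v) < \<epsilon>" using \<eta>(2)[of "n (u - v)"] by linarith
  qed
qed

text \<open>
  The modulus as a statement about limits. The time \<open>t'\<close> is allowed to depend on the filter
  variable, which covers dependence on the state at a fixed time, one-sided limits in time, and
  asymptotics in time.
\<close>

lemma tendsto_of_residual:
  assumes "\<forall>\<^sub>F t in F. t' t \<ge> 0 \<and> n (u t) \<le> r \<and> n (v t) \<le> r"
    and res: "((\<lambda>t. (u t - h (t' t) (u t)) - (v t - h (t' t) (v t))) \<longlongrightarrow> 0) F"
  shows "((\<lambda>t. u t - v t) \<longlongrightarrow> 0) F"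
proof (rule tendsto_is_norm_zero[OF norm], rule tendstoI)
  fix \<epsilon> :: real assume "\<epsilon> > 0"
  then obtain \<eta> where \<eta>: "\<eta> > 0" "\<And>t u v. t \<ge> 0 \<Longrightarrow> n u \<le> r \<Longrightarrow> n v \<le> r \<Longrightarrow>
    n ((u - h t u) - (v - h t v)) < \<eta> \<Longrightarrow> n (u - v) < \<epsilon>" using modulus by blast
  have "((\<lambda>t. n ((u t - h (t' t) (u t)) - (v t - h (t' t) (v t)))) \<longlongrightarrow> n 0) F"
    using continuous_on_tendsto_compose[OF is_norm_continuous[OF norm, of UNIV] res] by simp
  then have "\<forall>\<^sub>F t in F. n ((u t - h (t' t) (u t)) - (v t - h (t' t) (v t))) < \<eta>"
    using \<eta>(1) is_normD(5)[OF norm] by (intro order_tendstoD(2)[of _ "n 0"]) auto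
  with assms(1) show "\<forall>\<^sub>F t in F. dist (n (u t - v t)) 0 < \<epsilon>"
    by eventually_elim (use \<eta>(2) is_normD(1)[OF norm] in auto)
qed

lemma residual_inj:
  assumes "t \<ge> 0" "n u \<le> r" "n v \<le> r" "u - h t u = v - h t v"
  shows "u = v"
proof (rule ccontr)
  assume "u \<noteq> v"
  then have "n (u - v) > 0" using is_normD(1,2)[OF norm, of "u - v"] by (simp add: order_less_le)
  moreover have "u - v = h t u - h t v" using assms(4) by (simp add: algebra_simps)
  ultimately show False using contr[OF assms(1-3)] \<phi>_less by fastforce
qed

lemma fixed_point:
  assumes r: "r \<ge> 0" and lip: "\<And>u v. n u \<le> r \<Longrightarrow> n v \<le> r \<Longrightarrow> n (k u - k v) \<le> n (u - v)"
    and self: "\<And>u. n u \<le> r \<Longrightarrow> n (k u) \<le> r"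
  obtains u where "n u \<le> r" "k u = u"
proof -
  have "continuous_on {u. n u \<le> r} k"
    unfolding continuous_on_def
  proof
    fix u assume u: "u \<in> {u. n u \<le> r}"
    have ev: "\<forall>\<^sub>F v in at u within {u. n u \<le> r}. n v \<le> r"
      by (simp add: eventually_at_filter)
    have "((\<lambda>v. n (v - u)) \<longlongrightarrow> n (u - u)) (at u within {u. n u \<le> r})"
      by (intro continuous_on_tendsto_compose[OF is_norm_continuous[OF norm, of UNIV]] tendsto_intros) auto
    then have 0: "((\<lambda>v. n (v - u)) \<longlongrightarrow> 0) (at u within {u. n u \<le> r})" using is_normD(5)[OF norm] by simp
    have "((\<lambda>v. n (k v - k u)) \<longlongrightarrow> 0) (at u within {u. n u \<le> r})"
      by (rule Lim_null_comparison[OF _ 0]) (use ev in eventually_elim, use lip u is_normD(1)[OF norm] in auto)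
    from tendsto_is_norm_zero[OF norm this]
    show "(k \<longlongrightarrow> k u) (at u within {u. n u \<le> r})" by (simp add: LIM_zero_iff)
  qed
  moreover have "{u. n u \<le> r} \<noteq> {}" using is_normD(5)[OF norm] r by (auto intro!: exI[of _ 0])
  ultimately obtain u where "u \<in> {u. n u \<le> r}" "k u = u"
    using brouwer[OF is_norm_ball[OF norm]] self by blast
  then show ?thesis using that by auto
qed

definition resolvent :: "real \<Rightarrow> 'a \<Rightarrow> 'a" where
  "resolvent t w = (SOME u. n u \<le> r \<and> u - h t u = w)"

lemma resolvent:
  assumes "r \<ge> 0" "t \<ge> 0" "\<And>u. n u \<le> r \<Longrightarrow> n (w + h t u) \<le> r"
  shows "n (resolvent t w) \<le> r" "resolvent t w - h t (resolvent t w) = w"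
proof -
  obtain u where "n u \<le> r" "w + h t u = u"
    using fixed_point[OF assms(1), of "\<lambda>u. w + h t u"] lipschitz[OF assms(2)] assms(3) by auto
  then have "\<exists>u. n u \<le> r \<and> u - h t u = w" by (metis add_diff_cancel_right')
  from someI_ex[OF this] show "n (resolvent t w) \<le> r" "resolvent t w - h t (resolvent t w) = w"
    unfolding resolvent_def by auto
qed

lemma resolvent_continuous:
  assumes "r \<ge> 0" "t \<ge> 0" "\<And>w u. w \<in> K \<Longrightarrow> n u \<le> r \<Longrightarrow> n (w + h t u) \<le> r"
  shows "continuous_on K (resolvent t)"
  unfolding continuous_on_def
proof
  fix w assume w: "w \<in> K"
  note R = resolvent[OF assms(1,2) assms(3)]
  have ev: "\<forall>\<^sub>F v in at w within K. v \<in> K" by (simp add: eventually_at_filter)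
  have "((\<lambda>v. resolvent t v - resolvent t w) \<longlongrightarrow> 0) (at w within K)"
  proof (rule tendsto_of_residual[where t' = "\<lambda>_. t"])
    show "\<forall>\<^sub>F v in at w within K. t \<ge> 0 \<and> n (resolvent t v) \<le> r \<and> n (resolvent t w) \<le> r"
      using ev by eventually_elim (use R w assms(2) in auto)
    have "((\<lambda>v. v - w) \<longlongrightarrow> w - w) (at w within K)" by (intro tendsto_intros)
    then have "((\<lambda>v. v - w) \<longlongrightarrow> 0) (at w within K)" by simp
    then show "((\<lambda>v. (resolvent t v - h t (resolvent t v)) - (resolvent t w - h t (resolvent t w))) \<longlongrightarrow> 0) (at w within K)"
      by (rule Lim_transform_eventually) (use ev in eventually_elim, use R(2) w in auto)
  qed
  then show "(resolvent t \<longlongrightarrow> resolvent t w) (at w within K)" by (simp add: LIM_zero_iff)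
qed

text \<open>
  The limit is the fixed point of the limiting equation \<open>u = w0 + l u\<close>, which exists by Brouwer's
  theorem because \<open>l\<close> inherits the Lipschitz bound and the self-mapping property. Only the
  convergence of \<open>h t\<close> at this one state is then used.
\<close>

lemma resolvent_limit:
  assumes r: "r \<ge> 0" and F: "F \<noteq> bot" and t: "\<forall>\<^sub>F t in F. t \<ge> 0"
    and self: "\<And>t u. t \<ge> 0 \<Longrightarrow> n u \<le> r \<Longrightarrow> n (w t + h t u) \<le> r"
    and w: "(w \<longlongrightarrow> w0) F" and l: "\<And>u. ((\<lambda>t. h t u) \<longlongrightarrow> l u) F"
  obtains x0 where "((\<lambda>t. resolvent t (w t)) \<longlongrightarrow> x0) F"
proof -
  note nc = continuous_on_tendsto_compose[OF is_norm_continuous[OF norm, of UNIV]]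
  obtain x0 where x0: "n x0 \<le> r" "w0 + l x0 = x0"
  proof (rule fixed_point[OF r, of "\<lambda>u. w0 + l u"])
    fix u v assume uv: "n u \<le> r" "n v \<le> r"
    have "((\<lambda>t. n (h t u - h t v)) \<longlongrightarrow> n (l u - l v)) F" by (intro nc tendsto_intros l) auto
    moreover have "\<forall>\<^sub>F t in F. n (h t u - h t v) \<le> n (u - v)"
      using t by eventually_elim (use lipschitz uv in auto)
    ultimately show "n ((w0 + l u) - (w0 + l v)) \<le> n (u - v)"
      using tendsto_upperbound[OF _ _ F] by simp
  next
    fix u assume u: "n u \<le> r"
    have "((\<lambda>t. n (w t + h t u)) \<longlongrightarrow> n (w0 + l u)) F" by (intro nc tendsto_intros l w) auto
    moreover have "\<forall>\<^sub>F t in F. n (w t + h t u) \<le> r" using t by eventually_elim (use self u in auto)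
    ultimately show "n (w0 + l u) \<le> r" using tendsto_upperbound[OF _ _ F] by blast
  qed (use that in blast)
  have R: "n (resolvent t (w t)) \<le> r" "resolvent t (w t) - h t (resolvent t (w t)) = w t" if "t \<ge> 0" for t
    using resolvent[OF r that self[OF that]] by auto
  have "((\<lambda>t. resolvent t (w t) - x0) \<longlongrightarrow> 0) F"
  proof (rule tendsto_of_residual[where t' = "\<lambda>t. t"])
    show "\<forall>\<^sub>F t in F. t \<ge> 0 \<and> n (resolvent t (w t)) \<le> r \<and> n x0 \<le> r"
      using t by eventually_elim (use R x0 in auto)
    have "((\<lambda>t. w t - (x0 - h t x0)) \<longlongrightarrow> w0 - (x0 - l x0)) F" by (intro tendsto_intros w l)
    moreover have "w0 - (x0 - l x0) = 0" using x0(2) by (simp add: algebra_simps)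
    ultimately have "((\<lambda>t. w t - (x0 - h t x0)) \<longlongrightarrow> 0) F" by simp
    then show "((\<lambda>t. (resolvent t (w t) - h t (resolvent t (w t))) - (x0 - h t x0)) \<longlongrightarrow> 0) F"
      by (rule Lim_transform_eventually) (use t in eventually_elim, use R(2) in auto)
  qed
  then show ?thesis using that by (simp add: LIM_zero_iff)
qed

end

section \<open>Measurability of regulated functions\<close>

text \<open>
  The function \<open>xr\<close> of right limits is a limit of step functions that sample \<open>x\<close> at the next point
  of a grid. It differs from \<open>x\<close> at countably many points only: if \<open>x\<close> has a right limit at \<open>t\<close>,
  then just to the right of \<open>t\<close> the distance of \<open>x\<close> and \<open>xr\<close> is small, so the points of \<open>D k\<close> are
  isolated from the right.
\<close>

lemma right_limits_borel_measurable:
  fixes x :: "real \<Rightarrow> 'a::metric_space"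
  assumes "\<And>t. t \<ge> 0 \<Longrightarrow> \<exists>l. (x \<longlongrightarrow> l) (at_right t)"
  shows "x \<in> borel_measurable (restrict_space borel {0..})"
proof -
  obtain xr where xr: "\<And>t. t \<ge> 0 \<Longrightarrow> (x \<longlongrightarrow> xr t) (at_right t)" using assms by metis
  have meas: "xr \<in> borel_measurable (restrict_space borel {0..})"
  proof (rule borel_measurable_LIMSEQ_metric)
    fix k :: nat
    have "(\<lambda>t::real. \<lfloor>real (Suc k) * t\<rfloor>) \<in> measurable borel (count_space UNIV)"
      by (rule measurable_compose[OF _ measurable_real_floor]) measurable
    then have "(\<lambda>t. x (real_of_int (\<lfloor>real (Suc k) * t\<rfloor> + 1) / real (Suc k))) \<in> borel_measurable borel"
      by (rule measurable_compose) simp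
    then show "(\<lambda>t. x (real_of_int (\<lfloor>real (Suc k) * t\<rfloor>
        + 1) / real (Suc k))) \<in> borel_measurable (restrict_space borel {0..})"
      by (rule measurable_restrict_space1)
  next
    fix t :: real assume "t \<in> space (restrict_space borel {0..})"
    then have t: "t \<ge> 0" by (simp add: space_restrict_space)
    define s where "s k = real_of_int (\<lfloor>real (Suc k) * t\<rfloor> + 1) / real (Suc k)" for k
    have s: "t < s k" "s k \<le> t + 1 / real (Suc k)" for k
    proof -
      have "real (Suc k) * t < real_of_int \<lfloor>real (Suc k) * t\<rfloor> + 1" by linarith
      then show "t < s k" unfolding s_def by (simp add: pos_less_divide_eq mult.commute)
      have "real_of_int \<lfloor>real (Suc k) * t\<rfloor> + 1 \<le> real (Suc k) * t + 1" by linarith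
      then have "s k \<le> (real (Suc k) * t + 1) / real (Suc k)" unfolding s_def by (intro divide_right_mono) auto
      then show "s k \<le> t + 1 / real (Suc k)" by (simp add: add_divide_distrib)
    qed
    have "(\<lambda>k. t + 1 / real (Suc k)) \<longlonglongrightarrow> t + 0"
      using LIMSEQ_inverse_real_of_nat by (intro tendsto_intros) (simp add: inverse_eq_divide)
    then have l: "(\<lambda>k. t + 1 / real (Suc k)) \<longlonglongrightarrow> t" by (simp only: add_0_right)
    have "s \<longlonglongrightarrow> t"
    proof (rule tendsto_sandwich[OF _ _ tendsto_const l])
      show "\<forall>\<^sub>F k in sequentially. t \<le> s k" using s(1) less_imp_le by (intro always_eventually) blast
      show "\<forall>\<^sub>F k in sequentially. s k \<le> t + 1 / real (Suc k)" using s(2) by (intro always_eventually) blast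
    qed
    then have "filterlim s (at_right t) sequentially"
      using s(1) by (auto simp: filterlim_at intro!: always_eventually)
    from filterlim_compose[OF xr[OF t] this]
    show "(\<lambda>k. x (real_of_int (\<lfloor>real (Suc k) * t\<rfloor> + 1) / real (Suc k))) \<longlonglongrightarrow> xr t"
      by (simp add: s_def)
  qed
  define D where "D k = {t. t \<ge> 0 \<and> dist (x t) (xr t) > 1 / real (Suc k)}" for k
  have "countable (D k)" for k
  proof -
    define e where "e = 1 / real (Suc k)"
    have "e > 0" by (simp add: e_def)
    have isol: "\<exists>\<eta>>0. \<forall>s. t < s \<longrightarrow> s < t + \<eta> \<longrightarrow> s \<notin> D k" if "t \<ge> 0" for t
    proof -
      have "\<forall>\<^sub>F s in at_right t. dist (x s) (xr t) < e / 2"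
        using tendstoD[OF xr[OF that], of "e / 2"] \<open>e > 0\<close> by simp
      then obtain b where b: "b > t" "\<And>s. t < s \<Longrightarrow> s < b \<Longrightarrow> dist (x s) (xr t) < e / 2"
        unfolding eventually_at_right_field by blast
      have "s \<notin> D k" if s: "t < s" "s < b" for s
      proof -
        have "((\<lambda>u. dist (x u) (xr t)) \<longlongrightarrow> dist (xr s) (xr t)) (at_right s)"
          using s \<open>t \<ge> 0\<close> by (intro tendsto_intros xr) simp
        moreover have "\<forall>\<^sub>F u in at_right s. dist (x u) (xr t) \<le> e / 2"
        proof -
          have "\<forall>\<^sub>F u in at_right s. u \<in> {s<..<b}" using s eventually_at_right_real by blast
          then show ?thesis by eventually_elim (use b s in \<open>auto intro!: less_imp_le\<close>)
        qed
        ultimately have "dist (xr s) (xr t) \<le> e / 2"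
          using tendsto_upperbound trivial_limit_at_right_real by blast
        then have "dist (x s) (xr s) \<le> e"
          using b(2)[OF s] dist_triangle2[of "x s" "xr s" "xr t"] by linarith
        then show ?thesis by (simp add: D_def e_def)
      qed
      then show ?thesis using b(1) by (intro exI[of _ "b - t"]) auto
    qed
    then obtain \<eta> where \<eta>: "\<And>t. t \<ge> 0 \<Longrightarrow> \<eta> t > 0" "\<And>t s. t \<ge> 0 \<Longrightarrow> t < s \<Longrightarrow> s < t + \<eta> t \<Longrightarrow> s \<notin> D k" by metis
    have "\<exists>q\<in>\<rat>. t < q \<and> q < t + \<eta> t" if "t \<in> D k" for t
      using Rats_dense_in_real[of t "t + \<eta> t"] \<eta>(1) that by (auto simp: D_def)
    then obtain q where q: "\<And>t. t \<in> D k \<Longrightarrow> q t \<in> \<rat> \<and> t < q t \<and> q t < t + \<eta> t" by metis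
    have neq: "q s \<noteq> q t" if "s \<in> D k" "t \<in> D k" "s < t" for s t
    proof
      assume "q s = q t"
      then have "t < s + \<eta> s" using q[OF that(1)] q[OF that(2)] by linarith
      then show False using \<eta>(2)[of s t] that by (auto simp: D_def)
    qed
    have "inj_on q (D k)" by (rule linorder_inj_onI') (use neq in auto)
    moreover have "countable (q ` D k)" by (rule countable_subset[OF _ countable_rat]) (use q in auto)
    ultimately show ?thesis by (rule countable_image_inj_on[rotated])
  qed
  then have cD: "countable (\<Union>k. D k)" by simp
  have eq: "x t = xr t" if "t \<ge> 0" "t \<notin> (\<Union>k. D k)" for t
  proof (rule ccontr)
    assume "x t \<noteq> xr t"
    then obtain k where "1 / real (Suc k) < dist (x t) (xr t)"
      using reals_Archimedean[of "dist (x t) (xr t)"] by (auto simp: inverse_eq_divide)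
    then show False using that by (auto simp: D_def)
  qed
  show ?thesis
  proof (rule measurable_discrete_difference[OF meas cD])
    fix t assume "t \<in> (\<Union>k. D k)"
    then have "t \<ge> 0" by (auto simp: D_def)
    then show "{t} \<in> sets (restrict_space borel {0..})" by (subst sets_restrict_space_iff) auto
  next
    fix t assume "t \<in> space (restrict_space borel {0..})" "t \<notin> (\<Union>k. D k)"
    then show "xr t = x t" using eq[of t] by (simp add: space_restrict_space)
  qed auto
qed

context stieltjes_integrator
begin

lemma borel_measurable_lebesgue_on:
  assumes "f \<in> borel_measurable (restrict_space borel S)"
  shows "f \<in> borel_measurable (lebesgue_on S)"
proof (rule borel_measurable_subalgebra[OF _ _ assms])
  show "sets (restrict_space borel S) \<subseteq> sets (lebesgue_on S)"
    unfolding sets_restrict_space by (auto intro!: image_mono)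
qed (simp add: space_restrict_space)

lemma measurable_levels_of_right_limits:
  fixes x :: "real \<Rightarrow> 'a::metric_space"
  assumes "\<And>t. t \<ge> 0 \<Longrightarrow> \<exists>l. (x \<longlongrightarrow> l) (at_right t)"
  shows "(\<lambda>y. x (ginv y)) \<in> borel_measurable (lebesgue_on levels)"
proof (rule borel_measurable_lebesgue_on)
  have "ginv \<in> borel_measurable (restrict_space borel levels)"
    by (rule borel_measurable_mono_on_fnc[OF ginv_mono])
  then have "ginv \<in> measurable (restrict_space borel levels) (restrict_space borel {0..})"
    by (rule measurable_restrict_space2[rotated]) (auto simp: space_restrict_space ginv_nonneg)
  then show "(\<lambda>y. x (ginv y)) \<in> borel_measurable (restrict_space borel levels)"
    by (rule measurable_compose[OF _ right_limits_borel_measurable[OF assms]])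
qed

lemma measurable_levels_of_integrable:
  fixes F :: "real \<Rightarrow> 'a::euclidean_space"
  assumes int: "\<And>t. t \<ge> 0 \<Longrightarrow> (\<lambda>y. F (ginv y)) integrable_on {g 0..g t}"
  shows "(\<lambda>y. F (ginv y)) \<in> borel_measurable (lebesgue_on levels)"
proof (rule borel_measurable_LIMSEQ_metric)
  fix k :: nat
  have "(\<lambda>y. if y \<in> {g 0..g (real k)} then F (ginv y) else 0) integrable_on UNIV"
    using int[of "real k"] by (subst Henstock_Kurzweil_Integration.integrable_restrict_UNIV) auto
  then have "(\<lambda>y. if y \<in> {g 0..g (real k)} then F (ginv y) else 0) \<in> borel_measurable (lebesgue_on UNIV)"
    by (rule integrable_imp_measurable)
  then have "(\<lambda>y. if y \<in> {g 0..g (real k)} then F (ginv y) else 0) \<in> borel_measurable lebesgue"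
    by (simp add: lebesgue_on_UNIV_eq)
  then show "(\<lambda>y. if y \<in> {g 0..g (real k)} then F (ginv y) else 0) \<in> borel_measurable (lebesgue_on levels)"
    by (rule measurable_restrict_space1)
next
  fix y assume "y \<in> space (lebesgue_on levels)"
  then obtain N where N: "g 0 \<le> y" "y < g (real N)" by (auto simp: levels_eq space_restrict_space)
  have "(if y \<in> {g 0..g (real k)} then F (ginv y) else 0) = F (ginv y)" if "N \<le> k" for k
    using N g_le[of "real N" "real k"] that by auto
  then show "(\<lambda>k. if y \<in> {g 0..g (real k)} then F (ginv y) else 0) \<longlonglongrightarrow> F (ginv y)"
    by (intro tendsto_eventually eventually_sequentiallyI)
qed

end

section \<open>Existence of an asymptotically periodic solution\<close>

lemma ks_integral_inf_ge:
  assumes mono: "\<And>s t. 0 \<le> s \<Longrightarrow> s \<le> t \<Longrightarrow> ks_integral q g 0 s \<le> ks_integral q g 0 t" and "0 \<le> t"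
  shows "ereal (ks_integral q g 0 t) \<le> ks_integral_inf q g"
proof -
  let ?S = "SUP t\<in>{0..}. ereal (ks_integral q g 0 t)"
  have "((\<lambda>t. ereal (ks_integral q g 0 t)) \<longlongrightarrow> ?S) at_top"
  proof (rule order_tendstoI)
    fix a assume "a < ?S"
    then obtain t0 where t0: "t0 \<ge> 0" "a < ereal (ks_integral q g 0 t0)" by (auto simp: less_SUP_iff)
    show "\<forall>\<^sub>F t in at_top. a < ereal (ks_integral q g 0 t)"
      using eventually_ge_at_top[of t0]
    proof eventually_elim
      case (elim t)
      then have "ereal (ks_integral q g 0 t0) \<le> ereal (ks_integral q g 0 t)" using mono t0 by simp
      with t0(2) show ?case by (rule less_le_trans)
    qed
  next
    fix a assume a: "?S < a"
    show "\<forall>\<^sub>F t in at_top. ereal (ks_integral q g 0 t) < a"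
      using eventually_ge_at_top[of 0]
    proof eventually_elim
      case (elim t)
      then have "ereal (ks_integral q g 0 t) \<le> ?S" by (intro SUP_upper) simp
      then show ?case using a by (rule le_less_trans)
    qed
  qed
  then have "ks_integral_inf q g = ?S"
    unfolding ks_integral_inf_def by (intro tendsto_Lim) auto
  then show ?thesis using assms(2) by (auto intro: SUP_upper)
qed

text \<open>
  The limit inferior leaves room for the constant \<open>K\<close>: for some \<open>c < 1\<close> there are arbitrarily
  large \<open>N\<close> with \<open>\<alpha> N + \<beta> N < c * N\<close>, and \<open>K \<le> (1 - c) * N\<close> once \<open>N\<close> is large.
\<close>

lemma growth_radius:
  fixes \<alpha> \<beta> :: "real \<Rightarrow> ereal"
  assumes growth: "Liminf at_top (\<lambda>N::real. ereal (1 / N) * (\<alpha> N + \<beta> N)) < 1"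
    and nonneg: "\<And>N. N \<ge> 0 \<Longrightarrow> 0 \<le> \<alpha> N" "\<And>N. N \<ge> 0 \<Longrightarrow> 0 \<le> \<beta> N"
  obtains N A B where "N > 0" "N \<ge> N0" "\<alpha> N = ereal A" "\<beta> N = ereal B" "K + A + B \<le> N"
proof -
  obtain c where c: "Liminf at_top (\<lambda>N::real. ereal (1 / N) * (\<alpha> N + \<beta> N)) < ereal c" "c < 1"
    using ereal_dense2[OF growth] by auto
  define N1 where "N1 = max (max 1 N0) (K / (1 - c))"
  have "\<exists>N\<ge>N1. ereal (1 / N) * (\<alpha> N + \<beta> N) < ereal c"
  proof (rule ccontr)
    assume "\<not> ?thesis"
    then have "\<forall>\<^sub>F N in at_top. ereal c \<le> ereal (1 / N) * (\<alpha> N + \<beta> N)"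
      unfolding eventually_at_top_linorder by (intro exI[of _ N1]) (auto simp: not_less)
    from Liminf_bounded[OF this] c(1) show False by simp
  qed
  then obtain N where N: "N \<ge> N1" "ereal (1 / N) * (\<alpha> N + \<beta> N) < ereal c" by blast
  then have N': "N \<ge> 1" "N \<ge> N0" "K / (1 - c) \<le> N" by (auto simp: N1_def)
  have K: "K \<le> (1 - c) * N" using N'(3) c(2) by (simp add: divide_le_eq mult.commute)
  have pos: "0 \<le> \<alpha> N" "0 \<le> \<beta> N" using nonneg N' by auto
  have fin: "\<alpha> N \<noteq> \<infinity>" "\<beta> N \<noteq> \<infinity>" using N(2) pos N'(1) by (auto split: if_splits)
  obtain A B where AB: "\<alpha> N = ereal A" "\<beta> N = ereal B"
    using fin pos by (cases "\<alpha> N"; cases "\<beta> N") auto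
  have "(A + B) / N < c" using N(2) AB by simp
  then have "A + B \<le> c * N" using N'(1) by (simp add: divide_less_eq)
  then have "K + A + B \<le> N" using K by (simp add: algebra_simps)
  with AB N' show ?thesis by (intro that[of N A B]) auto
qed

theorem theorem4p10:
  fixes nrm :: "real ^ 'n \<Rightarrow> real"
    and \<omega> :: real
    and g :: "real \<Rightarrow> real"
    and x0 :: "real ^ 'n"
    and f h :: "real \<Rightarrow> real ^ 'n \<Rightarrow> real ^ 'n"
    and M :: "real \<Rightarrow> real \<Rightarrow> real"
  assumes nrm: "is_norm nrm"
    and \<omega>: "\<omega> > 0"
    and g_mono: "mono_on {0..} g"
    and g_left: "\<And>t. t > 0 \<Longrightarrow> (g \<longlongrightarrow> g t) (at_left t)"
    and A0: "\<And>t. t \<ge> 0 \<Longrightarrow> continuous_on UNIV (f t)"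
    and A1: "\<And>u a. a > 0 \<Longrightarrow> ks_integrable (\<lambda>s. f s u) g 0 a"
    and A2_nonneg: "\<And>s \<alpha>. s \<ge> 0 \<Longrightarrow> \<alpha> \<ge> 0 \<Longrightarrow> M s \<alpha> \<ge> 0"
    and A2_integrable: "\<And>\<alpha> a. \<alpha> \<ge> 0 \<Longrightarrow> a > 0 \<Longrightarrow> ks_integrable (\<lambda>s. M s \<alpha>) g 0 a"
    and A2_mono: "\<And>s. s \<ge> 0 \<Longrightarrow> mono_on {0..} (M s)"
    and A2_bound: "\<And>u c d. 0 \<le> c \<Longrightarrow> c \<le> d \<Longrightarrow>
           nrm (ks_integral (\<lambda>s. f s u) g c d) \<le> ks_integral (\<lambda>s. M s (nrm u)) g c d"
    and A3_regulated: "\<And>v. bounded ((\<lambda>t. h t v) ` {0..}) \<and> regulated (\<lambda>t. h t v)"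
    and A3_contraction: "\<exists>\<phi> :: real \<Rightarrow> real \<Rightarrow> real. \<forall>r\<ge>0.
           D_function (\<lambda>t. \<phi> t r) \<and> (\<forall>t>0. \<phi> t r < t) \<and>
           (\<forall>u v. nrm u \<le> r \<and> nrm v \<le> r \<longrightarrow>
              (\<forall>t\<ge>0. nrm (h t u - h t v) \<le> \<phi> (nrm (u - v)) r))"
    and growth: "Liminf at_top (\<lambda>N::real. ereal (1 / N) *
             ((SUP (t, u) \<in> {0..} \<times> {u. nrm u \<le> N}. ereal (nrm (h t u)))
              + ks_integral_inf (\<lambda>s. M s N) g)) < 1"
    and a: "unif_S_asymp_periodic_on_bounded \<omega> h"
    and b: "\<And>N. N > 0 \<Longrightarrow> S_asymp_periodic \<omega> (\<lambda>t. ks_integral (\<lambda>s. M s N) g 0 t)"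
  shows "\<exists>x. is_solution f h g x0 x \<and> S_asymp_periodic \<omega> x"
proof -
  interpret S: stieltjes_integrator g by unfold_locales (use g_mono g_left in auto)
  note nD = is_normD[OF nrm]
  have intM: "(\<lambda>y. M (S.ginv y) \<alpha>) integrable_on {g 0..g t}" if "\<alpha> \<ge> 0" "t \<ge> 0" for \<alpha> t
    using S.integrable_levels[of "\<lambda>s. M s \<alpha>"] A2_integrable that by blast
  have ksM: "ks_integral (\<lambda>s. M s \<alpha>) g c d = integral {g c..g d} (\<lambda>y. M (S.ginv y) \<alpha>)"
    if "\<alpha> \<ge> 0" "0 \<le> c" "c \<le> d" for \<alpha> c d
    using S.ks_integral_eq(2)[of "\<lambda>s. M s \<alpha>"] A2_integrable that by blast
  have intf: "(\<lambda>y. f (S.ginv y) u) integrable_on {g 0..g t}" if "t \<ge> 0" for u t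
    using S.integrable_levels[of "\<lambda>s. f s u"] A1 that by blast
  have ksf: "ks_integral (\<lambda>s. f s u) g c d = integral {g c..g d} (\<lambda>y. f (S.ginv y) u)"
    if "0 \<le> c" "c \<le> d" for u c d
    using S.ks_integral_eq(2)[of "\<lambda>s. f s u"] A1 that by blast
  define mu where "mu \<alpha> y = (if y \<in> S.levels then M (S.ginv y) \<alpha> else 0)" for \<alpha> y
  have mu_nonneg: "0 \<le> mu \<alpha> y" if "\<alpha> \<ge> 0" for \<alpha> y
    using A2_nonneg S.ginv_nonneg that by (simp add: mu_def)
  have mu_int: "(mu \<alpha> has_integral ks_integral (\<lambda>s. M s \<alpha>) g c d) {g c..g d}"
    if "\<alpha> \<ge> 0" "0 \<le> c" "c \<le> d" for \<alpha> c d
    unfolding ksM[OF that] mu_def by (rule S.has_integral_levels[OF intM that(2,3)]) (rule that)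
  have J_mono: "ks_integral (\<lambda>s. M s \<alpha>) g 0 s \<le> ks_integral (\<lambda>s. M s \<alpha>) g 0 t"
    if "\<alpha> \<ge> 0" "0 \<le> s" "s \<le> t" for \<alpha> s t
    by (rule has_integral_subset_le[OF _ mu_int mu_int]) (use that S.g_le mu_nonneg in auto)
  have J_0: "ks_integral (\<lambda>s. M s \<alpha>) g 0 0 = 0" if "\<alpha> \<ge> 0" for \<alpha> using ksM[OF that, of 0 0] by simp

  define c0 where "c0 = x0 - h 0 x0"
  obtain N A B where N: "N > 0" "N \<ge> nrm x0"
      "(SUP (t, u) \<in> {0..} \<times> {u. nrm u \<le> N}. ereal (nrm (h t u))) = ereal A"
      "ks_integral_inf (\<lambda>s. M s N) g = ereal B" "nrm c0 + A + B \<le> N"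
  proof (rule growth_radius[OF growth])
    fix N :: real assume "N \<ge> 0"
    have "0 \<le> ereal (nrm (h 0 0))" using nD(1) by simp
    also have "\<dots> \<le> (SUP (t, u) \<in> {0..} \<times> {u. nrm u \<le> N}. ereal (nrm (h t u)))"
      by (rule SUP_upper2[of "(0, 0)"]) (use nD(5) \<open>N \<ge> 0\<close> in auto)
    finally show "0 \<le> (SUP (t, u) \<in> {0..} \<times> {u. nrm u \<le> N}. ereal (nrm (h t u)))" .
    have "ereal (ks_integral (\<lambda>s. M s N) g 0 0) \<le> ks_integral_inf (\<lambda>s. M s N) g"
      by (rule ks_integral_inf_ge) (use J_mono \<open>N \<ge> 0\<close> in auto)
    then show "0 \<le> ks_integral_inf (\<lambda>s. M s N) g" using J_0[OF \<open>N \<ge> 0\<close>] by (simp add: zero_ereal_def)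
  qed
  have N0: "N \<ge> 0" using N(1) by simp
  have hA: "nrm (h t u) \<le> A" if "t \<ge> 0" "nrm u \<le> N" for t u
  proof -
    have "ereal (nrm (h t u)) \<le> (SUP (t, u) \<in> {0..} \<times> {u. nrm u \<le> N}. ereal (nrm (h t u)))"
      by (rule SUP_upper2[of "(t, u)"]) (use that in auto)
    then show ?thesis unfolding N(3) by simp
  qed
  have JB: "ks_integral (\<lambda>s. M s N) g 0 t \<le> B" if "t \<ge> 0" for t
    using ks_integral_inf_ge[of "\<lambda>s. M s N" g t] J_mono[OF N0] that unfolding N(4) by simp
  have B0: "B \<ge> 0" using JB[of 0] J_0[OF N0] by simp

  obtain \<phi> where \<phi>: "D_function \<phi>" "\<And>t. t > 0 \<Longrightarrow> \<phi> t < t"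
    "\<And>t u v. nrm u \<le> N \<Longrightarrow> nrm v \<le> N \<Longrightarrow> t \<ge> 0 \<Longrightarrow> nrm (h t u - h t v) \<le> \<phi> (nrm (u - v))"
    using A3_contraction N0 by metis
  interpret C: contractive_family nrm h \<phi> N
    by unfold_locales (use nrm \<phi> in \<open>auto simp: D_function_def\<close>)
  define m where "m = mu N"
  have m_int: "m integrable_on {c..d}" and m_bd: "integral {c..d} m \<le> B" for c d
    unfolding m_def mu_def
    by (rule S.integral_levels; use A2_nonneg N0 intM JB ksM[OF N0, of 0] in fastforce)+
  have m_J: "integral {g c..g d} m = ks_integral (\<lambda>s. M s N) g c d" if "0 \<le> c" "c \<le> d" for c d
    using mu_int[OF N0 that] by (simp add: m_def integral_unique)
  have m0: "0 \<le> m y" for y using mu_nonneg[OF N0] by (simp add: m_def)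

  obtain Z where Z: "negligible Z"
    "\<And>y u. y \<in> S.levels - Z \<Longrightarrow> nrm u \<le> N \<Longrightarrow> nrm (f (S.ginv y) u) \<le> M (S.ginv y) N"
  proof -
    \<comment> \<open>Countably many states suffice because \<open>f t\<close> is continuous. They are taken inside the ball,
      so that the bound \<open>M (S.ginv y) N\<close> applies to each of them.\<close>
    obtain T where T: "countable T" "T \<subseteq> {u. nrm u \<le> N}" "{u. nrm u \<le> N} \<subseteq> closure T"
      using separable[of "{u. nrm u \<le> N}"] by blast
    have "\<exists>Z. negligible Z \<and> (\<forall>y\<in>S.levels - Z. nrm (f (S.ginv y) u) \<le> M (S.ginv y) (nrm u))" for u
    proof -
      obtain Z where "negligible Z" "\<And>y. y \<in> S.levels - Z \<Longrightarrow> nrm (f (S.ginv y) u) \<le> M (S.ginv y) (nrm u)"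
      proof (rule S.ae_is_norm_le[OF nrm, of "\<lambda>s. f s u" "\<lambda>s. M s (nrm u)"])
        fix c d :: real assume cd: "0 \<le> c" "c \<le> d"
        show "nrm (integral {g c..g d} (\<lambda>y. f (S.ginv y) u)) \<le> integral {g c..g d} (\<lambda>y. M (S.ginv y) (nrm u))"
          using A2_bound[OF cd, of u] ksf[OF cd] ksM[OF nD(1) cd] by simp
      qed (use intf intM nD(1) in auto)
      then show ?thesis by blast
    qed
    then obtain Zu where Zu: "\<And>u. negligible (Zu u)"
      "\<And>u y. y \<in> S.levels - Zu u \<Longrightarrow> nrm (f (S.ginv y) u) \<le> M (S.ginv y) (nrm u)" by metis
    show ?thesis
    proof (rule that[of "\<Union>(Zu ` T)"])
      show "negligible (\<Union>(Zu ` T))" using T(1) Zu(1) by (intro negligible_countable_Union) auto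
      fix y u assume y: "y \<in> S.levels - \<Union>(Zu ` T)" and u: "nrm u \<le> N"
      define \<tau> where "\<tau> = S.ginv y"
      have \<tau>: "\<tau> \<ge> 0" using S.ginv_nonneg y by (simp add: \<tau>_def)
      have "T \<subseteq> {u. nrm (f \<tau> u) \<le> M \<tau> N}"
      proof
        fix v assume v: "v \<in> T"
        then have "nrm (f \<tau> v) \<le> M \<tau> (nrm v)" using Zu(2)[of y v] y by (auto simp: \<tau>_def)
        also have "\<dots> \<le> M \<tau> N" using mono_onD[OF A2_mono[OF \<tau>], of "nrm v" N] T(2) v nD(1) N0 by auto
        finally show "v \<in> {u. nrm (f \<tau> u) \<le> M \<tau> N}" by simp
      qed
      moreover have "closed {u. nrm (f \<tau> u) \<le> M \<tau> N}"
        by (intro closed_Collect_le continuous_on_compose2[OF is_norm_continuous[OF nrm, of UNIV] A0[OF \<tau>]] continuous_on_const) auto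
      ultimately have "closure T \<subseteq> {u. nrm (f \<tau> u) \<le> M \<tau> N}" by (rule closure_minimal)
      then show "nrm (f (S.ginv y) u) \<le> M (S.ginv y) N" using T(3) u by (auto simp: \<tau>_def)
    qed
  qed

  define K where "K = {w. nrm w \<le> B}"
  have K: "closed K" "convex K" "K \<noteq> {}"
    using is_norm_ball[OF nrm, of B] B0 nD(5) by (auto simp: K_def compact_imp_closed intro!: exI[of _ 0])
  \<comment> \<open>Composing with the projection onto the ball of radius \<open>B\<close> makes the right-hand side defined
    for all states. It does not change the equation for the solution, which stays in that ball.\<close>
  define cl where "cl = closest_point K"
  have clK: "nrm (cl w) \<le> B" for w
    using closest_point_in_set[OF K(1,3), of w] by (simp add: cl_def K_def)
  have cl_cont: "continuous_on UNIV cl" unfolding cl_def by (rule continuous_on_closest_point[OF K(2,1,3)])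
  have cl_id: "cl w = w" if "nrm w \<le> B" for w
    unfolding cl_def by (rule closest_point_self) (use that in \<open>simp add: K_def\<close>)
  have self: "nrm (c0 + w + h t u) \<le> N" if "t \<ge> 0" "nrm u \<le> N" "nrm w \<le> B" for t u w
    using nD(4)[of "c0 + w" "h t u"] nD(4)[of c0 w] hA[OF that(1,2)] that(3) N(5) by linarith
  have res: "nrm (C.resolvent t (c0 + w)) \<le> N"
    "C.resolvent t (c0 + w) - h t (C.resolvent t (c0 + w)) = c0 + w" if "t \<ge> 0" "nrm w \<le> B" for t w
    using C.resolvent[OF N0 that(1), of "c0 + w"] self[OF that(1) _ that(2)] by auto
  have res_lim: "\<exists>l. ((\<lambda>t. C.resolvent t (c0 + w t)) \<longlongrightarrow> l) F"
    if *: "F \<noteq> bot" "\<forall>\<^sub>F t in F. t \<ge> 0" "\<And>t. t \<ge> 0 \<Longrightarrow> nrm (w t) \<le> B" "(w \<longlongrightarrow> w0) F"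
      "\<And>u. \<exists>l. ((\<lambda>t. h t u) \<longlongrightarrow> l) F" for F w w0
  proof -
    obtain l where l: "\<And>u. ((\<lambda>t. h t u) \<longlongrightarrow> l u) F" using *(5) by metis
    have "((\<lambda>t. c0 + w t) \<longlongrightarrow> c0 + w0) F" by (intro tendsto_intros *(4))
    from C.resolvent_limit[OF N0 *(1,2) self[OF _ _ *(3)] this l] show ?thesis by blast
  qed

  \<comment> \<open>On the negligible set \<open>Z\<close> the value zero makes the majorant valid at every level.\<close>
  define H where "H y w = (if y \<in> S.levels - Z then f (S.ginv y) (C.resolvent (S.ginv y) (c0 + cl w)) else 0)" for y w
  define G where "G y = (if y \<in> S.levels then g (S.ginv y) else y)" for y
  obtain Cn where Cn: "Cn > 0" "\<And>x. norm x \<le> Cn * nrm x" using norm_le_is_norm[OF nrm] by blast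
  have H_le: "nrm (H y w) \<le> m y" for y w
  proof (cases "y \<in> S.levels - Z")
    case True
    then show ?thesis using Z(2)[OF True res(1)[OF _ clK]] S.ginv_nonneg by (simp add: H_def m_def mu_def)
  next
    case False
    then have "H y w = 0" by (auto simp: H_def)
    then show ?thesis using m0 nD(5) by simp
  qed
  have levelsZ: "S.levels - Z \<in> sets lebesgue"
    using S.levels_borel Z(1) negligible_imp_sets by (intro sets.Diff) auto
  obtain W where W: "continuous_on UNIV W" "\<And>y. (\<lambda>s. H s (W (G s))) integrable_on {g 0..y}"
    "\<And>y. W y = integral {g 0..y} (\<lambda>s. H s (W (G s)))"
  proof (rule caratheodory_delay_solution[of H "g 0" "\<lambda>y. Cn * m y" "Cn * B" G])
    fix w
    have "(\<lambda>y. C.resolvent (S.ginv y) (c0 + cl w)) \<in> borel_measurable (lebesgue_on S.levels)"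
    proof (rule S.measurable_levels_of_right_limits)
      fix t :: real assume "t \<ge> 0"
      have "\<forall>\<^sub>F s in at_right t. s \<ge> 0" using eventually_at_right_less[of t] by eventually_elim (use \<open>t \<ge> 0\<close> in simp)
      then show "\<exists>l. ((\<lambda>t. C.resolvent t (c0 + cl w)) \<longlongrightarrow> l) (at_right t)"
        using res_lim[of "at_right t" "\<lambda>_. cl w" "cl w"] clK A3_regulated \<open>t \<ge> 0\<close>
        by (auto simp: regulated_def)
    qed
    then have "(\<lambda>y. f (S.ginv y) (C.resolvent (S.ginv y) (c0 + cl w))) \<in> borel_measurable (lebesgue_on S.levels)"
      by (rule caratheodory_measurable[where H = "\<lambda>y. f (S.ginv y)", rotated 2])
         (use S.measurable_levels_of_integrable[of "\<lambda>s. f s _"] intf A0 S.ginv_nonneg in \<open>auto simp: space_restrict_space\<close>)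
    then have "(\<lambda>y. f (S.ginv y) (C.resolvent (S.ginv y) (c0
        + cl w))) \<in> borel_measurable (lebesgue_on (S.levels - Z))"
      by (rule measurable_restrict_mono) auto
    then have "(\<lambda>y. H y w) \<in> borel_measurable lebesgue"
      unfolding H_def by (rule borel_measurable_if_I[OF _ levelsZ])
    then show "(\<lambda>y. H y w) \<in> borel_measurable (lebesgue_on {g 0..})" by (rule measurable_restrict_space1)
  next
    fix y assume "y \<ge> g 0"
    show "continuous_on UNIV (H y)"
    proof (cases "y \<in> S.levels - Z")
      case True
      then have \<tau>: "S.ginv y \<ge> 0" using S.ginv_nonneg by simp
      have "continuous_on {v. \<exists>w\<in>K. v = c0 + w} (C.resolvent (S.ginv y))"
        by (rule C.resolvent_continuous[OF N0 \<tau>]) (use self[OF \<tau>] in \<open>auto simp: K_def\<close>)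
      then have "continuous_on UNIV (\<lambda>w. C.resolvent (S.ginv y) (c0 + cl w))"
        by (rule continuous_on_compose2) (use clK in \<open>auto simp: K_def intro!: continuous_intros cl_cont\<close>)
      then have "continuous_on UNIV (\<lambda>w. f (S.ginv y) (C.resolvent (S.ginv y) (c0 + cl w)))"
        by (rule continuous_on_compose2[OF A0[OF \<tau>]]) auto
      then show ?thesis using True by (simp add: H_def[abs_def])
    next
      case False
      then have "H y = (\<lambda>_. 0)" by (auto simp: H_def)
      then show ?thesis by simp
    qed
    show "norm (H y w) \<le> Cn * m y" for w
      using Cn(2)[of "H y w"] mult_left_mono[OF H_le, of Cn y w] Cn(1) by linarith
    show "G y \<le> y" using S.g_ginv_le by (simp add: G_def)
  next
    show "(\<lambda>y. Cn * m y) integrable_on {g 0..\<beta>}" for \<beta> using m_int by (rule integrable_on_mult_right)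
    show "integral {g 0..\<beta>} (\<lambda>y. Cn * m y) \<le> Cn * B" for \<beta> using m_bd Cn(1) by (simp add: mult_left_mono)
    have "mono_on {g 0..} G"
    proof (rule mono_onI)
      fix y z assume yz: "y \<in> {g 0..}" "z \<in> {g 0..}" "y \<le> z"
      show "G y \<le> G z"
      proof (cases "z \<in> S.levels")
        case True
        then have y: "y \<in> S.levels" using yz by (force simp: S.levels_def)
        have "S.ginv y \<le> S.ginv z" using mono_onD[OF S.ginv_mono y True yz(3)] .
        then show ?thesis using True y S.g_le S.ginv_nonneg by (simp add: G_def)
      next
        case False
        then show ?thesis using yz S.g_ginv_le[of y] by (auto simp: G_def)
      qed
    qed
    then show "G \<in> borel_measurable (lebesgue_on {g 0..})"
      by (intro S.borel_measurable_lebesgue_on borel_measurable_mono_on_fnc)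
  qed (use that in blast)

  have W_incr: "nrm (W z - W y) \<le> integral {y..z} m" if "g 0 \<le> y" "y \<le> z" for y z
  proof -
    have "W z - W y = integral {y..z} (\<lambda>s. H s (W (G s)))"
      using Henstock_Kurzweil_Integration.integral_combine[OF that W(2)] W(3)[of y] W(3)[of z]
          by (simp add: algebra_simps)
    moreover have "(\<lambda>s. H s (W (G s))) integrable_on {y..z}"
      by (rule integrable_subinterval_real[OF W(2)[of z]]) (use that in auto)
    ultimately show ?thesis using is_norm_integral_le[OF nrm _ m_int] H_le by simp
  qed
  have W_0: "W (g 0) = 0" using W(3)[of "g 0"] by simp
  have W_bd: "nrm (W y) \<le> B" if "g 0 \<le> y" for y
    using W_incr[OF order_refl that] m_bd[of "g 0" y] W_0 by simp

  \<comment> \<open>The equation evaluates \<open>W\<close> at \<open>G y = g (ginv y)\<close>, and this is the value of \<open>w\<close> at the time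
    \<open>ginv y\<close>.\<close>
  define w where "w t = W (g t)" for t
  define x where "x t = C.resolvent t (c0 + w t)" for t
  have wB: "nrm (w t) \<le> B" if "t \<ge> 0" for t using W_bd S.g_le[of 0 t] that by (simp add: w_def)
  have xN: "nrm (x t) \<le> N" and x_eq: "x t - h t (x t) = c0 + w t" if "t \<ge> 0" for t
    using res[OF that wB[OF that]] by (auto simp: x_def)
  have Hx: "H y (W (G y)) = f (S.ginv y) (x (S.ginv y))" if "y \<in> S.levels - Z" for y
  proof -
    have \<tau>: "S.ginv y \<ge> 0" using S.ginv_nonneg that by simp
    show ?thesis using that cl_id[OF wB[OF \<tau>]] by (simp add: H_def G_def x_def w_def)
  qed
  have ks_x: "ks_has_integral (\<lambda>s. f s (x s)) g 0 t (w t)" if t: "t \<ge> 0" for t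
  proof -
    have "((\<lambda>y. f (S.ginv y) (x (S.ginv y))) has_integral w t) {g 0..g t}"
    proof (rule has_integral_spike[of "Z \<union> {g t}"])
      show "negligible (Z \<union> {g t})" using Z(1) by (simp add: negligible_Un)
      show "((\<lambda>s. H s (W (G s))) has_integral w t) {g 0..g t}"
        using W(2,3)[of "g t"] by (simp add: w_def has_integral_integrable_integral)
      show "f (S.ginv y) (x (S.ginv y)) = H y (W (G y))" if y: "y \<in> {g 0..g t} - (Z \<union> {g t})" for y
        using Hx[of y] S.levelsI[of 0 t y] y t by auto
    qed
    then show ?thesis using S.ks_of_integrable[of 0 t "\<lambda>s. f s (x s)"] t
      by (auto simp: has_integral_integrable_integral)
  qed
  have W_tendsto: "((\<lambda>s. W (g s)) \<longlongrightarrow> W r) F" if "(g \<longlongrightarrow> r) F" for r F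
    using continuous_on_tendsto_compose[OF W(1) that] by simp
  have w_right: "\<exists>l. (w \<longlongrightarrow> l) (at_right t)" if "t \<ge> 0" for t
  proof -
    interpret I: left_continuous_integrator g 0 "t + 1" using S.on_interval that by simp
    show ?thesis unfolding w_def using W_tendsto[OF I.right_lim_tendsto[of t]] that by auto
  qed
  have w_left: "(w \<longlongrightarrow> w t) (at_left t)" if "t > 0" for t
    unfolding w_def by (rule W_tendsto[OF g_left[OF that]])
  have ev_right: "\<forall>\<^sub>F s in at_right t. s \<ge> 0" if "t \<ge> 0" for t :: real
    using eventually_at_right_less[of t] by eventually_elim (use that in simp)
  have ev_left: "\<forall>\<^sub>F s in at_left t. s \<ge> 0" if "t > 0" for t :: real
    using eventually_at_left_real[OF that] by eventually_elim simp
  have x_right: "\<exists>l. (x \<longlongrightarrow> l) (at_right t)" if "t \<ge> 0" for t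
  proof -
    obtain l where "(w \<longlongrightarrow> l) (at_right t)" using w_right \<open>t \<ge> 0\<close> by blast
    from res_lim[OF _ ev_right[OF that] wB this] show ?thesis
      using A3_regulated that unfolding x_def regulated_def by auto
  qed
  have x_left: "\<exists>l. (x \<longlongrightarrow> l) (at_left t)" if "t > 0" for t
    using res_lim[OF _ ev_left[OF that] wB w_left[OF that]] A3_regulated that
    unfolding x_def regulated_def by auto
  have x_reg: "regulated x" unfolding regulated_def using x_right x_left by blast
  have hx_lim: "\<exists>l. ((\<lambda>t. h t (x t)) \<longlongrightarrow> l) F"
    if *: "\<exists>l. (x \<longlongrightarrow> l) F" "\<exists>l. (w \<longlongrightarrow> l) F" "\<forall>\<^sub>F t in F. t \<ge> 0" for F
  proof -
    obtain l l' where "(x \<longlongrightarrow> l) F" "(w \<longlongrightarrow> l') F" using * by blast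
    then have lim: "((\<lambda>t. x t - (c0 + w t)) \<longlongrightarrow> l - (c0 + l')) F" by (intro tendsto_intros)
    have "\<forall>\<^sub>F t in F. x t - (c0 + w t) = h t (x t)"
      using *(3) by eventually_elim (use x_eq in \<open>simp add: algebra_simps\<close>)
    from Lim_transform_eventually[OF lim this] show ?thesis by blast
  qed
  have hx_reg: "regulated (\<lambda>t. h t (x t))" unfolding regulated_def
    using hx_lim x_right x_left w_right w_left ev_right ev_left by blast
  have x_init: "x 0 = x0"
  proof (rule C.residual_inj[of 0])
    show "x 0 - h 0 (x 0) = x0 - h 0 x0" using x_eq[of 0] W_0 by (simp add: w_def c0_def)
  qed (use xN[of 0] N(2) in auto)
  have sol: "is_solution f h g x0 x"
    unfolding is_solution_def
  proof (intro conjI allI impI x_reg hx_reg x_init)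
    fix t :: real assume t: "t \<ge> 0"
    show "ks_integrable (\<lambda>s. f s (x s)) g 0 t" using ks_x[OF t] unfolding ks_integrable_def by blast
    show "x t = x0 - h 0 (x 0) + h t (x t) + ks_integral (\<lambda>s. f s (x s)) g 0 t"
      using x_eq[OF t] x_init ks_integral_unique[OF ks_x[OF t]] by (simp add: c0_def algebra_simps)
  qed

  have w_per: "((\<lambda>t. w (t + \<omega>) - w t) \<longlongrightarrow> 0) at_top"
  proof (rule tendsto_is_norm_zero[OF nrm])
    have lim: "((\<lambda>t. ks_integral (\<lambda>s. M s N) g 0 (t + \<omega>) - ks_integral (\<lambda>s. M s N) g 0 t) \<longlongrightarrow> 0) at_top"
      using b[OF N(1)] by (simp add: S_asymp_periodic_def)
    show "((\<lambda>t. nrm (w (t + \<omega>) - w t)) \<longlongrightarrow> 0) at_top"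
    proof (rule Lim_null_comparison[OF _ lim])
      show "\<forall>\<^sub>F t in at_top. norm (nrm (w (t + \<omega>) - w t)) \<le> ks_integral (\<lambda>s. M s N) g 0 (t
          + \<omega>) - ks_integral (\<lambda>s. M s N) g 0 t"
        using eventually_ge_at_top[of 0]
      proof eventually_elim
        case (elim t)
        have gs: "g 0 \<le> g t" "g t \<le> g (t + \<omega>)" using S.g_le elim \<omega> by auto
        have "nrm (w (t + \<omega>) - w t) \<le> integral {g t..g (t + \<omega>)} m" unfolding w_def by (rule W_incr[OF gs])
        also have "\<dots> = integral {g 0..g (t + \<omega>)} m - integral {g 0..g t} m"
          using Henstock_Kurzweil_Integration.integral_combine[OF gs m_int] by simp
        also have "\<dots> = ks_integral (\<lambda>s. M s N) g 0 (t + \<omega>) - ks_integral (\<lambda>s. M s N) g 0 t"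
          using m_J[of 0 "t + \<omega>"] m_J[of 0 t] elim \<omega> by simp
        finally show ?case using nD(1) by simp
      qed
    qed
  qed
  have h_per: "((\<lambda>t. h (t + \<omega>) (x (t + \<omega>)) - h t (x (t + \<omega>))) \<longlongrightarrow> 0) at_top"
  proof (rule tendstoI)
    fix e :: real assume "e > 0"
    have "bounded {u. nrm u \<le> N}" using is_norm_ball(1)[OF nrm] by (rule compact_imp_bounded)
    then have "uniform_limit {u. nrm u \<le> N} (\<lambda>t u. h (t + \<omega>) u - h t u) (\<lambda>u. 0) at_top"
      using a unfolding unif_S_asymp_periodic_on_bounded_def by blast
    from uniform_limitD[OF this \<open>e > 0\<close>] eventually_ge_at_top[of 0]
    show "\<forall>\<^sub>F t in at_top. dist (h (t + \<omega>) (x (t + \<omega>)) - h t (x (t + \<omega>))) 0 < e"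
      by eventually_elim (use xN \<omega> in auto)
  qed
  have "((\<lambda>t. x (t + \<omega>) - x t) \<longlongrightarrow> 0) at_top"
  proof (rule C.tendsto_of_residual[where t' = "\<lambda>t. t"])
    show "\<forall>\<^sub>F t in at_top. t \<ge> 0 \<and> nrm (x (t + \<omega>)) \<le> N \<and> nrm (x t) \<le> N"
      using eventually_ge_at_top[of 0] by eventually_elim (use xN \<omega> in auto)
    have "((\<lambda>t. (w (t + \<omega>) - w t) + (h (t + \<omega>) (x (t + \<omega>)) - h t (x (t + \<omega>)))) \<longlongrightarrow> 0 + 0) at_top"
      by (intro tendsto_add w_per h_per)
    then have "((\<lambda>t. (w (t + \<omega>) - w t) + (h (t + \<omega>) (x (t + \<omega>)) - h t (x (t + \<omega>)))) \<longlongrightarrow> 0) at_top" by simp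
    then show "((\<lambda>t. (x (t + \<omega>) - h t (x (t + \<omega>))) - (x t - h t (x t))) \<longlongrightarrow> 0) at_top"
    proof (rule Lim_transform_eventually)
      show "\<forall>\<^sub>F t in at_top. (w (t + \<omega>) - w t) + (h (t + \<omega>) (x (t + \<omega>)) - h t (x (t + \<omega>)))
          = (x (t + \<omega>) - h t (x (t + \<omega>))) - (x t - h t (x t))"
        using eventually_ge_at_top[of 0]
      proof eventually_elim
        case (elim t)
        have e: "x (t + \<omega>) - h (t + \<omega>) (x (t + \<omega>)) = c0 + w (t + \<omega>)" using x_eq elim \<omega> by simp
        have "(x (t + \<omega>) - h t (x (t + \<omega>))) - (x t - h t (x t))
            = (x (t + \<omega>) - h (t + \<omega>) (x (t + \<omega>))) - (x t - h t (x t))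
              + (h (t + \<omega>) (x (t + \<omega>)) - h t (x (t + \<omega>)))" by simp
        then show ?case unfolding e x_eq[OF elim] by simp
      qed
    qed
  qed
  moreover have "bounded (x ` {0..})"
    by (rule bounded_subset[OF compact_imp_bounded[OF is_norm_ball(1)[OF nrm, of N]]]) (use xN in auto)
  ultimately have "S_asymp_periodic \<omega> x" using x_reg by (simp add: S_asymp_periodic_def)
  with sol show ?thesis by blast
qed

end
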